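(* Let $H$ be an infinite abelian group (written additively), $\beta$ an aperiodic automorphism of $H$, and $G=H\rtimes\mathbb{Z}$ the semidirect product for the action $k\cdot x=\beta^k(x)$ of $\mathbb{Z}$ on $H$. Let $\sigma'\in Z^2(H,\mathbb{T})$ be $\mathbb{Z}$-invariant, i.e. $\sigma'(k\cdot x,k\cdot y)=\sigma'(x,y)$ for all $x,y\in H$, $k\in\mathbb{Z}$, and let $\sigma\in Z^2(G,\mathbb{T})$ be given by $\sigma((x,k),(y,l))=\sigma'(x,k\cdot y)$. Consider the following conditions: (i) $(H,\sigma')$ satisfies Kleppner's condition. (ii) $(G,\sigma)$ has the unique trace property. (iii) $(G,\sigma)$ is $C^*$-simple. Then (i) and (ii) are equivalent, and they imply (iii). Moreover, if $H$ is countable, then (iii) holds if and only if $\widetilde\beta$ acts minimally on $C_r^*(H,\sigma')$, where $\widetilde\beta$ is the $*$-automorphism of $C_r^*(H,\sigma')$ determined by $\widetilde\beta(\lambda_{\sigma'}(x))=\lambda_{\sigma'}(\beta(x))$ for all $x\in H$.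
   Context: For a discrete group $G$ with identity $e$, $Z^2(G,\mathbb{T})$ is the set of normalized 2-cocycles, i.e. maps $\sigma:G\times G\to\mathbb{T}$ with $\sigma(g,e)=\sigma(e,g)=1$ and $\sigma(g,h)\sigma(gh,k)=\sigma(h,k)\sigma(g,hk)$ for all $g,h,k$. With $(\lambda_\sigma(g)\xi)(h)=\sigma(g,g^{-1}h)\xi(g^{-1}h)$ on $\ell^2(G)$, $C_r^*(G,\sigma)$ is the C$^*$-algebra generated by $\lambda_\sigma(G)$. $(G,\sigma)$ is $C^*$-simple if $C_r^*(G,\sigma)$ is simple, and has the unique trace property if $C_r^*(G,\sigma)$ has a unique tracial state. An element $g\in G$ is $\sigma$-regular if $\sigma(g,h)=\sigma(h,g)$ whenever $h\in G$ commutes with $g$ (a property of conjugacy classes); $(G,\sigma)$ satisfies Kleppner's condition if every nontrivial $\sigma$-regular conjugacy class of $G$ is infinite. An automorphism $\beta$ of $H$ is aperiodic if the orbit $\{\beta^k(x):k\in\mathbb{Z}\}$ of every nontrivial $x\in H$ is infinite. An automorphism $\alpha$ of a C$^*$-algebra $A$ acts minimally on $A$ if the zero ideal is the only proper two-sided closed ideal of $A$ that is invariant under $\alpha$ (i.e. under the $\mathbb{Z}$-action generated by $\alpha$). *)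

theory Defs
  imports "HOL-Analysis.Analysis" "HOL-Algebra.Bij" "HOL-Algebra.Elementary_Groups"
begin

section \<open>The Hilbert space of square-summable functions\<close>

typedef 'a ell2 = "{f :: 'a \<Rightarrow> complex. (\<lambda>x. (cmod (f x))\<^sup>2) summable_on UNIV}"
  morphisms ell2_apply Abs_ell2
  by (rule exI[of _ "\<lambda>_. 0"]) auto

setup_lifting type_definition_ell2

lemma square_summable_mult:
  fixes f g :: "'a \<Rightarrow> complex"
  assumes "(\<lambda>x. (cmod (f x))\<^sup>2) summable_on UNIV" "(\<lambda>x. (cmod (g x))\<^sup>2) summable_on UNIV"
  shows "(\<lambda>x. cnj (f x) * g x) summable_on UNIV"
proof -
  have "(\<lambda>x. norm (cnj (f x) * g x)) summable_on UNIV"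
  proof (rule summable_on_comparison_test)
    show "(\<lambda>x. (cmod (f x))\<^sup>2 + (cmod (g x))\<^sup>2) summable_on UNIV"
      using assms by (rule summable_on_add)
    fix x
    have "0 \<le> (cmod (f x) - cmod (g x))\<^sup>2" by simp
    then have "2 * (cmod (f x) * cmod (g x)) \<le> (cmod (f x))\<^sup>2 + (cmod (g x))\<^sup>2"
      by (simp add: power2_diff)
    moreover have "0 \<le> cmod (f x) * cmod (g x)" by simp
    ultimately have "cmod (f x) * cmod (g x) \<le> (cmod (f x))\<^sup>2 + (cmod (g x))\<^sup>2"
      by linarith
    then show "norm (cnj (f x) * g x) \<le> (cmod (f x))\<^sup>2 + (cmod (g x))\<^sup>2"
      by (simp add: norm_mult)
  qed auto
  then show ?thesis by (rule abs_summable_summable)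
qed

lemma square_summable_add:
  fixes f g :: "'a \<Rightarrow> complex"
  assumes "(\<lambda>x. (cmod (f x))\<^sup>2) summable_on UNIV" "(\<lambda>x. (cmod (g x))\<^sup>2) summable_on UNIV"
  shows "(\<lambda>x. (cmod (f x + g x))\<^sup>2) summable_on UNIV"
proof (rule summable_on_comparison_test)
  show "(\<lambda>x. 2 * ((cmod (f x))\<^sup>2 + (cmod (g x))\<^sup>2)) summable_on UNIV"
    by (intro summable_on_cmult_right summable_on_add assms)
  fix x
  have "(cmod (f x + g x))\<^sup>2 \<le> (cmod (f x) + cmod (g x))\<^sup>2"
    by (intro power_mono norm_triangle_ineq) auto
  moreover have "0 \<le> (cmod (f x) - cmod (g x))\<^sup>2" by simp
  ultimately show "(cmod (f x + g x))\<^sup>2 \<le> 2 * ((cmod (f x))\<^sup>2 + (cmod (g x))\<^sup>2)"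
    by (simp add: power2_diff power2_sum)
qed auto

lemma square_summable_cmult:
  fixes f :: "'a \<Rightarrow> complex"
  assumes "(\<lambda>x. (cmod (f x))\<^sup>2) summable_on UNIV"
  shows "(\<lambda>x. (cmod (c * f x))\<^sup>2) summable_on UNIV"
  unfolding norm_mult power_mult_distrib by (intro summable_on_cmult_right assms)

lift_definition ell2_cinner :: "'a ell2 \<Rightarrow> 'a ell2 \<Rightarrow> complex"
  is "\<lambda>f g. \<Sum>\<^sub>\<infinity>x. cnj (f x) * g x" .

lift_definition ell2_scaleC :: "complex \<Rightarrow> 'a ell2 \<Rightarrow> 'a ell2"
  is "\<lambda>c f x. c * f x" by (simp add: square_summable_cmult)

instantiation ell2 :: (type) real_vector
begin

lift_definition zero_ell2 :: "'a ell2" is "\<lambda>_. 0" by simp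
lift_definition plus_ell2 :: "'a ell2 \<Rightarrow> 'a ell2 \<Rightarrow> 'a ell2" is "\<lambda>f g x. f x + g x"
  by (simp add: square_summable_add)
lift_definition uminus_ell2 :: "'a ell2 \<Rightarrow> 'a ell2" is "\<lambda>f x. - f x" by simp
lift_definition minus_ell2 :: "'a ell2 \<Rightarrow> 'a ell2 \<Rightarrow> 'a ell2" is "\<lambda>f g x. f x - g x"
  subgoal for f g using square_summable_add[of f "\<lambda>x. - g x"] by simp
  done
lift_definition scaleR_ell2 :: "real \<Rightarrow> 'a ell2 \<Rightarrow> 'a ell2" is "\<lambda>r f x. complex_of_real r * f x"
  by (simp add: square_summable_cmult)

instance
proof
  fix x y z :: "'a ell2" and r s :: real
  show "x + y + z = x + (y + z)" by transfer (simp add: algebra_simps)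
  show "x + y = y + x" by transfer (simp add: algebra_simps)
  show "0 + x = x" by transfer simp
  show "- x + x = 0" by transfer simp
  show "x - y = x + - y" by transfer simp
  show "r *\<^sub>R (x + y) = r *\<^sub>R x + r *\<^sub>R y" by transfer (simp add: algebra_simps)
  show "(r + s) *\<^sub>R x = r *\<^sub>R x + s *\<^sub>R x" by transfer (simp add: algebra_simps)
  show "r *\<^sub>R s *\<^sub>R x = (r * s) *\<^sub>R x" by transfer (simp add: algebra_simps)
  show "1 *\<^sub>R x = x" by transfer simp
qed

end

lemma ell2_cinner_self:
  "ell2_cinner \<xi> \<xi> = complex_of_real (\<Sum>\<^sub>\<infinity>x. (cmod (ell2_apply \<xi> x))\<^sup>2)"
proof -
  have *: "cnj z * z = complex_of_real ((cmod z)\<^sup>2)" for z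
    by (metis complex_norm_square mult.commute)
  have "(\<lambda>x. (cmod (ell2_apply \<xi> x))\<^sup>2) summable_on UNIV"
    using ell2_apply[of \<xi>] by simp
  then show ?thesis
    unfolding ell2_cinner.rep_eq *
    by (intro infsum_bounded_linear_strong bounded_linear_of_real) (simp add: summable_on_of_real del: of_real_power)
qed

instantiation ell2 :: (type) real_inner
begin

definition inner_ell2 :: "'a ell2 \<Rightarrow> 'a ell2 \<Rightarrow> real"
  where "inner_ell2 \<xi> \<eta> = Re (ell2_cinner \<xi> \<eta>)"
definition norm_ell2 :: "'a ell2 \<Rightarrow> real"
  where "norm_ell2 \<xi> = sqrt (inner \<xi> \<xi>)"
definition sgn_ell2 :: "'a ell2 \<Rightarrow> 'a ell2"
  where "sgn_ell2 \<xi> = \<xi> /\<^sub>R norm \<xi>"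
definition dist_ell2 :: "'a ell2 \<Rightarrow> 'a ell2 \<Rightarrow> real"
  where "dist_ell2 \<xi> \<eta> = norm (\<xi> - \<eta>)"
definition uniformity_ell2 :: "('a ell2 \<times> 'a ell2) filter"
  where "uniformity_ell2 = (INF e\<in>{0 <..}. principal {(x, y). dist x y < e})"
definition open_ell2 :: "'a ell2 set \<Rightarrow> bool"
  where "open_ell2 U = (\<forall>x\<in>U. eventually (\<lambda>(x', y). x' = x \<longrightarrow> y \<in> U) uniformity)"

instance
proof
  fix x y z :: "'a ell2" and r :: real
  show "dist x y = norm (x - y)" by (simp add: dist_ell2_def)
  show "sgn x = x /\<^sub>R norm x" by (simp add: sgn_ell2_def)
  show "uniformity = (INF e\<in>{0 <..}. principal {(x, y :: 'a ell2). dist x y < e})"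
    by (rule uniformity_ell2_def)
  show "open U = (\<forall>x\<in>U. \<forall>\<^sub>F (x', y) in uniformity. x' = x \<longrightarrow> y \<in> U)" for U :: "'a ell2 set"
    by (rule open_ell2_def)
  show "norm x = sqrt (inner x x)" by (rule norm_ell2_def)
  have "ell2_cinner x y = cnj (ell2_cinner y x)"
    by (simp add: ell2_cinner.rep_eq mult.commute flip: infsum_cnj)
  then show "inner x y = inner y x" by (simp add: inner_ell2_def)
  have "ell2_cinner (x + y) z = ell2_cinner x z + ell2_cinner y z"
    by transfer (simp add: distrib_right infsum_add square_summable_mult)
  then show "inner (x + y) z = inner x z + inner y z" by (simp add: inner_ell2_def)
  have "ell2_cinner (r *\<^sub>R x) y = complex_of_real r * ell2_cinner x y"
    by transfer (simp add: mult.assoc infsum_cmult_right')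
  then show "inner (r *\<^sub>R x) y = r * inner x y" by (simp add: inner_ell2_def)
  show "0 \<le> inner x x"
    by (simp add: inner_ell2_def ell2_cinner_self infsum_nonneg)
  show "(inner x x = 0) = (x = 0)"
  proof
    assume "inner x x = 0"
    then have *: "(\<Sum>\<^sub>\<infinity>a. (cmod (ell2_apply x a))\<^sup>2) = 0"
      by (simp add: inner_ell2_def ell2_cinner_self)
    have "ell2_apply x a = 0" for a
      using nonneg_infsum_le_0D[of "\<lambda>a. (cmod (ell2_apply x a))\<^sup>2" UNIV a] * ell2_apply[of x]
      by simp
    then show "x = 0" by transfer auto
  next
    assume "x = 0"
    then show "inner x x = 0" by (simp add: inner_ell2_def ell2_cinner_self zero_ell2.rep_eq)
  qed
qed

end

lemma norm_ell2_eq: "norm \<xi> = sqrt (\<Sum>\<^sub>\<infinity>x. (cmod (ell2_apply \<xi> x))\<^sup>2)"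
  by (simp add: norm_ell2_def inner_ell2_def ell2_cinner_self)

lemma ell2_scaleC_scaleR: "ell2_scaleC c (r *\<^sub>R \<xi>) = r *\<^sub>R ell2_scaleC c \<xi>"
  by transfer (simp add: algebra_simps)

lemma ell2_scaleC_add: "ell2_scaleC c (\<xi> + \<eta>) = ell2_scaleC c \<xi> + ell2_scaleC c \<eta>"
  by transfer (simp add: algebra_simps)

lemma norm_ell2_scaleC: "norm (ell2_scaleC c \<xi>) = cmod c * norm \<xi>"
  by (simp add: norm_ell2_eq ell2_scaleC.rep_eq norm_mult power_mult_distrib infsum_cmult_right'
      real_sqrt_mult)

section \<open>Concrete C*-algebras of operators on this Hilbert space\<close>

text \<open>The library's bounded operators are real-linear; complex linearity is required
  separately, in the definition of a C*-subalgebra.\<close>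

type_synonym 'a op = "'a ell2 \<Rightarrow>\<^sub>L 'a ell2"

lemma bounded_linear_ell2_scaleC: "bounded_linear (ell2_scaleC c)"
  by (rule bounded_linear_intro[where K = "cmod c"])
    (simp_all add: ell2_scaleC_add ell2_scaleC_scaleR norm_ell2_scaleC)

definition op_scaleC :: "complex \<Rightarrow> 'a op \<Rightarrow> 'a op"
  where "op_scaleC c A = Blinfun (\<lambda>\<xi>. ell2_scaleC c (blinfun_apply A \<xi>))"

lemma op_scaleC_apply: "blinfun_apply (op_scaleC c A) \<xi> = ell2_scaleC c (blinfun_apply A \<xi>)"
  by (simp add: op_scaleC_def bounded_linear_Blinfun_apply
      bounded_linear_compose[OF bounded_linear_ell2_scaleC blinfun.bounded_linear_right])

definition complex_linear_op :: "'a op \<Rightarrow> bool"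
  where "complex_linear_op A \<longleftrightarrow>
    (\<forall>c \<xi>. blinfun_apply A (ell2_scaleC c \<xi>) = ell2_scaleC c (blinfun_apply A \<xi>))"

definition is_adjoint :: "'a op \<Rightarrow> 'a op \<Rightarrow> bool"
  where "is_adjoint A B \<longleftrightarrow>
    (\<forall>\<xi> \<eta>. ell2_cinner (blinfun_apply A \<xi>) \<eta> = ell2_cinner \<xi> (blinfun_apply B \<eta>))"

definition complex_subspace :: "'a op set \<Rightarrow> bool"
  where "complex_subspace S \<longleftrightarrow>
    0 \<in> S \<and> (\<forall>a\<in>S. \<forall>b\<in>S. a + b \<in> S) \<and> (\<forall>c. \<forall>a\<in>S. op_scaleC c a \<in> S)"

definition cstar_subalgebra :: "'a op set \<Rightarrow> bool"
  where "cstar_subalgebra A \<longleftrightarrow>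
    (\<forall>a\<in>A. complex_linear_op a) \<and> complex_subspace A \<and> closed A \<and>
    (\<forall>a\<in>A. \<forall>b\<in>A. a o\<^sub>L b \<in> A) \<and> (\<forall>a\<in>A. \<forall>b. is_adjoint a b \<longrightarrow> b \<in> A)"

definition closed_ideal :: "'a op set \<Rightarrow> 'a op set \<Rightarrow> bool"
  where "closed_ideal A I \<longleftrightarrow>
    I \<subseteq> A \<and> complex_subspace I \<and> closed I \<and>
    (\<forall>a\<in>A. \<forall>x\<in>I. a o\<^sub>L x \<in> I \<and> x o\<^sub>L a \<in> I)"

definition simple_cstar :: "'a op set \<Rightarrow> bool"
  where "simple_cstar A \<longleftrightarrow> {I. closed_ideal A I \<and> I \<noteq> A} = {{0}}"

text \<open>Tracial states of a unital algebra \<open>A\<close>, whose unit need not be the identity operator.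
  They are taken to be undefined outside \<open>A\<close>, so that equality means agreement on \<open>A\<close>.\<close>

definition tracial_states :: "'a op set \<Rightarrow> ('a op \<Rightarrow> complex) set"
  where "tracial_states A = {\<tau> \<in> extensional A.
    (\<forall>a\<in>A. \<forall>b\<in>A. \<tau> (a + b) = \<tau> a + \<tau> b) \<and>
    (\<forall>c. \<forall>a\<in>A. \<tau> (op_scaleC c a) = c * \<tau> a) \<and>
    (\<forall>a\<in>A. \<forall>b. is_adjoint a b \<longrightarrow> \<tau> (b o\<^sub>L a) \<in> \<real>\<^sub>\<ge>\<^sub>0) \<and>
    (\<exists>u\<in>A. (\<forall>a\<in>A. u o\<^sub>L a = a \<and> a o\<^sub>L u = a) \<and> \<tau> u = 1) \<and>
    (\<forall>a\<in>A. \<forall>b\<in>A. \<tau> (a o\<^sub>L b) = \<tau> (b o\<^sub>L a))}"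

definition star_automorphism :: "'a op set \<Rightarrow> ('a op \<Rightarrow> 'a op) \<Rightarrow> bool"
  where "star_automorphism A \<Phi> \<longleftrightarrow>
    bij_betw \<Phi> A A \<and>
    (\<forall>a\<in>A. \<forall>b\<in>A. \<Phi> (a + b) = \<Phi> a + \<Phi> b) \<and>
    (\<forall>c. \<forall>a\<in>A. \<Phi> (op_scaleC c a) = op_scaleC c (\<Phi> a)) \<and>
    (\<forall>a\<in>A. \<forall>b\<in>A. \<Phi> (a o\<^sub>L b) = \<Phi> a o\<^sub>L \<Phi> b) \<and>
    (\<forall>a\<in>A. \<forall>b\<in>A. is_adjoint a b \<longrightarrow> is_adjoint (\<Phi> a) (\<Phi> b))"

text \<open>Invariance under the action of the integers generated by \<open>\<Phi>\<close> amounts to \<open>\<Phi> ` I = I\<close>.\<close>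

definition acts_minimally :: "'a op set \<Rightarrow> ('a op \<Rightarrow> 'a op) \<Rightarrow> bool"
  where "acts_minimally A \<Phi> \<longleftrightarrow> {I. closed_ideal A I \<and> I \<noteq> A \<and> \<Phi> ` I = I} = {{0}}"

section \<open>Twisted group C*-algebras\<close>

definition two_cocycles :: "('a, 'm) monoid_scheme \<Rightarrow> ('a \<Rightarrow> 'a \<Rightarrow> complex) set"
  where "two_cocycles G = {\<sigma>.
    (\<forall>g\<in>carrier G. \<forall>h\<in>carrier G. cmod (\<sigma> g h) = 1) \<and>
    (\<forall>g\<in>carrier G. \<sigma> g \<one>\<^bsub>G\<^esub> = 1 \<and> \<sigma> \<one>\<^bsub>G\<^esub> g = 1) \<and>
    (\<forall>g\<in>carrier G. \<forall>h\<in>carrier G. \<forall>k\<in>carrier G.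
      \<sigma> g h * \<sigma> (g \<otimes>\<^bsub>G\<^esub> h) k = \<sigma> h k * \<sigma> g (h \<otimes>\<^bsub>G\<^esub> k))}"

text \<open>A group \<open>G\<close> has a carrier inside an ambient type \<open>'a\<close>. We identify \<open>\<ell>\<^sup>2(G)\<close> with the
  functions in \<open>'a ell2\<close> supported on \<open>carrier G\<close>; the operators of the regular representation
  are extended by zero on its orthogonal complement, which changes neither the norm nor
  the algebraic structure. The unit of the reduced algebra is then the projection
  onto \<open>\<ell>\<^sup>2(G)\<close>.\<close>

definition twisted_translate ::
    "('a, 'm) monoid_scheme \<Rightarrow> ('a \<Rightarrow> 'a \<Rightarrow> complex) \<Rightarrow> 'a \<Rightarrow> ('a \<Rightarrow> complex) \<Rightarrow> 'a \<Rightarrow> complex"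
  where "twisted_translate G \<sigma> g f h =
    (if h \<in> carrier G then \<sigma> g (inv\<^bsub>G\<^esub> g \<otimes>\<^bsub>G\<^esub> h) * f (inv\<^bsub>G\<^esub> g \<otimes>\<^bsub>G\<^esub> h) else 0)"

definition twisted_regular ::
    "('a, 'm) monoid_scheme \<Rightarrow> ('a \<Rightarrow> 'a \<Rightarrow> complex) \<Rightarrow> 'a \<Rightarrow> 'a op"
  where "twisted_regular G \<sigma> g =
    Blinfun (\<lambda>\<xi>. Abs_ell2 (twisted_translate G \<sigma> g (ell2_apply \<xi>)))"

text \<open>For a cocycle, the formula above does define a bounded operator on square-summable
  functions, so that neither \<open>Abs_ell2\<close> nor \<open>Blinfun\<close> is applied outside its domain.\<close>

lemma
  assumes G: "group G" and \<sigma>: "\<sigma> \<in> two_cocycles G" and g: "g \<in> carrier G"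
    and f: "(\<lambda>h. (cmod (f h))\<^sup>2) summable_on UNIV"
  shows twisted_translate_summable:
      "(\<lambda>h. (cmod (twisted_translate G \<sigma> g f h))\<^sup>2) summable_on UNIV"
    and twisted_translate_infsum_le:
      "(\<Sum>\<^sub>\<infinity>h. (cmod (twisted_translate G \<sigma> g f h))\<^sup>2) \<le> (\<Sum>\<^sub>\<infinity>h. (cmod (f h))\<^sup>2)"
proof -
  interpret group G by (rule G)
  let ?t = "\<lambda>h. inv\<^bsub>G\<^esub> g \<otimes>\<^bsub>G\<^esub> h"
  let ?F = "\<lambda>h. (cmod (f h))\<^sup>2"
  let ?L = "\<lambda>h. (cmod (twisted_translate G \<sigma> g f h))\<^sup>2"
  have inj: "inj_on ?t (carrier G)"
    using g by (simp add: inj_on_cmult)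
  have L: "?L h = (?F \<circ> ?t) h" if "h \<in> carrier G" for h
    using that g \<sigma> by (simp add: twisted_translate_def two_cocycles_def norm_mult)
  have FU: "?F summable_on A" for A
    using f by (rule summable_on_subset_banach) auto
  have "(?F \<circ> ?t) summable_on carrier G"
    using summable_on_reindex[OF inj, of ?F] FU by blast
  then have "?L summable_on carrier G"
    using L by (simp cong: summable_on_cong)
  moreover have "?L summable_on UNIV \<longleftrightarrow> ?L summable_on carrier G"
    by (rule summable_on_cong_neutral) (auto simp: twisted_translate_def)
  ultimately show "?L summable_on UNIV" by simp
  have "infsum ?L UNIV = infsum ?L (carrier G)"
    by (rule infsum_cong_neutral) (auto simp: twisted_translate_def)
  also have "\<dots> = infsum (?F \<circ> ?t) (carrier G)"
    using L by (rule infsum_cong)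
  also have "\<dots> = infsum ?F (?t ` carrier G)"
    by (rule infsum_reindex[OF inj, symmetric])
  also have "\<dots> \<le> infsum ?F UNIV"
    by (rule infsum_mono2) (auto intro: FU)
  finally show "infsum ?L UNIV \<le> infsum ?F UNIV" .
qed

lemma twisted_regular_apply:
  assumes "group G" "\<sigma> \<in> two_cocycles G" "g \<in> carrier G"
  shows "ell2_apply (blinfun_apply (twisted_regular G \<sigma> g) \<xi>) h =
    (if h \<in> carrier G
     then \<sigma> g (inv\<^bsub>G\<^esub> g \<otimes>\<^bsub>G\<^esub> h) * ell2_apply \<xi> (inv\<^bsub>G\<^esub> g \<otimes>\<^bsub>G\<^esub> h) else 0)"
proof -
  let ?T = "\<lambda>\<xi>. Abs_ell2 (twisted_translate G \<sigma> g (ell2_apply \<xi>))"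
  have rep: "ell2_apply (?T \<xi>) = twisted_translate G \<sigma> g (ell2_apply \<xi>)" for \<xi>
    using twisted_translate_summable[OF assms] ell2_apply[of \<xi>] by (simp add: Abs_ell2_inverse)
  have "bounded_linear ?T"
  proof (rule bounded_linear_intro[where K = 1])
    fix x y :: "'a ell2" and r :: real
    show "?T (x + y) = ?T x + ?T y"
      unfolding ell2_apply_inject[symmetric] rep unfolding plus_ell2.rep_eq rep
      by (simp add: fun_eq_iff twisted_translate_def algebra_simps)
    show "?T (r *\<^sub>R x) = r *\<^sub>R ?T x"
      unfolding ell2_apply_inject[symmetric] rep unfolding scaleR_ell2.rep_eq rep
      by (simp add: fun_eq_iff twisted_translate_def algebra_simps)
    show "norm (?T x) \<le> norm x * 1"
      using twisted_translate_infsum_le[OF assms] ell2_apply[of x]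
      by (simp add: norm_ell2_eq rep)
  qed
  then show ?thesis
    by (simp add: twisted_regular_def bounded_linear_Blinfun_apply rep twisted_translate_def)
qed

definition reduced_twisted_cstar ::
    "('a, 'm) monoid_scheme \<Rightarrow> ('a \<Rightarrow> 'a \<Rightarrow> complex) \<Rightarrow> 'a op set"
  where "reduced_twisted_cstar G \<sigma> = cstar_subalgebra hull (twisted_regular G \<sigma> ` carrier G)"

definition cstar_simple :: "('a, 'm) monoid_scheme \<Rightarrow> ('a \<Rightarrow> 'a \<Rightarrow> complex) \<Rightarrow> bool"
  where "cstar_simple G \<sigma> \<longleftrightarrow> simple_cstar (reduced_twisted_cstar G \<sigma>)"

definition unique_trace_property :: "('a, 'm) monoid_scheme \<Rightarrow> ('a \<Rightarrow> 'a \<Rightarrow> complex) \<Rightarrow> bool"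
  where "unique_trace_property G \<sigma> \<longleftrightarrow> (\<exists>!\<tau>. \<tau> \<in> tracial_states (reduced_twisted_cstar G \<sigma>))"

definition cocycle_regular :: "('a, 'm) monoid_scheme \<Rightarrow> ('a \<Rightarrow> 'a \<Rightarrow> complex) \<Rightarrow> 'a \<Rightarrow> bool"
  where "cocycle_regular G \<sigma> g \<longleftrightarrow>
    (\<forall>h\<in>carrier G. g \<otimes>\<^bsub>G\<^esub> h = h \<otimes>\<^bsub>G\<^esub> g \<longrightarrow> \<sigma> g h = \<sigma> h g)"

definition conjugacy_class :: "('a, 'm) monoid_scheme \<Rightarrow> 'a \<Rightarrow> 'a set"
  where "conjugacy_class G g = (\<lambda>h. h \<otimes>\<^bsub>G\<^esub> g \<otimes>\<^bsub>G\<^esub> inv\<^bsub>G\<^esub> h) ` carrier G"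

definition kleppner_condition :: "('a, 'm) monoid_scheme \<Rightarrow> ('a \<Rightarrow> 'a \<Rightarrow> complex) \<Rightarrow> bool"
  where "kleppner_condition G \<sigma> \<longleftrightarrow>
    (\<forall>g\<in>carrier G. g \<noteq> \<one>\<^bsub>G\<^esub> \<and> cocycle_regular G \<sigma> g \<longrightarrow> infinite (conjugacy_class G g))"

section \<open>Semidirect products by a single automorphism\<close>

text \<open>The integer powers of an automorphism are formed in the library's automorphism group,
  whose elements are undefined outside the carrier.\<close>

abbreviation aut_power :: "('a, 'm) monoid_scheme \<Rightarrow> ('a \<Rightarrow> 'a) \<Rightarrow> int \<Rightarrow> 'a \<Rightarrow> 'a"
  where "aut_power H \<beta> k \<equiv> \<beta> [^]\<^bsub>AutoGroup H\<^esub> k"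

definition aperiodic :: "('a, 'm) monoid_scheme \<Rightarrow> ('a \<Rightarrow> 'a) \<Rightarrow> bool"
  where "aperiodic H \<beta> \<longleftrightarrow>
    (\<forall>x\<in>carrier H. x \<noteq> \<one>\<^bsub>H\<^esub> \<longrightarrow> infinite (range (\<lambda>k. aut_power H \<beta> k x)))"

definition semidirect_product ::
    "('a, 'm) monoid_scheme \<Rightarrow> ('b, 'n) monoid_scheme \<Rightarrow> ('b \<Rightarrow> 'a \<Rightarrow> 'a) \<Rightarrow> ('a \<times> 'b) monoid"
  where "semidirect_product N K \<phi> =
    \<lparr>carrier = carrier N \<times> carrier K,
     monoid.mult = (\<lambda>(x, k) (y, l). (x \<otimes>\<^bsub>N\<^esub> \<phi> k y, k \<otimes>\<^bsub>K\<^esub> l)),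
     one = (\<one>\<^bsub>N\<^esub>, \<one>\<^bsub>K\<^esub>)\<rparr>"

definition induced_automorphism ::
    "('a, 'm) monoid_scheme \<Rightarrow> ('a \<Rightarrow> 'a \<Rightarrow> complex) \<Rightarrow> ('a \<Rightarrow> 'a) \<Rightarrow> 'a op \<Rightarrow> 'a op"
  where "induced_automorphism H \<sigma> \<beta> =
    (THE \<Phi>. \<Phi> \<in> extensional (reduced_twisted_cstar H \<sigma>) \<and>
      star_automorphism (reduced_twisted_cstar H \<sigma>) \<Phi> \<and>
      (\<forall>x\<in>carrier H. \<Phi> (twisted_regular H \<sigma> x) = twisted_regular H \<sigma> (\<beta> x)))"

end

theory Submission
  imports Defs "HOL-Real_Asymp.Real_Asymp"
begin

text \<open>
  Since \<open>H\<close> is abelian, its conjugacy classes are singletons, and Kleppner's condition says that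
  every nontrivial \<open>x\<close> fails to commute, up to the cocycle, with some \<open>y\<close>. The proof shows that this
  is equivalent to each of: the unique trace property of \<open>(G, \<sigma>)\<close>, the simplicity of \<open>C*(G, \<sigma>)\<close>, and
  the minimality of the induced automorphism on \<open>C*(H, \<sigma>')\<close>.

  Suppose that Kleppner's condition holds. Averages of conjugates by the unitaries of \<open>H\<close> send every
  nontrivial generator to zero in norm. For a generator of \<open>H\<close>, conjugation by a suitable
  \<open>y\<close> multiplies it by some \<open>z \<noteq> 1\<close> on the unit circle, so that the mean of the
  two has norm below one, and iterating gives zero. For a generator at \<open>(x, k)\<close> with \<open>k \<noteq> 0\<close>,
  aperiodicity gives infinitely many conjugates by elements of \<open>H\<close>. The mean \<open>X\<close> of \<open>n\<close> of them satisfies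
  \<open>X* X = 1/n\<close> modulo nontrivial generators of \<open>H\<close>, and the Kadison inequality
  \<open>P(X)* P(X) \<le> P(X* X)\<close> for averages \<open>P\<close> bounds \<open>P(X)\<close> by about \<open>1/sqrt n\<close>. These averages commute, so
  every \<open>a\<close> can be averaged to \<open>\<tau>(a) 1\<close>, where \<open>\<tau>\<close> is the canonical trace (\<open>averages_to_trace\<close>).
  Closed ideals and tracial states are stable under averaging and \<open>\<tau>\<close> is faithful, which gives
  simplicity and the unique trace property (\<open>simple_of_averaging\<close>, \<open>unique_trace_of_averaging\<close>).
  The same argument inside \<open>H\<close> shows that \<open>C*(H, \<sigma>')\<close> is simple, whence minimality.

  Suppose that Kleppner's condition fails, and let \<open>S\<close> be the nontrivial group of regular elements of
  \<open>H\<close>. On \<open>S\<close> the cocycle is symmetric. As the circle is divisible, it is the coboundary of a function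
  \<open>b\<close>; as \<open>\<beta>\<close> has no nontrivial fixed points, \<open>b\<close> can moreover be chosen \<open>\<beta>\<close>-invariant
  (\<open>invariant_trivialization\<close>). Extended by zero, \<open>b\<close> is the restriction to generators of a tracial
  state. To see that this function defines a bounded positive functional on the reduced algebra, one
  realizes it as a limit of vector states, with vectors supported on Folner sets of the abelian group
  \<open>S\<close> (\<open>b_state\<close>). The kernel of this trace is a proper closed ideal containing \<open>\<lambda>(s) - b(s)\<close> for
  \<open>s \<in> S\<close>. On \<open>C*(G, \<sigma>)\<close> the trace is different from \<open>\<tau>\<close> and the ideal is nonzero, so both the
  unique trace property and simplicity fail; on \<open>C*(H, \<sigma>')\<close> the ideal is invariant, so minimality fails.
\<close>


section \<open>The Hilbert space and its operators\<close>

lemma ell2_eqI: "(\<And>x. ell2_apply \<xi> x = ell2_apply \<eta> x) \<Longrightarrow> \<xi> = \<eta>"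
  by (simp add: ell2_apply_inject[symmetric] fun_eq_iff)

lemma ell2_cinner_commute: "ell2_cinner \<xi> \<eta> = cnj (ell2_cinner \<eta> \<xi>)"
  by (simp add: ell2_cinner.rep_eq mult.commute flip: infsum_cnj)

lemma ell2_cinner_add_left: "ell2_cinner (\<xi> + \<eta>) \<zeta> = ell2_cinner \<xi> \<zeta> + ell2_cinner \<eta> \<zeta>"
  by transfer (simp add: distrib_right infsum_add square_summable_mult)

lemma ell2_cinner_add_right: "ell2_cinner \<zeta> (\<xi> + \<eta>) = ell2_cinner \<zeta> \<xi> + ell2_cinner \<zeta> \<eta>"
  by (metis complex_cnj_add ell2_cinner_add_left ell2_cinner_commute)

lemma ell2_cinner_scaleC_left: "ell2_cinner (ell2_scaleC c \<xi>) \<zeta> = cnj c * ell2_cinner \<xi> \<zeta>"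
  by transfer (simp add: mult.assoc infsum_cmult_right')

lemma ell2_cinner_scaleC_right: "ell2_cinner \<zeta> (ell2_scaleC c \<xi>) = c * ell2_cinner \<zeta> \<xi>"
  by (metis complex_cnj_cnj complex_cnj_mult ell2_cinner_commute ell2_cinner_scaleC_left)

lemma ell2_scaleR_scaleC: "r *\<^sub>R \<xi> = ell2_scaleC (complex_of_real r) \<xi>"
  by transfer simp

lemma ell2_scaleC_mult: "ell2_scaleC c (ell2_scaleC d \<xi>) = ell2_scaleC (c * d) \<xi>"
  by transfer (simp add: mult.assoc)

lemma ell2_scaleC_add_left: "ell2_scaleC (c + d) \<xi> = ell2_scaleC c \<xi> + ell2_scaleC d \<xi>"
  by transfer (simp add: distrib_right)

lemma ell2_scaleC_1 [simp]: "ell2_scaleC 1 \<xi> = \<xi>"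
  by transfer simp

lemma ell2_cinner_self_norm: "ell2_cinner \<xi> \<xi> = complex_of_real ((norm \<xi>)\<^sup>2)"
  unfolding ell2_cinner_self by (simp add: norm_ell2_eq infsum_nonneg)

lemma cmod_ell2_cinner_le: "cmod (ell2_cinner \<xi> \<eta>) \<le> norm \<xi> * norm \<eta>"
proof (cases "ell2_cinner \<xi> \<eta> = 0")
  case False
  define z where "z = ell2_cinner \<xi> \<eta>"
  \<comment> \<open>Rotating the second vector makes the inner product positive, so that the real
    Cauchy-Schwarz inequality applies.\<close>
  define c where "c = cnj z / cmod z"
  have "c * z = cmod z"
  proof -
    have "cnj z * z = cmod z * cmod z"
      by (metis complex_norm_square mult.commute of_real_mult power2_eq_square)
    then show ?thesis
      using False by (simp add: c_def z_def)
  qed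
  moreover have "cmod c = 1"
    using False by (simp add: c_def z_def norm_divide)
  moreover have "Re (c * z) \<le> norm \<xi> * norm (ell2_scaleC c \<eta>)"
    using norm_cauchy_schwarz[of \<xi> "ell2_scaleC c \<eta>"]
    by (simp add: inner_ell2_def ell2_cinner_scaleC_right z_def)
  ultimately show ?thesis
    by (simp add: norm_ell2_scaleC z_def)
qed simp

lemma cmod_ell2_apply_le: "cmod (ell2_apply \<xi> x) \<le> norm \<xi>"
proof -
  have "(cmod (ell2_apply \<xi> x))\<^sup>2 = (\<Sum>\<^sub>\<infinity>y\<in>{x}. (cmod (ell2_apply \<xi> y))\<^sup>2)"
    by simp
  also have "\<dots> \<le> (\<Sum>\<^sub>\<infinity>y. (cmod (ell2_apply \<xi> y))\<^sup>2)"
    using ell2_apply[of \<xi>] by (intro infsum_mono2) auto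
  finally show ?thesis
    by (simp add: norm_ell2_eq real_le_rsqrt)
qed

lemma sum_square_le_norm: 
  assumes "finite F"
  shows "(\<Sum>x\<in>F. (cmod (ell2_apply \<xi> x))\<^sup>2) \<le> (norm \<xi>)\<^sup>2"
proof -
  have "(\<Sum>\<^sub>\<infinity>y\<in>F. (cmod (ell2_apply \<xi> y))\<^sup>2) \<le> (\<Sum>\<^sub>\<infinity>y. (cmod (ell2_apply \<xi> y))\<^sup>2)"
    using ell2_apply[of \<xi>] assms by (intro infsum_mono2) auto
  then show ?thesis
    using assms by (simp add: norm_ell2_eq infsum_nonneg)
qed

text \<open>Completeness: a Cauchy sequence converges pointwise, and its bounds on finite partial sums
  survive in the limit.\<close>

instance ell2 :: (type) complete_space
proof
  fix X :: "nat \<Rightarrow> 'a ell2"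
  assume X: "Cauchy X"
  have "Cauchy (\<lambda>n. ell2_apply (X n) x)" for x
  proof (rule metric_CauchyI)
    fix e :: real assume "0 < e"
    then obtain M where M: "\<And>m n. m \<ge> M \<Longrightarrow> n \<ge> M \<Longrightarrow> dist (X m) (X n) < e"
      using X by (meson metric_CauchyD)
    have "dist (ell2_apply (X m) x) (ell2_apply (X n) x) < e" if "m \<ge> M" "n \<ge> M" for m n
      using M[OF that] cmod_ell2_apply_le[of "X m - X n" x]
      by (simp add: dist_norm minus_ell2.rep_eq)
    then show "\<exists>M. \<forall>m\<ge>M. \<forall>n\<ge>M. dist (ell2_apply (X m) x) (ell2_apply (X n) x) < e"
      by blast
  qed
  then have "\<forall>x. \<exists>l. (\<lambda>n. ell2_apply (X n) x) \<longlonglongrightarrow> l"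
    by (simp add: Cauchy_convergent_iff convergent_def)
  then obtain l where l: "\<And>x. (\<lambda>n. ell2_apply (X n) x) \<longlonglongrightarrow> l x"
    by metis
  have partial: "(\<Sum>x\<in>F. (cmod (l x - ell2_apply (X n) x))\<^sup>2) \<le> e\<^sup>2"
    if F: "finite F" and M: "\<And>m. m \<ge> M \<Longrightarrow> dist (X m) (X n) \<le> e" for F n M e
  proof (rule tendsto_upperbound)
    show "(\<lambda>m. \<Sum>x\<in>F. (cmod (ell2_apply (X m) x - ell2_apply (X n) x))\<^sup>2)
        \<longlonglongrightarrow> (\<Sum>x\<in>F. (cmod (l x - ell2_apply (X n) x))\<^sup>2)"
      by (intro tendsto_intros l)
    have "(\<Sum>x\<in>F. (cmod (ell2_apply (X m) x - ell2_apply (X n) x))\<^sup>2) \<le> e\<^sup>2" if "m \<ge> M" for m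
    proof -
      have "(\<Sum>x\<in>F. (cmod (ell2_apply (X m - X n) x))\<^sup>2) \<le> (norm (X m - X n))\<^sup>2"
        by (rule sum_square_le_norm[OF F])
      also have "\<dots> \<le> e\<^sup>2"
        using M[OF that] by (intro power_mono) (auto simp: dist_norm)
      finally show ?thesis
        by (simp add: minus_ell2.rep_eq)
    qed
    then show "\<forall>\<^sub>F m in sequentially.
        (\<Sum>x\<in>F. (cmod (ell2_apply (X m) x - ell2_apply (X n) x))\<^sup>2) \<le> e\<^sup>2"
      by (auto simp: eventually_sequentially)
  qed simp
  have summable: "(\<lambda>x. (cmod (l x - ell2_apply (X n) x))\<^sup>2) summable_on UNIV"
    if M: "\<And>m. m \<ge> M \<Longrightarrow> dist (X m) (X n) \<le> e" for n M e
    using partial[OF _ M] by (intro nonneg_bdd_above_summable_on bdd_aboveI2[where M = "e\<^sup>2"]) auto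
  obtain N where N: "\<And>m n. m \<ge> N \<Longrightarrow> n \<ge> N \<Longrightarrow> dist (X m) (X n) < 1"
    using X metric_CauchyD zero_less_one by blast
  have "(\<lambda>x. (cmod ((l x - ell2_apply (X N) x) + ell2_apply (X N) x))\<^sup>2) summable_on UNIV"
    using ell2_apply[of "X N"] N[of _ N]
    by (intro square_summable_add summable[of N N 1]) (auto intro: less_imp_le)
  then have rep: "ell2_apply (Abs_ell2 l) = l"
    by (intro Abs_ell2_inverse) simp
  have "X \<longlonglongrightarrow> Abs_ell2 l"
  proof (rule metric_LIMSEQ_I)
    fix r :: real assume "0 < r"
    then obtain M where M: "\<And>m n. m \<ge> M \<Longrightarrow> n \<ge> M \<Longrightarrow> dist (X m) (X n) < r/2"
      using X by (meson half_gt_zero metric_CauchyD)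
    have "dist (X n) (Abs_ell2 l) < r" if n: "n \<ge> M" for n
    proof -
      have le: "dist (X m) (X n) \<le> r/2" if "m \<ge> M" for m
        using M[OF that n] by simp
      have "(\<Sum>\<^sub>\<infinity>x. (cmod (l x - ell2_apply (X n) x))\<^sup>2) \<le> (r/2)\<^sup>2"
        using partial[OF _ le] by (intro infsum_le_finite_sums summable[OF le]) auto
      then have "(norm (Abs_ell2 l - X n)) \<le> r/2"
        using \<open>0 < r\<close> unfolding norm_ell2_eq minus_ell2.rep_eq rep
        by (intro real_le_lsqrt) auto
      then show ?thesis
        using \<open>0 < r\<close> by (simp add: dist_norm norm_minus_commute)
    qed
    then show "\<exists>no. \<forall>n\<ge>no. dist (X n) (Abs_ell2 l) < r"
      by blast
  qed
  then show "convergent X"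
    by (auto simp: convergent_def)
qed

instance ell2 :: (type) banach ..

lemma op_scaleC_add: "op_scaleC c (a + b) = op_scaleC c a + op_scaleC c b"
  by (rule blinfun_eqI) (simp add: op_scaleC_apply plus_blinfun.rep_eq ell2_scaleC_add)

lemma op_scaleC_add_left: "op_scaleC (c + d) a = op_scaleC c a + op_scaleC d a"
  by (rule blinfun_eqI) (simp add: op_scaleC_apply plus_blinfun.rep_eq ell2_scaleC_add_left)

lemma op_scaleC_mult: "op_scaleC c (op_scaleC d a) = op_scaleC (c * d) a"
  by (rule blinfun_eqI) (simp add: op_scaleC_apply ell2_scaleC_mult)

lemma op_scaleC_1 [simp]: "op_scaleC 1 a = a"
  by (rule blinfun_eqI) (simp add: op_scaleC_apply)

lemma op_scaleC_of_real: "op_scaleC (complex_of_real r) a = r *\<^sub>R a"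
  by (rule blinfun_eqI) (simp add: op_scaleC_apply scaleR_blinfun.rep_eq ell2_scaleR_scaleC)

lemma op_scaleC_0 [simp]: "op_scaleC 0 a = 0"
  using op_scaleC_of_real[of 0 a] by simp

lemma op_scaleC_zero_right [simp]: "op_scaleC c 0 = 0"
  by (metis op_scaleC_0 op_scaleC_mult mult_zero_right)

lemma op_scaleC_minus1: "op_scaleC (- 1) a = - a"
  using op_scaleC_of_real[of "-1" a] by simp

lemma op_scaleC_scaleR: "op_scaleC c (r *\<^sub>R a) = r *\<^sub>R op_scaleC c a"
  by (simp add: op_scaleC_mult mult.commute flip: op_scaleC_of_real)

lemma op_scaleC_diff: "op_scaleC c (a - b) = op_scaleC c a - op_scaleC c b"
  by (metis (no_types, lifting) add_diff_cancel_right' diff_add_cancel op_scaleC_add)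

lemma norm_op_scaleC: "norm (op_scaleC c a) = cmod c * norm a"
proof (cases "c = 0")
  case False
  have le: "norm (op_scaleC d b) \<le> cmod d * norm b" for d :: complex and b :: "'a op"
  proof (rule norm_blinfun_bound)
    show "norm (blinfun_apply (op_scaleC d b) x) \<le> cmod d * norm b * norm x" for x
      using norm_blinfun[of b x]
      by (simp add: op_scaleC_apply norm_ell2_scaleC mult.assoc mult_left_mono)
  qed simp
  show ?thesis
  proof (rule antisym[OF le])
    have "norm a = norm (op_scaleC (inverse c) (op_scaleC c a))"
      using False by (simp add: op_scaleC_mult)
    also have "\<dots> \<le> cmod (inverse c) * norm (op_scaleC c a)"
      by (rule le)
    finally have "cmod c * norm a \<le> cmod c * (cmod (inverse c) * norm (op_scaleC c a))"
      by (rule mult_left_mono) simp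
    then show "cmod c * norm a \<le> norm (op_scaleC c a)"
      using False by (simp add: norm_inverse flip: mult.assoc)
  qed
qed simp

lemma continuous_on_op_scaleC: "continuous_on S (op_scaleC c)"
proof -
  have "bounded_linear (op_scaleC c)"
    by (rule bounded_linear_intro[where K = "cmod c"])
      (simp_all add: op_scaleC_add op_scaleC_scaleR norm_op_scaleC)
  then show ?thesis
    by (rule linear_continuous_on)
qed

lemma op_scaleC_compose_left: "op_scaleC c a o\<^sub>L b = op_scaleC c (a o\<^sub>L b)"
  by (rule blinfun_eqI) (simp add: op_scaleC_apply)

lemma op_scaleC_compose_right:
  "complex_linear_op a \<Longrightarrow> a o\<^sub>L op_scaleC c b = op_scaleC c (a o\<^sub>L b)"
  by (rule blinfun_eqI) (simp add: op_scaleC_apply complex_linear_op_def)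

lemma op_compose_assoc: "(a o\<^sub>L b) o\<^sub>L c = a o\<^sub>L (b o\<^sub>L c)"
  by (rule blinfun_eqI) simp

lemmas op_compose_add_left = bounded_bilinear.add_left[OF bounded_bilinear_blinfun_compose]
lemmas op_compose_add_right = bounded_bilinear.add_right[OF bounded_bilinear_blinfun_compose]
lemmas op_compose_diff_left = bounded_bilinear.diff_left[OF bounded_bilinear_blinfun_compose]
lemmas op_compose_diff_right = bounded_bilinear.diff_right[OF bounded_bilinear_blinfun_compose]
lemmas op_compose_scaleR_left = bounded_bilinear.scaleR_left[OF bounded_bilinear_blinfun_compose]
lemmas op_compose_scaleR_right = bounded_bilinear.scaleR_right[OF bounded_bilinear_blinfun_compose]

lemma continuous_on_op_compose_left: "continuous_on S (\<lambda>a. a o\<^sub>L b)"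
  by (intro continuous_intros)

lemma continuous_on_op_compose_right: "continuous_on S (\<lambda>a. b o\<^sub>L a)"
  by (intro continuous_intros)

lemma closed_complex_linear: "closed {a. complex_linear_op a}"
proof -
  have "{a :: 'a op. complex_linear_op a} =
      (\<Inter>c. \<Inter>\<xi>. {a. blinfun_apply a (ell2_scaleC c \<xi>) = ell2_scaleC c (blinfun_apply a \<xi>)})"
    by (auto simp: complex_linear_op_def)
  moreover have "closed {a :: 'a op. blinfun_apply a (ell2_scaleC c \<xi>) = ell2_scaleC c (blinfun_apply a \<xi>)}"
    for c \<xi>
    by (intro closed_Collect_eq continuous_intros
        bounded_linear.continuous_on[OF bounded_linear_ell2_scaleC])
  ultimately show ?thesis
    by (simp add: closed_INT)
qed

lemma is_adjoint_sym: "is_adjoint a b \<Longrightarrow> is_adjoint b a"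
  unfolding is_adjoint_def by (metis ell2_cinner_commute)

lemma is_adjoint_inner: "is_adjoint a b \<Longrightarrow> inner (blinfun_apply a \<xi>) \<eta> = inner \<xi> (blinfun_apply b \<eta>)"
  by (simp add: is_adjoint_def inner_ell2_def)

lemma is_adjoint_norm_le:
  assumes "is_adjoint a b"
  shows "norm b \<le> norm a"
proof (rule norm_blinfun_bound)
  fix \<eta>
  let ?y = "blinfun_apply b \<eta>"
  have "(norm ?y)\<^sup>2 = inner (blinfun_apply a ?y) \<eta>"
    by (simp add: is_adjoint_inner[OF assms] power2_norm_eq_inner)
  also have "\<dots> \<le> norm (blinfun_apply a ?y) * norm \<eta>"
    by (rule norm_cauchy_schwarz)
  also have "\<dots> \<le> norm a * norm ?y * norm \<eta>"
    by (intro mult_right_mono norm_blinfun) simp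
  finally show "norm ?y \<le> norm a * norm \<eta>"
    by (cases "norm ?y = 0") (auto simp: power2_eq_square mult_ac)
qed simp

lemma is_adjoint_norm_eq: "is_adjoint a b \<Longrightarrow> norm b = norm a"
  by (simp add: antisym is_adjoint_norm_le is_adjoint_sym)

lemma is_adjoint_unique:
  assumes "is_adjoint a b" "is_adjoint a c"
  shows "b = c"
proof (rule blinfun_eqI)
  fix \<eta>
  have "inner \<xi> (blinfun_apply b \<eta> - blinfun_apply c \<eta>) = 0" for \<xi>
    by (simp add: inner_diff_right is_adjoint_inner[OF assms(1), symmetric]
        is_adjoint_inner[OF assms(2), symmetric])
  from this[of "blinfun_apply b \<eta> - blinfun_apply c \<eta>"]
  show "blinfun_apply b \<eta> = blinfun_apply c \<eta>"
    by simp
qed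

lemma is_adjoint_0: "is_adjoint 0 0"
  by (simp add: is_adjoint_def ell2_cinner.rep_eq zero_ell2.rep_eq zero_blinfun.rep_eq)

lemma is_adjoint_add: "is_adjoint a b \<Longrightarrow> is_adjoint c d \<Longrightarrow> is_adjoint (a + c) (b + d)"
  by (simp add: is_adjoint_def plus_blinfun.rep_eq ell2_cinner_add_left ell2_cinner_add_right)

lemma is_adjoint_scaleC: "is_adjoint a b \<Longrightarrow> is_adjoint (op_scaleC c a) (op_scaleC (cnj c) b)"
  by (simp add: is_adjoint_def op_scaleC_apply ell2_cinner_scaleC_left ell2_cinner_scaleC_right)

lemma is_adjoint_scaleR: "is_adjoint a b \<Longrightarrow> is_adjoint (r *\<^sub>R a) (r *\<^sub>R b)"
  using is_adjoint_scaleC[of a b "complex_of_real r"] by (simp add: op_scaleC_of_real)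

lemma is_adjoint_diff: "is_adjoint a b \<Longrightarrow> is_adjoint c d \<Longrightarrow> is_adjoint (a - c) (b - d)"
  using is_adjoint_add[of a b "- c" "- d"] is_adjoint_scaleC[of c d "- 1"]
  by (simp add: op_scaleC_minus1)

lemma is_adjoint_compose: "is_adjoint a b \<Longrightarrow> is_adjoint c d \<Longrightarrow> is_adjoint (a o\<^sub>L c) (d o\<^sub>L b)"
  by (simp add: is_adjoint_def)

lemma bounded_linear_ell2_cinner_right: "bounded_linear (ell2_cinner \<xi>)"
  by (rule bounded_linear_intro[where K = "norm \<xi>"])
    (simp_all add: ell2_cinner_add_right ell2_scaleR_scaleC ell2_cinner_scaleC_right
      scaleR_conv_of_real cmod_ell2_cinner_le[of \<xi>, unfolded mult.commute[of "norm \<xi>"]])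

lemma bounded_linear_ell2_cinner_left: "bounded_linear (\<lambda>\<xi>. ell2_cinner \<xi> \<eta>)"
  by (rule bounded_linear_intro[where K = "norm \<eta>"])
    (simp_all add: ell2_cinner_add_left ell2_scaleR_scaleC ell2_cinner_scaleC_left
      scaleR_conv_of_real cmod_ell2_cinner_le)

lemma closed_is_adjoint: "closed {(a, b). is_adjoint a b}"
proof -
  have "{(a, b). is_adjoint a b} =
      (\<Inter>\<xi>. \<Inter>\<eta>. {p :: 'a op \<times> 'a op. ell2_cinner (blinfun_apply (fst p) \<xi>) \<eta> = ell2_cinner \<xi> (blinfun_apply (snd p) \<eta>)})"
    by (auto simp: is_adjoint_def)
  moreover have "closed {p :: 'a op \<times> 'a op. ell2_cinner (blinfun_apply (fst p) \<xi>) \<eta> = ell2_cinner \<xi> (blinfun_apply (snd p) \<eta>)}"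
    for \<xi> \<eta>
    by (intro closed_Collect_eq continuous_intros
        bounded_linear.continuous_on[OF bounded_linear_ell2_cinner_left]
        bounded_linear.continuous_on[OF bounded_linear_ell2_cinner_right])
  ultimately show ?thesis
    by (simp add: closed_INT)
qed

section \<open>Positive functionals on operator algebras\<close>

text \<open>Positivity of a functional is tested on products \<open>b a\<close> with \<open>b\<close> adjoint to \<open>a\<close>, so comparing a
  self-adjoint element with the unit requires square roots. The equation \<open>(1 - d)\<^sup>2 = 1 - h\<close> is the
  fixed point equation \<open>d = (h + d\<^sup>2)/2\<close>, whose right-hand side maps the ball of radius 1/2 to itself
  and contracts it when \<open>h\<close> has norm at most 3/4.\<close>

lemma sqrt_unit_minus_exists:
  assumes A: "cstar_subalgebra A"
    and u: "u \<in> A" "\<And>a. a \<in> A \<Longrightarrow> u o\<^sub>L a = a \<and> a o\<^sub>L u = a" "is_adjoint u u"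
    and h: "h \<in> A" "is_adjoint h h" "norm h \<le> 3/4"
  shows "\<exists>c\<in>A. is_adjoint c c \<and> c o\<^sub>L c = u - h"
proof -
  have sub: "complex_subspace A" and clo: "closed A"
    and mult: "\<And>a b. a \<in> A \<Longrightarrow> b \<in> A \<Longrightarrow> a o\<^sub>L b \<in> A"
    using A by (auto simp: cstar_subalgebra_def)
  have add: "a + b \<in> A" if "a \<in> A" "b \<in> A" for a b
    using sub that by (simp add: complex_subspace_def)
  have scale: "r *\<^sub>R a \<in> A" if "a \<in> A" for r a
    using sub that by (metis complex_subspace_def op_scaleC_of_real)
  define X where "X = A \<inter> {d. is_adjoint d d} \<inter> cball 0 (1/2)"
  define f where "f d = (1/2) *\<^sub>R (h + (d o\<^sub>L d))" for d
  have "continuous_on UNIV (\<lambda>d :: 'a op. (d, d))"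
    by (intro continuous_intros)
  from continuous_closed_vimage[OF closed_is_adjoint this[unfolded continuous_on_eq_continuous_at[OF open_UNIV], rule_format]]
  have "closed {d :: 'a op. is_adjoint d d}"
    by (simp add: vimage_def)
  then have "complete X"
    using clo by (simp add: X_def complete_eq_closed closed_Int)
  moreover have "0 \<in> X"
    using sub by (simp add: X_def complex_subspace_def is_adjoint_0)
  moreover have "f ` X \<subseteq> X"
  proof
    fix y assume "y \<in> f ` X"
    then obtain d where d: "d \<in> A" "is_adjoint d d" "norm d \<le> 1/2" and y: "y = f d"
      by (auto simp: X_def)
    have "norm (d o\<^sub>L d) \<le> norm d * norm d"
      by (rule norm_blinfun_compose)
    also have "\<dots> \<le> (1/2) * (1/2)"
      using d by (intro mult_mono) auto
    finally have "norm (h + (d o\<^sub>L d)) \<le> 1"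
      using h(3) norm_triangle_ineq[of h "d o\<^sub>L d"] by linarith
    then show "y \<in> X"
      using d h by (auto simp: X_def y f_def intro!: add scale mult is_adjoint_scaleR
          is_adjoint_add is_adjoint_compose)
  qed
  moreover have "dist (f x) (f y) \<le> 1/2 * dist x y" if "x \<in> X" "y \<in> X" for x y
  proof -
    have eq: "(x o\<^sub>L x) - (y o\<^sub>L y) = (x o\<^sub>L (x - y)) + ((x - y) o\<^sub>L y)"
      by (simp add: op_compose_diff_left op_compose_diff_right)
    have "norm ((x o\<^sub>L x) - (y o\<^sub>L y)) \<le> norm x * norm (x - y) + norm (x - y) * norm y"
      unfolding eq by (rule order_trans[OF norm_triangle_ineq add_mono[OF norm_blinfun_compose norm_blinfun_compose]])
    also have "\<dots> \<le> 1/2 * norm (x - y) + norm (x - y) * (1/2)"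
      using that by (intro add_mono mult_mono) (auto simp: X_def)
    also have "\<dots> = norm (x - y)"
      by simp
    finally show ?thesis
      by (simp add: f_def dist_norm flip: scaleR_diff_right)
  qed
  ultimately have "\<exists>!x\<in>X. f x = x"
    by (intro Banach_fix[where c = "1/2"]) auto
  then obtain d where d: "d \<in> A" "is_adjoint d d" and fd: "f d = d"
    by (auto simp: X_def)
  have "d o\<^sub>L d = 2 *\<^sub>R d - h"
    using arg_cong[OF fd, of "\<lambda>z. 2 *\<^sub>R z - h"] by (simp add: f_def)
  then have "(u - d) o\<^sub>L (u - d) = u - h"
    using u d by (simp add: op_compose_diff_left op_compose_diff_right scaleR_2)
  moreover have "u - d \<in> A"
    using add[OF u(1) scale[OF d(1), of "-1"]] by simp
  ultimately show ?thesis
    using is_adjoint_diff[OF u(3) d(2)] by blast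
qed

text \<open>Boundedness is a consequence (\<open>positive_on_bound\<close>). This makes the notion fit both tracial states
  and compositions of vector states with *-automorphisms, whose definitions do not mention continuity.\<close>

definition positive_on :: "'a op set \<Rightarrow> ('a op \<Rightarrow> complex) \<Rightarrow> bool"
  where "positive_on A \<phi> \<longleftrightarrow>
    (\<forall>a\<in>A. \<forall>b\<in>A. \<phi> (a + b) = \<phi> a + \<phi> b) \<and>
    (\<forall>c. \<forall>a\<in>A. \<phi> (op_scaleC c a) = c * \<phi> a) \<and>
    (\<forall>a\<in>A. \<forall>b. is_adjoint a b \<longrightarrow> \<phi> (b o\<^sub>L a) \<in> \<real>\<^sub>\<ge>\<^sub>0)"

text \<open>After scaling to norm 3/4, both \<open>u - h\<close> and \<open>u + h\<close> are squares of self-adjoint elements.\<close>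

lemma positive_on_selfadjoint_bound:
  assumes A: "cstar_subalgebra A"
    and u: "u \<in> A" "\<And>a. a \<in> A \<Longrightarrow> u o\<^sub>L a = a \<and> a o\<^sub>L u = a" "is_adjoint u u"
    and \<phi>: "positive_on A \<phi>"
    and h: "h \<in> A" "is_adjoint h h"
  shows "\<phi> h \<in> \<real> \<and> cmod (\<phi> h) \<le> 4/3 * norm h * Re (\<phi> u)"
proof -
  have sub: "complex_subspace A"
    using A by (auto simp: cstar_subalgebra_def)
  have scale: "r *\<^sub>R a \<in> A" if "a \<in> A" for r a
    using sub that by (metis complex_subspace_def op_scaleC_of_real)
  have u0: "\<phi> u \<in> \<real>\<^sub>\<ge>\<^sub>0"
    using \<phi> u unfolding positive_on_def by metis
  have scaled: "\<phi> (r *\<^sub>R k) = r * \<phi> k" if "k \<in> A" for r k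
    using \<phi> that by (simp add: positive_on_def flip: op_scaleC_of_real)
  have small: "\<phi> u - \<phi> k \<in> \<real>\<^sub>\<ge>\<^sub>0" if k: "k \<in> A" "is_adjoint k k" "norm k \<le> 3/4" for k
  proof -
    obtain c where c: "c \<in> A" "is_adjoint c c" "c o\<^sub>L c = u - k"
      using sqrt_unit_minus_exists[OF A u k] by blast
    have "\<phi> (u - k) \<in> \<real>\<^sub>\<ge>\<^sub>0"
      using \<phi> c(1,2) unfolding positive_on_def c(3)[symmetric] by blast
    moreover have "u - k \<in> A"
      using c(1) A unfolding c(3)[symmetric] cstar_subalgebra_def by blast
    then have "\<phi> ((u - k) + k) = \<phi> (u - k) + \<phi> k"
      using \<phi> k(1) unfolding positive_on_def by blast
    ultimately show ?thesis
      by simp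
  qed
  show ?thesis
  proof (cases "h = 0")
    case True
    then show ?thesis
      using scaled[OF h(1), of 0] by simp
  next
    case False
    define r where "r = 3 / (4 * norm h)"
    have r: "r > 0" and r': "inverse r = 4/3 * norm h"
      using False by (auto simp: r_def field_simps)
    have k: "r *\<^sub>R h \<in> A" "is_adjoint (r *\<^sub>R h) (r *\<^sub>R h)" "norm (r *\<^sub>R h) \<le> 3/4"
      using scale h is_adjoint_scaleR[OF h(2)] False by (auto simp: r_def)
    have k': "(-r) *\<^sub>R h \<in> A" "is_adjoint ((-r) *\<^sub>R h) ((-r) *\<^sub>R h)" "norm ((-r) *\<^sub>R h) \<le> 3/4"
      using k(3) scale[OF h(1)] is_adjoint_scaleR[OF h(2), of "-r"] by (simp_all only:) simp
    have 1: "\<phi> u - r * \<phi> h \<in> \<real>\<^sub>\<ge>\<^sub>0" "\<phi> u + r * \<phi> h \<in> \<real>\<^sub>\<ge>\<^sub>0"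
      using small[OF k] small[OF k'] scaled[OF h(1), of r] scaled[OF h(1), of "-r"] by auto
    then have im: "Im (\<phi> h) = 0"
      using u0 r by (auto simp: complex_nonneg_Reals_iff)
    then have "cmod (\<phi> h) = \<bar>Re (\<phi> h)\<bar>"
      by (simp add: cmod_eq_Re)
    moreover have "r * \<bar>Re (\<phi> h)\<bar> \<le> Re (\<phi> u)"
      using 1 by (auto simp: complex_nonneg_Reals_iff abs_if)
    then have "\<bar>Re (\<phi> h)\<bar> \<le> inverse r * Re (\<phi> u)"
      using r by (simp add: field_simps)
    ultimately show ?thesis
      using im r' by (simp add: complex_is_Real_iff)
  qed
qed

text \<open>An arbitrary element is \<open>h + \<i> k\<close> with \<open>h\<close> and \<open>k\<close> self-adjoint.\<close>

lemma positive_on_bound: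
  assumes A: "cstar_subalgebra A"
    and u: "u \<in> A" "\<And>a. a \<in> A \<Longrightarrow> u o\<^sub>L a = a \<and> a o\<^sub>L u = a" "is_adjoint u u"
    and \<phi>: "positive_on A \<phi>"
    and a: "a \<in> A" "is_adjoint a b"
  shows "cmod (\<phi> a) \<le> 8/3 * norm a * Re (\<phi> u)"
proof -
  have sub: "complex_subspace A"
    using A by (auto simp: cstar_subalgebra_def)
  have b: "b \<in> A" "norm b = norm a"
    using A a by (auto simp: cstar_subalgebra_def is_adjoint_norm_eq)
  define h where "h = op_scaleC (1/2) (a + b)"
  define k where "k = op_scaleC (- \<i>/2) (a + (op_scaleC (- 1) b))"
  have mem: "h \<in> A" "k \<in> A"
    using sub a b unfolding h_def k_def complex_subspace_def by blast+
  have ab: "is_adjoint (a + b) (b + a)" "is_adjoint (a + op_scaleC (-1) b) (b + op_scaleC (-1) a)"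
    using is_adjoint_add[OF a(2) is_adjoint_sym[OF a(2)]]
      is_adjoint_add[OF a(2) is_adjoint_scaleC[OF is_adjoint_sym[OF a(2)], of "-1"]] by auto
  have hh: "is_adjoint h h" 
    using is_adjoint_scaleC[OF ab(1), of "1/2"] by (simp add: h_def add.commute)
  have kk: "is_adjoint k k"
    using is_adjoint_scaleC[OF ab(2), of "- \<i>/2"]
    by (simp add: k_def op_scaleC_add op_scaleC_mult add.commute)
  have u0: "0 \<le> Re (\<phi> u)"
    using \<phi> u by (metis complex_nonneg_Reals_iff positive_on_def)
  have nh: "norm h \<le> norm a"
    using norm_triangle_ineq[of a b] b by (simp add: h_def norm_op_scaleC)
  have nk: "norm k \<le> norm a"
    using norm_triangle_ineq[of a "op_scaleC (-1) b"] b by (simp add: k_def norm_op_scaleC norm_divide)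
  have eq: "a = h + op_scaleC \<i> k"
  proof -
    have "h + op_scaleC \<i> k = (op_scaleC (1/2) a + op_scaleC (1/2) a) + (op_scaleC (1/2) b + op_scaleC (-1/2) b)"
      by (simp add: h_def k_def op_scaleC_add op_scaleC_mult)
    then show ?thesis
      by (simp flip: op_scaleC_add_left)
  qed
  have "op_scaleC \<i> k \<in> A"
    using mem sub by (simp add: complex_subspace_def)
  then have "\<phi> a = \<phi> h + \<i> * \<phi> k"
    using \<phi> mem by (subst eq) (simp add: positive_on_def)
  then have "cmod (\<phi> a) \<le> cmod (\<phi> h) + cmod (\<phi> k)"
    using norm_triangle_ineq[of "\<phi> h" "\<i> * \<phi> k"] by (simp add: norm_mult)
  also have "\<dots> \<le> 4/3 * norm h * Re (\<phi> u) + 4/3 * norm k * Re (\<phi> u)"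
    using positive_on_selfadjoint_bound[OF A u \<phi>] mem hh kk by (intro add_mono) auto
  also have "\<dots> \<le> 4/3 * norm a * Re (\<phi> u) + 4/3 * norm a * Re (\<phi> u)"
    using nh nk u0 by (intro add_mono mult_right_mono) auto
  finally show ?thesis
    by simp
qed


section \<open>Generators and density\<close>

lemma closure_binary_closed:
  fixes f :: "'a::topological_space \<Rightarrow> 'a \<Rightarrow> 'a"
  assumes "\<And>b. continuous_on UNIV (\<lambda>a. f a b)" "\<And>a. continuous_on UNIV (f a)"
    and D: "\<And>a b. a \<in> D \<Longrightarrow> b \<in> D \<Longrightarrow> f a b \<in> D"
    and ab: "a \<in> closure D" "b \<in> closure D"
  shows "f a b \<in> closure D"
proof -
  have "(\<lambda>a. f a d) ` closure D \<subseteq> closure D" if "d \<in> D" for d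
    using assms(1) D that closure_subset[of D]
    by (intro image_closure_subset) (auto intro: continuous_on_subset)
  then have "f a ` D \<subseteq> closure D"
    using ab by auto
  then have "f a ` closure D \<subseteq> closure D"
    using assms(2) by (intro image_closure_subset) (auto intro: continuous_on_subset)
  then show ?thesis
    using ab by auto
qed

lemma complex_subspace_Inter: "(\<And>S. S \<in> T \<Longrightarrow> complex_subspace S) \<Longrightarrow> complex_subspace (\<Inter>T)"
  by (simp add: complex_subspace_def)

lemma complex_subspace_hull: "complex_subspace (complex_subspace hull S)"
  by (rule hull_in, rule complex_subspace_Inter) simp

lemma complex_subspace_closure:
  assumes "complex_subspace D"
  shows "complex_subspace (closure D)"
proof -
  have "a + b \<in> closure D" if "a \<in> closure D" "b \<in> closure D" for a b
    using assms that
    by (intro closure_binary_closed[where f = "(+)"] continuous_intros) (auto simp: complex_subspace_def)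
  moreover have "op_scaleC c ` closure D \<subseteq> closure D" for c
    using assms closure_subset[of D]
    by (intro image_closure_subset continuous_on_op_scaleC) (auto simp: complex_subspace_def)
  moreover have "0 \<in> closure D"
    using assms closure_subset[of D] by (auto simp: complex_subspace_def)
  ultimately show ?thesis
    unfolding complex_subspace_def by blast
qed

lemma complex_subspace_diff: "complex_subspace D \<Longrightarrow> a \<in> D \<Longrightarrow> b \<in> D \<Longrightarrow> a - b \<in> D"
  unfolding complex_subspace_def by (metis op_scaleC_minus1 uminus_add_conv_diff add.commute)

lemma complex_subspace_scaleR: "complex_subspace D \<Longrightarrow> a \<in> D \<Longrightarrow> r *\<^sub>R a \<in> D"
  unfolding complex_subspace_def by (metis op_scaleC_of_real)

lemma complex_subspace_sum:
  "complex_subspace D \<Longrightarrow> (\<And>i. i \<in> I \<Longrightarrow> f i \<in> D) \<Longrightarrow> sum f I \<in> D"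
  by (induction I rule: infinite_finite_induct) (auto simp: complex_subspace_def)

lift_definition ket :: "'a \<Rightarrow> 'a ell2" is "\<lambda>x y. if y = x then 1 else 0"
proof -
  fix x :: 'a
  have "(\<lambda>y. (cmod (if y = x then 1 else 0))\<^sup>2) summable_on {x}"
    by simp
  then show "(\<lambda>y. (cmod (if y = x then 1 else 0))\<^sup>2) summable_on UNIV"
    by (rule summable_on_cong_neutral[THEN iffD1, rotated -1]) auto
qed

lemma ell2_cinner_finite_support:
  assumes "finite F" "\<And>x. x \<notin> F \<Longrightarrow> ell2_apply \<xi> x = 0"
  shows "ell2_cinner \<xi> \<eta> = (\<Sum>x\<in>F. cnj (ell2_apply \<xi> x) * ell2_apply \<eta> x)"
proof -
  have "ell2_cinner \<xi> \<eta> = (\<Sum>\<^sub>\<infinity>x\<in>F. cnj (ell2_apply \<xi> x) * ell2_apply \<eta> x)"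
    unfolding ell2_cinner.rep_eq using assms by (intro infsum_cong_neutral) auto
  then show ?thesis
    using assms by simp
qed

lemma ell2_cinner_ket: "ell2_cinner (ket x) \<xi> = ell2_apply \<xi> x"
  by (subst ell2_cinner_finite_support[of "{x}"]) (auto simp: ket.rep_eq)

lemma norm_ket [simp]: "norm (ket x) = 1"
proof -
  have "complex_of_real ((norm (ket x))\<^sup>2) = 1"
    unfolding ell2_cinner_self_norm[symmetric] ell2_cinner_ket by (simp add: ket.rep_eq)
  then show ?thesis
    using norm_ge_zero[of "ket x"] by (simp only: of_real_eq_1_iff power2_eq_1_iff) simp
qed

definition bounded_functional :: "'a op set \<Rightarrow> ('a op \<Rightarrow> complex) \<Rightarrow> bool"
  where "bounded_functional A \<phi> \<longleftrightarrow>
    (\<forall>a\<in>A. \<forall>b\<in>A. \<phi> (a + b) = \<phi> a + \<phi> b) \<and>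
    (\<forall>c. \<forall>a\<in>A. \<phi> (op_scaleC c a) = c * \<phi> a) \<and>
    (\<exists>C. \<forall>a\<in>A. cmod (\<phi> a) \<le> C * norm a)"

lemma bounded_functional_diff:
  assumes "bounded_functional A \<phi>" "complex_subspace A" "a \<in> A" "b \<in> A"
  shows "\<phi> (a - b) = \<phi> a - \<phi> b"
proof -
  have "\<phi> ((a - b) + b) = \<phi> (a - b) + \<phi> b"
    using assms complex_subspace_diff[OF assms(2-4)] unfolding bounded_functional_def by blast
  then show ?thesis
    by simp
qed

lemma bounded_functional_bound:
  assumes "bounded_functional A \<phi>"
  obtains C where "C > 0" "\<And>a. a \<in> A \<Longrightarrow> cmod (\<phi> a) \<le> C * norm a"
proof -
  obtain C where C: "\<And>a. a \<in> A \<Longrightarrow> cmod (\<phi> a) \<le> C * norm a"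
    using assms unfolding bounded_functional_def by blast
  have "cmod (\<phi> a) \<le> (\<bar>C\<bar> + 1) * norm a" if "a \<in> A" for a
  proof -
    have "C * norm a \<le> (\<bar>C\<bar> + 1) * norm a"
      by (intro mult_right_mono) auto
    then show ?thesis
      using C[OF that] by simp
  qed
  then show ?thesis
    using that[of "\<bar>C\<bar> + 1"] by simp
qed

lemma bounded_functional_continuous:
  assumes "bounded_functional A \<phi>" "complex_subspace A"
  shows "continuous_on A \<phi>"
proof -
  obtain C where "C > 0" and C: "\<And>a. a \<in> A \<Longrightarrow> cmod (\<phi> a) \<le> C * norm a"
    using bounded_functional_bound[OF assms(1)] by metis
  have "C-lipschitz_on A \<phi>"
  proof (rule lipschitz_onI)
    fix a b assume "a \<in> A" "b \<in> A"
    then show "dist (\<phi> a) (\<phi> b) \<le> C * dist a b"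
      using C[of "a - b"] complex_subspace_diff[OF assms(2)]
      by (simp add: dist_norm bounded_functional_diff[OF assms])
  qed (use \<open>C > 0\<close> in simp)
  then show ?thesis
    by (rule lipschitz_on_continuous_on)
qed

locale twisted_group = group G for G :: "('a, 'm) monoid_scheme" (structure) +
  fixes \<sigma> :: "'a \<Rightarrow> 'a \<Rightarrow> complex"
  assumes cocycle: "\<sigma> \<in> two_cocycles G"
begin

abbreviation L :: "'a \<Rightarrow> 'a op"
  where "L \<equiv> twisted_regular G \<sigma>"

abbreviation A :: "'a op set"
  where "A \<equiv> reduced_twisted_cstar G \<sigma>"

text \<open>An explicit formula for the adjoint of a generator (\<open>is_adjoint_L\<close>), which makes it visible that
  adjoints stay in the span of the generators.\<close>

definition L_adj :: "'a \<Rightarrow> 'a op"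
  where "L_adj g = op_scaleC (cnj (\<sigma> (inv g) g)) (L (inv g))"

lemma cmod_sigma [simp]: "g \<in> carrier G \<Longrightarrow> h \<in> carrier G \<Longrightarrow> cmod (\<sigma> g h) = 1"
  using cocycle by (simp add: two_cocycles_def)

lemma sigma_nonzero [simp]: "g \<in> carrier G \<Longrightarrow> h \<in> carrier G \<Longrightarrow> \<sigma> g h \<noteq> 0"
  by (metis cmod_sigma norm_zero zero_neq_one)

lemma sigma_cnj: "g \<in> carrier G \<Longrightarrow> h \<in> carrier G \<Longrightarrow> cnj (\<sigma> g h) * \<sigma> g h = 1"
  using complex_norm_square[of "\<sigma> g h"] by (simp add: mult.commute)

lemma sigma_one [simp]: "g \<in> carrier G \<Longrightarrow> \<sigma> g \<one> = 1" "g \<in> carrier G \<Longrightarrow> \<sigma> \<one> g = 1"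
  using cocycle by (simp_all add: two_cocycles_def)

lemma sigma_cocycle:
  "g \<in> carrier G \<Longrightarrow> h \<in> carrier G \<Longrightarrow> k \<in> carrier G \<Longrightarrow>
    \<sigma> g h * \<sigma> (g \<otimes> h) k = \<sigma> h k * \<sigma> g (h \<otimes> k)"
  using cocycle by (simp add: two_cocycles_def)

lemmas L_apply = twisted_regular_apply[OF is_group cocycle]

lemma L_mult:
  assumes "g \<in> carrier G" "h \<in> carrier G"
  shows "L g o\<^sub>L L h = op_scaleC (\<sigma> g h) (L (g \<otimes> h))"
proof (rule blinfun_eqI, rule ell2_eqI)
  fix \<xi> k
  show "ell2_apply (blinfun_apply (L g o\<^sub>L L h) \<xi>) k =
      ell2_apply (blinfun_apply (op_scaleC (\<sigma> g h) (L (g \<otimes> h))) \<xi>) k"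
  proof (cases "k \<in> carrier G")
    case True
    define m where "m = inv (g \<otimes> h) \<otimes> k"
    have m: "m \<in> carrier G" "inv h \<otimes> (inv g \<otimes> k) = m" "inv g \<otimes> k = h \<otimes> m"
      using assms True
      by (simp_all add: m_def inv_mult_group m_assoc) (simp add: m_assoc[symmetric])
    then show ?thesis
      using assms True sigma_cocycle[of g h m]
      by (simp add: L_apply op_scaleC_apply ell2_scaleC.rep_eq flip: m_def)
  qed (use assms in \<open>simp add: L_apply op_scaleC_apply ell2_scaleC.rep_eq\<close>)
qed

lemma L_complex_linear: "g \<in> carrier G \<Longrightarrow> complex_linear_op (L g)"
  unfolding complex_linear_op_def
  by (intro allI ell2_eqI) (simp add: L_apply ell2_scaleC.rep_eq)

lemma is_adjoint_L:
  assumes g: "g \<in> carrier G"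
  shows "is_adjoint (L g) (L_adj g)"
  unfolding is_adjoint_def
proof (intro allI)
  fix \<xi> \<eta>
  let ?f = "\<lambda>h. cnj (ell2_apply (blinfun_apply (L g) \<xi>) h) * ell2_apply \<eta> h"
  have bij: "bij_betw (\<lambda>k. g \<otimes> k) (carrier G) (carrier G)"
    using g by (simp add: bij_betw_def inj_on_cmult surj_const_mult)
  have "ell2_cinner (blinfun_apply (L g) \<xi>) \<eta> = infsum ?f (carrier G)"
    unfolding ell2_cinner.rep_eq using g by (intro infsum_cong_neutral) (auto simp: L_apply)
  also have "\<dots> = (\<Sum>\<^sub>\<infinity>k\<in>carrier G. ?f (g \<otimes> k))"
    by (rule infsum_reindex_bij_betw[OF bij, symmetric])
  also have "\<dots> = (\<Sum>\<^sub>\<infinity>k\<in>carrier G. cnj (ell2_apply \<xi> k) * ell2_apply (blinfun_apply (L_adj g) \<eta>) k)"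
  proof (rule infsum_cong)
    fix k assume k: "k \<in> carrier G"
    have "\<sigma> (inv g) g = \<sigma> g k * \<sigma> (inv g) (g \<otimes> k)"
      using sigma_cocycle[of "inv g" g k] g k by simp
    then have "cnj (\<sigma> (inv g) g) * \<sigma> (inv g) (g \<otimes> k) =
        cnj (\<sigma> g k) * (cnj (\<sigma> (inv g) (g \<otimes> k)) * \<sigma> (inv g) (g \<otimes> k))"
      by simp
    also have "\<dots> = cnj (\<sigma> g k)"
      using g k by (simp add: sigma_cnj)
    finally show "?f (g \<otimes> k) = cnj (ell2_apply \<xi> k) * ell2_apply (blinfun_apply (L_adj g) \<eta>) k"
      using g k by (simp add: L_adj_def L_apply op_scaleC_apply ell2_scaleC.rep_eq m_assoc[symmetric])
  qed
  also have "\<dots> = ell2_cinner \<xi> (blinfun_apply (L_adj g) \<eta>)"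
    unfolding ell2_cinner.rep_eq using g
    by (intro infsum_cong_neutral) (auto simp: L_adj_def L_apply op_scaleC_apply ell2_scaleC.rep_eq)
  finally show "ell2_cinner (blinfun_apply (L g) \<xi>) \<eta> = ell2_cinner \<xi> (blinfun_apply (L_adj g) \<eta>)" .
qed

lemma norm_L_le:
  assumes g: "g \<in> carrier G"
  shows "norm (L g) \<le> 1"
proof (rule norm_blinfun_bound)
  fix \<xi>
  have "ell2_apply (blinfun_apply (L g) \<xi>) = twisted_translate G \<sigma> g (ell2_apply \<xi>)"
    using g by (simp add: fun_eq_iff L_apply twisted_translate_def)
  then show "norm (blinfun_apply (L g) \<xi>) \<le> 1 * norm \<xi>"
    using twisted_translate_infsum_le[OF is_group cocycle g, of "ell2_apply \<xi>"] ell2_apply[of \<xi>]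
    by (simp add: norm_ell2_eq)
qed simp

lemma norm_L_adj_le: "g \<in> carrier G \<Longrightarrow> norm (L_adj g) \<le> 1"
  using is_adjoint_norm_eq[OF is_adjoint_L] norm_L_le by simp

lemma L_adj_complex_linear: "g \<in> carrier G \<Longrightarrow> complex_linear_op (L_adj g)"
  using L_complex_linear[of "inv g"]
  by (simp add: L_adj_def complex_linear_op_def op_scaleC_apply ell2_scaleC_mult mult.commute)

lemma sigma_inv: "g \<in> carrier G \<Longrightarrow> \<sigma> (inv g) g = \<sigma> g (inv g)"
  using sigma_cocycle[of g "inv g" g] by simp

lemma L_L_adj: "g \<in> carrier G \<Longrightarrow> L g o\<^sub>L L_adj g = L \<one>"
  using sigma_cnj[of "inv g" g]
  by (simp add: L_adj_def op_scaleC_compose_right L_complex_linear L_mult op_scaleC_mult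
      flip: sigma_inv)

lemma L_adj_L: "g \<in> carrier G \<Longrightarrow> L_adj g o\<^sub>L L g = L \<one>"
  using sigma_cnj[of "inv g" g]
  by (simp add: L_adj_def op_scaleC_compose_left L_mult op_scaleC_mult)

lemma L_adj_one: "L_adj \<one> = L \<one>"
  by (simp add: L_adj_def)

text \<open>Closure under adjoints passes from the span to its closure because taking adjoints is isometric.\<close>

lemma cstar_subalgebra_closure_span:
  "cstar_subalgebra (closure (complex_subspace hull (L ` carrier G)))"
  (is "cstar_subalgebra (closure ?D)")
proof -
  have LD: "L g \<in> ?D" if "g \<in> carrier G" for g
    using that by (auto intro: hull_inc)
  note D = complex_subspace_hull[of "L ` carrier G"]
  have induct: "P a" if "a \<in> ?D" "\<And>g. g \<in> carrier G \<Longrightarrow> P (L g)" "complex_subspace {a. P a}" for P a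
    using that by (auto intro: hull_induct)
  have lin: "complex_linear_op a" if "a \<in> ?D" for a
    using that
  proof (rule induct)
    show "complex_subspace {a :: 'a op. complex_linear_op a}"
      by (auto simp: complex_subspace_def complex_linear_op_def plus_blinfun.rep_eq
          ell2_scaleC_add op_scaleC_apply ell2_scaleC_mult mult.commute ell2_eqI zero_ell2.rep_eq
          ell2_scaleC.rep_eq)
  qed (rule L_complex_linear)
  have mult_L: "L g o\<^sub>L b \<in> ?D" if "g \<in> carrier G" "b \<in> ?D" for g b
  proof (rule induct[OF that(2)])
    show "L g o\<^sub>L L h \<in> ?D" if "h \<in> carrier G" for h
      using D LD[of "g \<otimes> h"] \<open>g \<in> carrier G\<close> that by (simp add: L_mult complex_subspace_def)
    show "complex_subspace {b. L g o\<^sub>L b \<in> ?D}"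
      using D \<open>g \<in> carrier G\<close>
      by (auto simp: complex_subspace_def op_compose_add_right op_scaleC_compose_right
          L_complex_linear)
  qed
  have mult: "a o\<^sub>L b \<in> ?D" if "a \<in> ?D" "b \<in> ?D" for a b
  proof (rule induct[OF that(1)])
    show "complex_subspace {a. a o\<^sub>L b \<in> ?D}"
      using D by (auto simp: complex_subspace_def op_compose_add_left op_scaleC_compose_left)
  qed (rule mult_L[OF _ that(2)])
  have adj: "\<exists>b\<in>?D. is_adjoint a b" if "a \<in> ?D" for a
    using that
  proof (rule induct)
    show "\<exists>b\<in>?D. is_adjoint (L g) b" if "g \<in> carrier G" for g
      using is_adjoint_L[OF that] D LD[of "inv g"] that
      by (intro bexI[of _ "L_adj g"]) (auto simp: L_adj_def complex_subspace_def)
    show "complex_subspace {a. \<exists>b\<in>?D. is_adjoint a b}"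
      using D unfolding complex_subspace_def
      by (blast intro: is_adjoint_0 is_adjoint_add is_adjoint_scaleC)
  qed
  have "b \<in> closure ?D" if a: "a \<in> closure ?D" "is_adjoint a b" for a b
    unfolding closure_approachable
  proof (intro allI impI)
    fix e :: real assume "0 < e"
    then obtain c where c: "c \<in> ?D" "dist c a < e"
      using a by (auto simp: closure_approachable)
    then obtain d where d: "d \<in> ?D" "is_adjoint c d"
      using adj by blast
    have "dist d b < e"
      using c(2) is_adjoint_norm_eq[OF is_adjoint_diff[OF d(2) a(2)]] by (simp add: dist_norm)
    then show "\<exists>y\<in>?D. dist y b < e"
      using d(1) by blast
  qed
  moreover have "a o\<^sub>L b \<in> closure ?D" if "a \<in> closure ?D" "b \<in> closure ?D" for a b
    using mult that
    by (intro closure_binary_closed[where f = "(o\<^sub>L)"] continuous_on_op_compose_left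
        continuous_on_op_compose_right) auto
  moreover have "closure ?D \<subseteq> {a. complex_linear_op a}"
    using lin by (intro closure_minimal closed_complex_linear) auto
  ultimately show ?thesis
    using complex_subspace_closure[OF D] by (auto simp: cstar_subalgebra_def)
qed

lemma reduced_eq_closure_span: "A = closure (complex_subspace hull (L ` carrier G))"
proof
  show "A \<subseteq> closure (complex_subspace hull (L ` carrier G))"
    unfolding reduced_twisted_cstar_def
    by (intro hull_minimal cstar_subalgebra_closure_span)
      (meson closure_subset hull_subset order_trans)
  show "closure (complex_subspace hull (L ` carrier G)) \<subseteq> A"
    unfolding reduced_twisted_cstar_def hull_def[of cstar_subalgebra]
    by (intro Inter_greatest closure_minimal hull_minimal) (auto simp: cstar_subalgebra_def)
qed

lemma cstar_A: "cstar_subalgebra A"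
  using cstar_subalgebra_closure_span by (simp add: reduced_eq_closure_span)

lemma A_subspace: "complex_subspace A" and A_closed: "closed A"
  and A_linear: "a \<in> A \<Longrightarrow> complex_linear_op a"
  and A_mult: "a \<in> A \<Longrightarrow> b \<in> A \<Longrightarrow> a o\<^sub>L b \<in> A"
  and A_adj: "a \<in> A \<Longrightarrow> is_adjoint a b \<Longrightarrow> b \<in> A"
  using cstar_A by (auto simp: cstar_subalgebra_def)

lemma A_add: "a \<in> A \<Longrightarrow> b \<in> A \<Longrightarrow> a + b \<in> A" and A_scaleC: "a \<in> A \<Longrightarrow> op_scaleC c a \<in> A"
  using A_subspace by (auto simp: complex_subspace_def)

lemmas A_diff = complex_subspace_diff[OF A_subspace]
lemmas A_scaleR = complex_subspace_scaleR[OF A_subspace]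

lemma L_in_A [simp]: "g \<in> carrier G \<Longrightarrow> L g \<in> A"
  unfolding reduced_twisted_cstar_def by (intro hull_inc) auto

lemma L_adj_in_A [simp]: "g \<in> carrier G \<Longrightarrow> L_adj g \<in> A"
  by (simp add: L_adj_def A_scaleC)

text \<open>The density principle: a property that is closed and linear need only be checked on generators.\<close>

lemma A_subset_closed_subspace:
  assumes "complex_subspace W" "closed W" "\<And>g. g \<in> carrier G \<Longrightarrow> L g \<in> W"
  shows "A \<subseteq> W"
  unfolding reduced_eq_closure_span using assms by (intro closure_minimal hull_minimal) auto

text \<open>Completeness of the operators on square-summable functions enters here: adjoints of an
  approximating sequence from the span form a Cauchy sequence.\<close>

lemma A_adj_exists:
  assumes "a \<in> A"
  obtains b where "b \<in> A" "is_adjoint a b"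
proof -
  let ?D = "complex_subspace hull (L ` carrier G)"
  have adjD: "\<exists>b. is_adjoint a b" if "a \<in> ?D" for a
    using that
  proof (rule hull_induct)
    show "complex_subspace {a. \<exists>b. is_adjoint a b}"
      unfolding complex_subspace_def
      by (blast intro: is_adjoint_0 is_adjoint_add is_adjoint_scaleC)
  qed (auto intro: is_adjoint_L)
  obtain s where s: "\<And>n. s n \<in> ?D" "s \<longlonglongrightarrow> a"
    using assms unfolding reduced_eq_closure_span closure_sequential by blast
  obtain t where t: "\<And>n. is_adjoint (s n) (t n)"
    using adjD[OF s(1)] by metis
  have "dist (t m) (t n) = dist (s m) (s n)" for m n
    using is_adjoint_norm_eq[OF is_adjoint_diff[OF t t]] by (simp add: dist_norm)
  then have "Cauchy t"
    using LIMSEQ_imp_Cauchy[OF s(2)] by (simp add: Cauchy_def)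
  then obtain b where "t \<longlonglongrightarrow> b"
    by (auto simp: Cauchy_convergent_iff convergent_def)
  then have "(\<lambda>n. (s n, t n)) \<longlonglongrightarrow> (a, b)"
    using s(2) by (intro tendsto_Pair)
  then have "is_adjoint a b"
    using closed_sequentially[OF closed_is_adjoint, of "\<lambda>n. (s n, t n)"] t by auto
  then show ?thesis
    using that A_adj[OF assms] by blast
qed

lemma A_unit: "a \<in> A \<Longrightarrow> L \<one> o\<^sub>L a = a \<and> a o\<^sub>L L \<one> = a"
proof -
  have "A \<subseteq> {a. L \<one> o\<^sub>L a = a} \<inter> {a. a o\<^sub>L L \<one> = a}"
  proof (rule A_subset_closed_subspace)
    show "closed ({a. L \<one> o\<^sub>L a = a} \<inter> {a. a o\<^sub>L L \<one> = a})"
      by (intro closed_Int closed_Collect_eq continuous_intros)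
    show "complex_subspace ({a. L \<one> o\<^sub>L a = a} \<inter> {a. a o\<^sub>L L \<one> = a})"
      by (auto simp: complex_subspace_def op_compose_add_left op_compose_add_right
          op_scaleC_compose_left op_scaleC_compose_right L_complex_linear)
  qed (simp add: L_mult)
  then show "a \<in> A \<Longrightarrow> L \<one> o\<^sub>L a = a \<and> a o\<^sub>L L \<one> = a"
    by auto
qed

lemma L_one_selfadjoint: "is_adjoint (L \<one>) (L \<one>)"
  using is_adjoint_L[of \<one>] by (simp add: L_adj_one)

lemma L_ket: "g \<in> carrier G \<Longrightarrow> h \<in> carrier G \<Longrightarrow>
    blinfun_apply (L g) (ket h) = ell2_scaleC (\<sigma> g h) (ket (g \<otimes> h))"
  by (rule ell2_eqI) (auto simp: L_apply ell2_scaleC.rep_eq ket.rep_eq inv_solve_left m_assoc[symmetric])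

lemma positive_on_bounded:
  assumes "positive_on A \<phi>"
  shows "bounded_functional A \<phi>"
proof -
  have "cmod (\<phi> a) \<le> (8/3 * Re (\<phi> (L \<one>))) * norm a" if a: "a \<in> A" for a
  proof -
    obtain b where "is_adjoint a b"
      using A_adj_exists[OF a] by metis
    from positive_on_bound[OF cstar_A L_in_A[OF one_closed] A_unit L_one_selfadjoint assms a this]
    show ?thesis
      by (simp add: mult_ac)
  qed
  then show ?thesis
    using assms unfolding bounded_functional_def positive_on_def by blast
qed

lemma positive_on_star_automorphism:
  assumes \<Phi>: "star_automorphism A \<Phi>" and \<phi>: "positive_on A \<phi>"
  shows "positive_on A (\<lambda>a. \<phi> (\<Phi> a))"
proof -
  have in_A: "\<Phi> a \<in> A" if "a \<in> A" for a
    using \<Phi> that by (auto simp: star_automorphism_def bij_betw_def)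
  have "\<phi> (\<Phi> (c o\<^sub>L a)) \<in> \<real>\<^sub>\<ge>\<^sub>0" if ac: "a \<in> A" "is_adjoint a c" for a c
  proof -
    have "is_adjoint (\<Phi> a) (\<Phi> c)" "\<Phi> (c o\<^sub>L a) = \<Phi> c o\<^sub>L \<Phi> a"
      using \<Phi> ac A_adj[OF ac] by (auto simp: star_automorphism_def)
    then show ?thesis
      using \<phi> in_A[OF ac(1)] by (simp add: positive_on_def)
  qed
  then show ?thesis
    using \<Phi> \<phi> in_A by (simp add: star_automorphism_def positive_on_def)
qed

lemma functional_ext:
  assumes "bounded_functional A \<phi>" "bounded_functional A \<psi>"
    and "\<And>g. g \<in> carrier G \<Longrightarrow> \<phi> (L g) = \<psi> (L g)" and a: "a \<in> A"
  shows "\<phi> a = \<psi> a"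
proof -
  have "A \<subseteq> {a \<in> A. \<phi> a - \<psi> a = 0}"
  proof (rule A_subset_closed_subspace)
    show "closed {a \<in> A. \<phi> a - \<psi> a = 0}"
      by (intro continuous_closed_preimage_constant A_closed continuous_intros
          bounded_functional_continuous assms A_subspace)
    have "\<phi> 0 = 0" "\<psi> 0 = 0"
      using bounded_functional_diff[OF assms(1) A_subspace a a]
        bounded_functional_diff[OF assms(2) A_subspace a a] by auto
    then show "complex_subspace {a \<in> A. \<phi> a - \<psi> a = 0}"
      using assms(1,2) A_subspace by (simp add: complex_subspace_def bounded_functional_def)
  qed (use assms in auto)
  then show ?thesis
    using a by auto
qed

lemma bounded_functional_compose_left:
  assumes \<phi>: "bounded_functional A \<phi>" and b: "b \<in> A"
  shows "bounded_functional A (\<lambda>a. \<phi> (b o\<^sub>L a))"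
proof -
  obtain C where "C > 0" and C: "\<And>a. a \<in> A \<Longrightarrow> cmod (\<phi> a) \<le> C * norm a"
    using bounded_functional_bound[OF \<phi>] by metis
  have "cmod (\<phi> (b o\<^sub>L a)) \<le> (C * norm b) * norm a" if "a \<in> A" for a
  proof -
    have "C * norm (b o\<^sub>L a) \<le> C * (norm b * norm a)"
      using \<open>C > 0\<close> by (intro mult_left_mono norm_blinfun_compose) simp
    then show ?thesis
      using C[OF A_mult[OF b that]] by (simp only: mult.assoc)
  qed
  then show ?thesis
    using \<phi> b A_mult A_linear[OF b] unfolding bounded_functional_def
    by (auto simp: op_compose_add_right op_scaleC_compose_right)
qed

lemma bounded_functional_compose_right:
  assumes \<phi>: "bounded_functional A \<phi>" and b: "b \<in> A"
  shows "bounded_functional A (\<lambda>a. \<phi> (a o\<^sub>L b))"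
proof -
  obtain C where "C > 0" and C: "\<And>a. a \<in> A \<Longrightarrow> cmod (\<phi> a) \<le> C * norm a"
    using bounded_functional_bound[OF \<phi>] by metis
  have "cmod (\<phi> (a o\<^sub>L b)) \<le> (C * norm b) * norm a" if "a \<in> A" for a
  proof -
    have "C * norm (a o\<^sub>L b) \<le> C * (norm a * norm b)"
      using \<open>C > 0\<close> by (intro mult_left_mono norm_blinfun_compose) simp
    then show ?thesis
      using C[OF A_mult[OF that b]] by (simp only: mult.assoc mult.commute[of "norm b"])
  qed
  then show ?thesis
    using \<phi> b A_mult unfolding bounded_functional_def
    by (auto simp: op_compose_add_left op_scaleC_compose_left)
qed

lemma functional_tracial:
  assumes \<phi>: "bounded_functional A \<phi>"
    and gens: "\<And>g h. g \<in> carrier G \<Longrightarrow> h \<in> carrier G \<Longrightarrow> \<phi> (L g o\<^sub>L L h) = \<phi> (L h o\<^sub>L L g)"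
    and "a \<in> A" "b \<in> A"
  shows "\<phi> (a o\<^sub>L b) = \<phi> (b o\<^sub>L a)"
proof -
  have 1: "\<phi> (a o\<^sub>L L h) = \<phi> (L h o\<^sub>L a)" if "a \<in> A" "h \<in> carrier G" for a h
    using that
    by (intro functional_ext[where a = a and \<phi> = "\<lambda>a. \<phi> (a o\<^sub>L L h)" and \<psi> = "\<lambda>a. \<phi> (L h o\<^sub>L a)"]
        bounded_functional_compose_left bounded_functional_compose_right \<phi> gens) auto
  show ?thesis
    using assms
    by (intro functional_ext[where a = b and \<phi> = "\<lambda>b. \<phi> (a o\<^sub>L b)" and \<psi> = "\<lambda>b. \<phi> (b o\<^sub>L a)"]
        bounded_functional_compose_left bounded_functional_compose_right \<phi> 1) auto
qed

definition vec_functional :: "'a ell2 \<Rightarrow> 'a op \<Rightarrow> complex"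
  where "vec_functional \<xi> a = ell2_cinner \<xi> (blinfun_apply a \<xi>)"

lemma vec_functional_bound: "cmod (vec_functional \<xi> a) \<le> (norm \<xi>)\<^sup>2 * norm a"
proof -
  have "cmod (vec_functional \<xi> a) \<le> norm \<xi> * norm (blinfun_apply a \<xi>)"
    unfolding vec_functional_def by (rule cmod_ell2_cinner_le)
  also have "\<dots> \<le> norm \<xi> * (norm a * norm \<xi>)"
    by (intro mult_left_mono norm_blinfun) simp
  finally show ?thesis
    by (simp add: power2_eq_square mult_ac)
qed

lemma vec_functional_add: "vec_functional \<xi> (a + b) = vec_functional \<xi> a + vec_functional \<xi> b"
  by (simp add: vec_functional_def plus_blinfun.rep_eq ell2_cinner_add_right)

lemma vec_functional_scaleC: "vec_functional \<xi> (op_scaleC c a) = c * vec_functional \<xi> a"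
  by (simp add: vec_functional_def op_scaleC_apply ell2_cinner_scaleC_right)

lemma vec_functional_diff: "vec_functional \<xi> (a - b) = vec_functional \<xi> a - vec_functional \<xi> b"
  using vec_functional_add[of \<xi> "a - b" b] by simp

lemma vec_functional_adj_mult:
  "is_adjoint a b \<Longrightarrow> vec_functional \<xi> (b o\<^sub>L a) = complex_of_real ((norm (blinfun_apply a \<xi>))\<^sup>2)"
  unfolding vec_functional_def
  by (metis blinfun_apply_blinfun_compose ell2_cinner_self_norm is_adjoint_def)

lemma vec_functional_positive: "positive_on A (vec_functional \<xi>)"
  by (auto simp: positive_on_def vec_functional_add vec_functional_scaleC vec_functional_adj_mult)

abbreviation \<tau> :: "'a op \<Rightarrow> complex"
  where "\<tau> \<equiv> vec_functional (ket \<one>)"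

lemma trace_L: "g \<in> carrier G \<Longrightarrow> \<tau> (L g) = (if g = \<one> then 1 else 0)"
  by (auto simp: vec_functional_def ell2_cinner_ket L_ket ell2_scaleC.rep_eq ket.rep_eq)

lemma trace_bounded: "bounded_functional A \<tau>"
  by (intro positive_on_bounded vec_functional_positive)

lemma functional_L_mult: "bounded_functional A \<phi> \<Longrightarrow> g \<in> carrier G \<Longrightarrow> h \<in> carrier G \<Longrightarrow>
    \<phi> (L g o\<^sub>L L h) = \<sigma> g h * \<phi> (L (g \<otimes> h))"
  by (simp add: L_mult bounded_functional_def)

lemma trace_tracial: "a \<in> A \<Longrightarrow> b \<in> A \<Longrightarrow> \<tau> (a o\<^sub>L b) = \<tau> (b o\<^sub>L a)"
proof (rule functional_tracial[OF trace_bounded])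
  fix g h assume gh: "g \<in> carrier G" "h \<in> carrier G"
  have "g \<otimes> h = \<one> \<longleftrightarrow> h = inv g" "h \<otimes> g = \<one> \<longleftrightarrow> h = inv g"
    using gh inv_equality[of h g] inv_equality[of g h] by (auto simp: inv_comm)
  then show "\<tau> (L g o\<^sub>L L h) = \<tau> (L h o\<^sub>L L g)"
    using gh by (simp add: functional_L_mult[OF trace_bounded] trace_L sigma_inv)
qed

text \<open>By the trace property, the norm of \<open>a\<close> applied to the basis vector at \<open>g\<close> is the same for all
  \<open>g\<close> in the group.\<close>

lemma trace_faithful:
  assumes a: "a \<in> A" "is_adjoint a b" and 0: "\<tau> (b o\<^sub>L a) = 0"
  shows "a = 0"
proof -
  have bA: "b \<in> A"
    using A_adj a by blast
  have ket: "blinfun_apply a (ket g) = 0" if g: "g \<in> carrier G" for g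
  proof -
    have "complex_of_real ((norm (blinfun_apply a (ket g)))\<^sup>2) = vec_functional (ket \<one>) ((L_adj g o\<^sub>L b) o\<^sub>L (a o\<^sub>L L g))"
      using vec_functional_adj_mult[OF is_adjoint_compose[OF a(2) is_adjoint_L[OF g]], of "ket \<one>"] g
      by (simp add: L_ket)
    also have "\<dots> = \<tau> (L_adj g o\<^sub>L ((b o\<^sub>L a) o\<^sub>L L g))"
      by (simp add: op_compose_assoc)
    also have "\<dots> = \<tau> (((b o\<^sub>L a) o\<^sub>L L g) o\<^sub>L L_adj g)"
      using a bA g A_mult by (intro trace_tracial) auto
    also have "\<dots> = \<tau> (b o\<^sub>L a)"
      using a bA g A_mult A_unit[of "b o\<^sub>L a"] by (simp add: op_compose_assoc[of _ "L g"] L_L_adj)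
    finally show ?thesis
      using 0 by simp
  qed
  \<comment> \<open>The adjoint vanishes: its values are orthogonal to all basis vectors of the group, and
    they are supported on the group.\<close>
  have "blinfun_apply b \<eta> = 0" for \<eta>
  proof (rule ell2_eqI)
    fix x
    show "ell2_apply (blinfun_apply b \<eta>) x = ell2_apply 0 x"
    proof (cases "x \<in> carrier G")
      case True
      have "ell2_cinner (ket x) (blinfun_apply b \<eta>) = ell2_cinner 0 \<eta>"
        using a(2) ket[OF True] by (metis is_adjoint_def)
      then show ?thesis
        unfolding ell2_cinner_ket by (simp add: zero_ell2.rep_eq ell2_cinner.rep_eq)
    next
      case False
      have "blinfun_apply b \<eta> = blinfun_apply (L \<one>) (blinfun_apply b \<eta>)"
        using A_unit[OF bA] by (metis blinfun_apply_blinfun_compose)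
      then show ?thesis
        using L_apply[of \<one> _ x] False by (metis one_closed zero_ell2.rep_eq)
    qed
  qed
  then have "b = 0"
    by (intro blinfun_eqI) simp
  then show ?thesis
    using is_adjoint_norm_eq[OF a(2)] by simp
qed

lemma tracial_stateI:
  assumes "positive_on A \<phi>" "\<phi> (L \<one>) = 1"
    and "\<And>g h. g \<in> carrier G \<Longrightarrow> h \<in> carrier G \<Longrightarrow> \<phi> (L g o\<^sub>L L h) = \<phi> (L h o\<^sub>L L g)"
  shows "restrict \<phi> A \<in> tracial_states A"
proof -
  have tr: "\<phi> (a o\<^sub>L b) = \<phi> (b o\<^sub>L a)" if "a \<in> A" "b \<in> A" for a b
    using functional_tracial[OF positive_on_bounded[OF assms(1)] assms(3) that] .
  have "\<exists>u\<in>A. (\<forall>a\<in>A. u o\<^sub>L a = a \<and> a o\<^sub>L u = a) \<and> restrict \<phi> A u = 1"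
    using assms(2) A_unit by (intro bexI[of _ "L \<one>"]) auto
  then show ?thesis
    using assms(1) tr A_add A_scaleC A_mult A_adj by (simp add: tracial_states_def positive_on_def)
qed

lemma tracial_stateD:
  assumes "\<phi> \<in> tracial_states A"
  shows "positive_on A \<phi>" "\<phi> (L \<one>) = 1" "\<And>a b. a \<in> A \<Longrightarrow> b \<in> A \<Longrightarrow> \<phi> (a o\<^sub>L b) = \<phi> (b o\<^sub>L a)"
    "\<phi> \<in> extensional A"
proof -
  obtain u where u: "u \<in> A" "\<forall>a\<in>A. u o\<^sub>L a = a \<and> a o\<^sub>L u = a" "\<phi> u = 1"
    using assms by (auto simp: tracial_states_def)
  then have "u = L \<one>"
    using A_unit by (metis L_in_A one_closed)
  then show "\<phi> (L \<one>) = 1"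
    using u by simp
qed (use assms in \<open>auto simp: tracial_states_def positive_on_def\<close>)

lemma canonical_tracial_state: "restrict \<tau> A \<in> tracial_states A"
  by (intro tracial_stateI vec_functional_positive trace_tracial) (auto simp: trace_L)

end


section \<open>Averaging over an abelian subgroup\<close>

lemma op_compose_sum_left: "sum f I o\<^sub>L b = (\<Sum>i\<in>I. f i o\<^sub>L b)"
  by (induction I rule: infinite_finite_induct) (simp_all add: op_compose_add_left)

lemma op_compose_sum_right: "b o\<^sub>L sum f I = (\<Sum>i\<in>I. b o\<^sub>L f i)"
  by (induction I rule: infinite_finite_induct) (simp_all add: op_compose_add_right)

lemma is_adjoint_sum: "(\<And>i. i \<in> I \<Longrightarrow> is_adjoint (f i) (g i)) \<Longrightarrow> is_adjoint (sum f I) (sum g I)"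
  by (induction I rule: infinite_finite_induct) (simp_all add: is_adjoint_0 is_adjoint_add)

locale twisted_group_with_abelian_subgroup = twisted_group +
  fixes Y
  assumes Y_subgroup: "subgroup Y G"
    and Y_comm: "x \<in> Y \<Longrightarrow> y \<in> Y \<Longrightarrow> x \<otimes> y = y \<otimes> x"
begin

lemma Y_closed [simp]: "y \<in> Y \<Longrightarrow> y \<in> carrier G"
  by (rule subgroup.mem_carrier[OF Y_subgroup])

definition conj_op :: "'a \<Rightarrow> 'a op \<Rightarrow> 'a op"
  where "conj_op y a = L y o\<^sub>L (a o\<^sub>L L_adj y)"

text \<open>Convex combinations of conjugations by elements of \<open>Y\<close>. Adding one conjugation at a time on the
  outside keeps the proof of the Kadison inequality to a single induction; closure under
  composition follows.\<close>

inductive_set averages :: "('a op \<Rightarrow> 'a op) set"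
  where
    average_id: "(\<lambda>a. a) \<in> averages"
  | average_conj: "P \<in> averages \<Longrightarrow> y \<in> Y \<Longrightarrow> (\<lambda>a. conj_op y (P a)) \<in> averages"
  | average_convex: "P \<in> averages \<Longrightarrow> Q \<in> averages \<Longrightarrow> 0 \<le> t \<Longrightarrow> t \<le> 1 \<Longrightarrow>
      (\<lambda>a. t *\<^sub>R P a + (1 - t) *\<^sub>R Q a) \<in> averages"

lemma conj_op_add: "conj_op y (a + b) = conj_op y a + conj_op y b"
  by (simp add: conj_op_def op_compose_add_left op_compose_add_right)

lemma conj_op_scaleC: "y \<in> Y \<Longrightarrow> conj_op y (op_scaleC c a) = op_scaleC c (conj_op y a)"
  by (simp add: conj_op_def op_scaleC_compose_left op_scaleC_compose_right L_complex_linear)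

lemma conj_op_scaleR: "conj_op y (r *\<^sub>R a) = r *\<^sub>R conj_op y a"
  by (simp add: conj_op_def op_compose_scaleR_left op_compose_scaleR_right)

lemma conj_op_in_A: "y \<in> Y \<Longrightarrow> a \<in> A \<Longrightarrow> conj_op y a \<in> A"
  by (simp add: conj_op_def A_mult)

lemma norm_conj_op_le:
  assumes "y \<in> Y"
  shows "norm (conj_op y a) \<le> norm a"
proof -
  have "norm (conj_op y a) \<le> norm (L y) * norm (a o\<^sub>L L_adj y)"
    unfolding conj_op_def by (rule norm_blinfun_compose)
  also have "\<dots> \<le> 1 * (norm a * norm (L_adj y))"
    using assms by (intro mult_mono norm_blinfun_compose norm_L_le) auto
  also have "\<dots> \<le> 1 * (norm a * 1)"
    using assms by (intro mult_left_mono norm_L_adj_le) auto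
  finally show ?thesis
    by simp
qed

text \<open>The scalars by which generators multiply cancel in a conjugation, so that conjugations by
  elements of an abelian group commute although the unitaries themselves need not.\<close>

lemma conj_op_conj_op:
  assumes "x \<in> Y" "y \<in> Y" "a \<in> A"
  shows "conj_op x (conj_op y a) = conj_op (x \<otimes> y) a"
proof -
  have "is_adjoint (L x o\<^sub>L L y) (L_adj y o\<^sub>L L_adj x)"
    using assms by (intro is_adjoint_compose is_adjoint_L) auto
  moreover have "is_adjoint (L x o\<^sub>L L y) (op_scaleC (cnj (\<sigma> x y)) (L_adj (x \<otimes> y)))"
    using assms by (auto simp: L_mult intro!: is_adjoint_scaleC is_adjoint_L)
  ultimately have adj: "L_adj y o\<^sub>L L_adj x = op_scaleC (cnj (\<sigma> x y)) (L_adj (x \<otimes> y))"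
    by (rule is_adjoint_unique)
  have "conj_op x (conj_op y a) = (L x o\<^sub>L L y) o\<^sub>L (a o\<^sub>L (L_adj y o\<^sub>L L_adj x))"
    by (simp add: conj_op_def op_compose_assoc)
  also have "\<dots> = op_scaleC (\<sigma> x y * cnj (\<sigma> x y)) (conj_op (x \<otimes> y) a)"
    using assms by (simp add: adj L_mult op_scaleC_compose_left op_scaleC_compose_right
        A_linear L_complex_linear op_scaleC_mult conj_op_def)
  finally show ?thesis
    using sigma_cnj[of x y] assms by (simp add: mult.commute)
qed

lemma conj_op_commute: "x \<in> Y \<Longrightarrow> y \<in> Y \<Longrightarrow> a \<in> A \<Longrightarrow> conj_op x (conj_op y a) = conj_op y (conj_op x a)"
  by (simp add: conj_op_conj_op Y_comm)

lemma conj_op_L: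
  assumes y: "y \<in> Y" and g: "g \<in> carrier G"
  obtains c where "cmod c = 1" "conj_op y (L g) = op_scaleC c (L (y \<otimes> g \<otimes> inv y))"
proof
  let ?c = "cnj (\<sigma> (inv y) y) * \<sigma> g (inv y) * \<sigma> y (g \<otimes> inv y)"
  show "cmod ?c = 1"
    using assms by (simp add: norm_mult)
  show "conj_op y (L g) = op_scaleC ?c (L (y \<otimes> g \<otimes> inv y))"
    using assms by (simp add: conj_op_def L_adj_def op_scaleC_compose_right L_complex_linear L_mult
        op_scaleC_mult m_assoc)
qed

lemma conj_op_L_commuting:
  assumes y: "y \<in> Y" and g: "g \<in> carrier G" and yg: "y \<otimes> g = g \<otimes> y"
  shows "conj_op y (L g) = op_scaleC (\<sigma> y g * cnj (\<sigma> g y)) (L g)"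
proof -
  have "L y o\<^sub>L L g = op_scaleC (\<sigma> y g * (cnj (\<sigma> g y) * \<sigma> g y)) (L (g \<otimes> y))"
    using assms by (simp add: L_mult sigma_cnj)
  also have "\<dots> = op_scaleC (\<sigma> y g * cnj (\<sigma> g y)) (L g o\<^sub>L L y)"
    using assms by (simp add: L_mult op_scaleC_mult mult.assoc)
  finally have "(L y o\<^sub>L L g) o\<^sub>L L_adj y = op_scaleC (\<sigma> y g * cnj (\<sigma> g y)) (L g o\<^sub>L (L y o\<^sub>L L_adj y))"
    by (simp add: op_scaleC_compose_left op_compose_assoc)
  then show ?thesis
    using assms A_unit[of "L g"] by (simp add: conj_op_def op_compose_assoc L_L_adj)
qed

lemma conj_op_one: "y \<in> Y \<Longrightarrow> conj_op y (L \<one>) = L \<one>"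
  by (subst conj_op_L_commuting) (auto simp: op_scaleC_1)

lemma average_in_A: "P \<in> averages \<Longrightarrow> a \<in> A \<Longrightarrow> P a \<in> A"
  by (induction arbitrary: a rule: averages.induct) (auto intro: conj_op_in_A A_add A_scaleR)

lemma average_add: "P \<in> averages \<Longrightarrow> P (a + b) = P a + P b"
  by (induction rule: averages.induct) (auto simp: conj_op_add algebra_simps)

lemma average_scaleC: "P \<in> averages \<Longrightarrow> P (op_scaleC c a) = op_scaleC c (P a)"
  by (induction rule: averages.induct) (auto simp: conj_op_scaleC op_scaleC_add op_scaleC_scaleR)

lemma average_scaleR: "P \<in> averages \<Longrightarrow> P (r *\<^sub>R a) = r *\<^sub>R P a"
  using average_scaleC[of P "complex_of_real r" a] by (simp add: op_scaleC_of_real)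

lemma average_diff: "P \<in> averages \<Longrightarrow> P (a - b) = P a - P b"
  using average_add[of P "a - b" b] by simp

lemma average_one: "P \<in> averages \<Longrightarrow> P (L \<one>) = L \<one>"
  by (induction rule: averages.induct) (auto simp: conj_op_one simp flip: scaleR_add_left)

lemma average_norm_le: "P \<in> averages \<Longrightarrow> norm (P a) \<le> norm a"
proof (induction rule: averages.induct)
  case (average_conj P y)
  then show ?case
    using norm_conj_op_le order_trans by blast
next
  case (average_convex P Q t)
  have "norm (t *\<^sub>R P a + (1 - t) *\<^sub>R Q a) \<le> t * norm (P a) + (1 - t) * norm (Q a)"
    using average_convex norm_triangle_ineq[of "t *\<^sub>R P a" "(1 - t) *\<^sub>R Q a"] by simp
  also have "\<dots> \<le> t * norm a + (1 - t) * norm a"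
    using average_convex by (intro add_mono mult_left_mono) auto
  finally show ?case
    by (simp add: algebra_simps)
qed simp

lemma average_compose: "P \<in> averages \<Longrightarrow> Q \<in> averages \<Longrightarrow> (\<lambda>a. P (Q a)) \<in> averages"
  by (induction rule: averages.induct) (auto intro: averages.intros)

lemma average_commute:
  assumes "P \<in> averages" "Q \<in> averages" "a \<in> A"
  shows "P (Q a) = Q (P a)"
proof -
  have 1: "conj_op y (Q a) = Q (conj_op y a)" if "y \<in> Y" "Q \<in> averages" "a \<in> A" for y Q a
    using that(2,1,3)
    by (induction arbitrary: a rule: averages.induct)
      (auto simp: conj_op_add conj_op_scaleR conj_op_commute average_in_A)
  show ?thesis
    using assms
    by (induction arbitrary: a rule: averages.induct)
      (auto simp: 1 average_in_A average_add average_scaleR)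
qed

lemma average_ideal:
  assumes I: "closed_ideal A I"
  shows "P \<in> averages \<Longrightarrow> a \<in> I \<Longrightarrow> P a \<in> I"
proof (induction arbitrary: a rule: averages.induct)
  case (average_conj P y)
  then have "P a o\<^sub>L L_adj y \<in> I"
    using I by (simp add: closed_ideal_def)
  then show ?case
    using I average_conj by (simp add: closed_ideal_def conj_op_def)
next
  case (average_convex P Q t)
  have "complex_subspace I"
    using I by (simp add: closed_ideal_def)
  moreover from this average_convex have "t *\<^sub>R P a \<in> I" "(1 - t) *\<^sub>R Q a \<in> I"
    by (auto intro: complex_subspace_scaleR)
  ultimately show ?case
    by (simp add: complex_subspace_def)
qed simp

lemma average_trace:
  assumes \<phi>: "bounded_functional A \<phi>"
    and tr: "\<And>a b. a \<in> A \<Longrightarrow> b \<in> A \<Longrightarrow> \<phi> (a o\<^sub>L b) = \<phi> (b o\<^sub>L a)"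
  shows "P \<in> averages \<Longrightarrow> a \<in> A \<Longrightarrow> \<phi> (P a) = \<phi> a"
proof (induction rule: averages.induct)
  case (average_conj P y)
  have P: "P a \<in> A" and y: "y \<in> carrier G"
    using average_conj by (auto intro: average_in_A)
  have "\<phi> (conj_op y (P a)) = \<phi> ((P a o\<^sub>L L_adj y) o\<^sub>L L y)"
    unfolding conj_op_def using P y by (intro tr) (auto intro: A_mult)
  also have "\<dots> = \<phi> (P a)"
    using P y A_unit by (simp add: op_compose_assoc L_adj_L)
  finally show ?case
    using average_conj by simp
next
  case (average_convex P Q t)
  have "t *\<^sub>R P a \<in> A" "(1 - t) *\<^sub>R Q a \<in> A" "P a \<in> A" "Q a \<in> A"
    using average_convex by (auto intro: average_in_A A_scaleR)
  moreover have "\<phi> (r *\<^sub>R b) = r * \<phi> b" if "b \<in> A" for r b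
    using \<phi> that by (simp add: bounded_functional_def flip: op_scaleC_of_real)
  ultimately have "\<phi> (t *\<^sub>R P a + (1 - t) *\<^sub>R Q a) = t * \<phi> (P a) + (1 - t) * \<phi> (Q a)"
    using \<phi> by (simp add: bounded_functional_def)
  then show ?case
    using average_convex by (simp add: algebra_simps)
qed simp

text \<open>Kadison's inequality \<open>P(a)* P(a) \<le> P(a* a)\<close> as an inequality of quadratic forms. Conjugations
  satisfy it since \<open>L y\<close> is a contraction, convex combinations by convexity of the square.\<close>

lemma average_Kadison_vector:
  assumes ab: "is_adjoint a b"
  shows "P \<in> averages \<Longrightarrow>
    (norm (blinfun_apply (P a) \<xi>))\<^sup>2 \<le> Re (ell2_cinner \<xi> (blinfun_apply (P (b o\<^sub>L a)) \<xi>))"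
proof (induction arbitrary: \<xi> rule: averages.induct)
  case average_id
  show ?case
    using vec_functional_adj_mult[OF ab, of \<xi>] by (simp add: vec_functional_def)
next
  case (average_conj P y)
  let ?\<eta> = "blinfun_apply (L_adj y) \<xi>"
  have y: "y \<in> carrier G"
    using average_conj by simp
  have "norm (blinfun_apply (conj_op y (P a)) \<xi>) \<le> norm (L y) * norm (blinfun_apply (P a) ?\<eta>)"
    by (simp add: conj_op_def norm_blinfun)
  also have "\<dots> \<le> 1 * norm (blinfun_apply (P a) ?\<eta>)"
    using y by (intro mult_right_mono norm_L_le) auto
  finally have "(norm (blinfun_apply (conj_op y (P a)) \<xi>))\<^sup>2 \<le> (norm (blinfun_apply (P a) ?\<eta>))\<^sup>2"
    by (intro power_mono) auto
  also have "\<dots> \<le> Re (ell2_cinner ?\<eta> (blinfun_apply (P (b o\<^sub>L a)) ?\<eta>))"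
    by (rule average_conj)
  also have "ell2_cinner ?\<eta> (blinfun_apply (P (b o\<^sub>L a)) ?\<eta>) =
      ell2_cinner \<xi> (blinfun_apply (conj_op y (P (b o\<^sub>L a))) \<xi>)"
    using is_adjoint_sym[OF is_adjoint_L[OF y]] by (simp add: is_adjoint_def conj_op_def)
  finally show ?case .
next
  case (average_convex P Q t)
  let ?x = "blinfun_apply (P a) \<xi>" and ?y = "blinfun_apply (Q a) \<xi>"
  have "norm (t *\<^sub>R ?x + (1 - t) *\<^sub>R ?y) \<le> t * norm ?x + (1 - t) * norm ?y"
    using average_convex norm_triangle_ineq[of "t *\<^sub>R ?x" "(1 - t) *\<^sub>R ?y"] by simp
  then have "(norm (t *\<^sub>R ?x + (1 - t) *\<^sub>R ?y))\<^sup>2 \<le> (t * norm ?x + (1 - t) * norm ?y)\<^sup>2"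
    by (intro power_mono) auto
  also have "\<dots> = t * (norm ?x)\<^sup>2 + (1 - t) * (norm ?y)\<^sup>2 - t * (1 - t) * (norm ?x - norm ?y)\<^sup>2"
    by (simp add: power2_eq_square algebra_simps)
  also have "\<dots> \<le> t * (norm ?x)\<^sup>2 + (1 - t) * (norm ?y)\<^sup>2"
    using average_convex by simp
  also have "\<dots> \<le> t * Re (ell2_cinner \<xi> (blinfun_apply (P (b o\<^sub>L a)) \<xi>)) +
      (1 - t) * Re (ell2_cinner \<xi> (blinfun_apply (Q (b o\<^sub>L a)) \<xi>))"
    using average_convex by (intro add_mono mult_left_mono) auto
  also have "\<dots> = Re (ell2_cinner \<xi> (blinfun_apply (t *\<^sub>R P (b o\<^sub>L a) + (1 - t) *\<^sub>R Q (b o\<^sub>L a)) \<xi>))"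
    by (simp add: plus_blinfun.rep_eq scaleR_blinfun.rep_eq ell2_cinner_add_right
        ell2_scaleR_scaleC ell2_cinner_scaleC_right)
  finally show ?case
    by (simp add: plus_blinfun.rep_eq scaleR_blinfun.rep_eq)
qed

lemma average_Kadison:
  assumes "is_adjoint a b" "P \<in> averages"
  shows "(norm (P a))\<^sup>2 \<le> norm (P (b o\<^sub>L a))"
proof -
  have "norm (P a) \<le> sqrt (norm (P (b o\<^sub>L a)))"
  proof (rule norm_blinfun_bound)
    fix \<xi>
    have "(norm (blinfun_apply (P a) \<xi>))\<^sup>2 \<le> Re (ell2_cinner \<xi> (blinfun_apply (P (b o\<^sub>L a)) \<xi>))"
      using assms by (rule average_Kadison_vector)
    also have "\<dots> \<le> (norm \<xi>)\<^sup>2 * norm (P (b o\<^sub>L a))"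
      using vec_functional_bound[of \<xi> "P (b o\<^sub>L a)"] complex_Re_le_cmod order_trans
      unfolding vec_functional_def by blast
    finally have "(norm (blinfun_apply (P a) \<xi>))\<^sup>2 \<le> (sqrt (norm (P (b o\<^sub>L a))) * norm \<xi>)\<^sup>2"
      by (simp add: power_mult_distrib mult.commute)
    then show "norm (blinfun_apply (P a) \<xi>) \<le> sqrt (norm (P (b o\<^sub>L a))) * norm \<xi>"
      by (rule power2_le_imp_le) simp
  qed simp
  then show ?thesis
    using power_mono[of "norm (P a)" "sqrt (norm (P (b o\<^sub>L a)))" 2] by simp
qed

definition averages_to_zero :: "'a op \<Rightarrow> bool"
  where "averages_to_zero a \<longleftrightarrow> (\<forall>e>0. \<exists>P\<in>averages. norm (P a) < e)"

text \<open>Commutativity of the averages is essential: the average that makes one summand small is composed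
  with the one that makes the other summand small.\<close>

lemma averages_to_zero_add:
  assumes "averages_to_zero a" "averages_to_zero b" "a \<in> A" "b \<in> A"
  shows "averages_to_zero (a + b)"
  unfolding averages_to_zero_def
proof (intro allI impI)
  fix e :: real assume "0 < e"
  then obtain P Q where P: "P \<in> averages" "norm (P a) < e/2" and Q: "Q \<in> averages" "norm (Q b) < e/2"
    using assms by (meson averages_to_zero_def half_gt_zero)
  have "P (Q (a + b)) = Q (P a) + P (Q b)"
    using P Q assms by (simp add: average_add average_commute)
  then have "norm (P (Q (a + b))) \<le> norm (Q (P a)) + norm (P (Q b))"
    by (simp add: norm_triangle_ineq)
  also have "\<dots> < e"
    using P Q average_norm_le[OF Q(1), of "P a"] average_norm_le[OF P(1), of "Q b"] by simp
  finally show "\<exists>P\<in>averages. norm (P (a + b)) < e"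
    using average_compose[OF P(1) Q(1)] by (rule_tac bexI)
qed

lemma averages_to_zero_scaleC:
  assumes "averages_to_zero a"
  shows "averages_to_zero (op_scaleC c a)"
  unfolding averages_to_zero_def
proof (intro allI impI)
  fix e :: real assume "0 < e"
  then have "e / (cmod c + 1) > 0"
    by (simp add: add_nonneg_pos)
  then obtain P where P: "P \<in> averages" "norm (P a) < e / (cmod c + 1)"
    using assms by (meson averages_to_zero_def)
  have "norm (P (op_scaleC c a)) = cmod c * norm (P a)"
    using P by (simp add: average_scaleC norm_op_scaleC)
  also have "\<dots> \<le> (cmod c + 1) * norm (P a)"
    by (intro mult_right_mono) auto
  also have "\<dots> < e"
    using P(2) by (simp add: pos_less_divide_eq add_nonneg_pos mult.commute)
  finally show "\<exists>P\<in>averages. norm (P (op_scaleC c a)) < e"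
    using P(1) by blast
qed

lemma averages_to_zero_subspace: "complex_subspace {a \<in> A. averages_to_zero a}"
proof -
  have "averages_to_zero 0"
    unfolding averages_to_zero_def using average_id by force
  then show ?thesis
    using A_subspace averages_to_zero_add averages_to_zero_scaleC
    by (auto simp: complex_subspace_def)
qed

lemma averages_to_zero_closed: "closed {a \<in> A. averages_to_zero a}"
  unfolding closed_sequential_limits
proof (intro allI impI, elim conjE)
  fix s a assume s: "\<forall>n. s n \<in> {a \<in> A. averages_to_zero a}" "s \<longlonglongrightarrow> a"
  have "averages_to_zero a"
    unfolding averages_to_zero_def
  proof (intro allI impI)
    fix e :: real assume e: "0 < e"
    then obtain n where n: "norm (s n - a) < e/2"
      using s(2) by (metis LIMSEQ_iff half_gt_zero order_refl)
    obtain P where P: "P \<in> averages" "norm (P (s n)) < e/2"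
      using s(1) e by (metis (no_types, lifting) averages_to_zero_def half_gt_zero mem_Collect_eq)
    have "P a = P (s n) - P (s n - a)"
      using P by (simp add: average_diff)
    then have "norm (P a) \<le> norm (P (s n)) + norm (P (s n - a))"
      by (simp add: norm_triangle_ineq4)
    also have "\<dots> < e"
      using P n average_norm_le[OF P(1), of "s n - a"] by simp
    finally show "\<exists>P\<in>averages. norm (P a) < e"
      using P(1) by blast
  qed
  moreover have "a \<in> A"
    using closed_sequentially[OF A_closed _ s(2)] s(1) by simp
  ultimately show "a \<in> {a \<in> A. averages_to_zero a}"
    by simp
qed

text \<open>Conjugation by \<open>y\<close> multiplies \<open>L g\<close> by a number \<open>z \<noteq> 1\<close> of modulus one; the mean of the identity
  and this conjugation multiplies \<open>L g\<close> by \<open>(1 + z)/2\<close>, which lies inside the unit disc.\<close>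

lemma averages_to_zero_not_regular:
  assumes g: "g \<in> Y" and y: "y \<in> Y" and ne: "\<sigma> g y \<noteq> \<sigma> y g"
  shows "averages_to_zero (L g)"
  unfolding averages_to_zero_def
proof (intro allI impI)
  fix e :: real assume "0 < e"
  define z where "z = \<sigma> y g * cnj (\<sigma> g y)"
  have z: "conj_op y (L g) = op_scaleC z (L g)"
    using assms by (simp add: conj_op_L_commuting Y_comm z_def)
  have cmod_z: "cmod z = 1"
    using g y by (simp add: z_def norm_mult)
  have "z \<noteq> 1"
  proof
    assume "z = 1"
    then have "\<sigma> y g * (cnj (\<sigma> g y) * \<sigma> g y) = \<sigma> g y"
      by (simp add: z_def mult.assoc[symmetric])
    then show False
      using ne g y by (simp add: sigma_cnj)
  qed
  define r where "r = (1/2) * (1 + z)"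
  \<comment> \<open>Equality in the triangle inequality would force \<open>z\<close> to be positive.\<close>
  have "cmod (1 + z) \<noteq> cmod 1 + cmod z"
  proof
    assume "cmod (1 + z) = cmod 1 + cmod z"
    then have "cmod 1 *\<^sub>R z = cmod z *\<^sub>R 1"
      by (simp only: norm_triangle_eq)
    then show False
      using \<open>z \<noteq> 1\<close> cmod_z by simp
  qed
  then have r: "cmod r < 1"
    using norm_triangle_ineq[of 1 z] cmod_z by (simp add: r_def norm_mult)
  define M where "M a = (1/2) *\<^sub>R a + (1 - 1/2) *\<^sub>R conj_op y a" for a
  have M: "M \<in> averages"
    unfolding M_def using y by (intro average_convex average_conj average_id) auto
  have M_gen: "M (L g) = op_scaleC r (L g)"
    unfolding M_def z r_def by (simp add: op_scaleC_mult distrib_left op_scaleC_add_left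
        flip: op_scaleC_of_real)
  have powers: "(M ^^ n) \<in> averages \<and> (M ^^ n) (L g) = op_scaleC (r ^ n) (L g)" for n
  proof (induction n)
    case 0
    show ?case
      using average_id by (simp add: id_def)
  next
    case (Suc n)
    then show ?case
      using average_compose[OF M] M
      by (auto simp: comp_def average_scaleC M_gen op_scaleC_mult mult.commute)
  qed
  obtain n where "cmod r ^ n < e"
    using real_arch_pow_inv[OF \<open>0 < e\<close> r] by blast
  moreover have "norm ((M ^^ n) (L g)) \<le> cmod r ^ n"
    using powers[of n] norm_L_le[of g] g
    by (simp add: norm_op_scaleC norm_power mult_left_le)
  ultimately show "\<exists>P\<in>averages. norm (P (L g)) < e"
    using powers[of n] by (intro bexI[of _ "M ^^ n"]) auto
qed

lemma average_uniform:
  assumes "finite T" "T \<noteq> {}" "\<And>t. t \<in> T \<Longrightarrow> y t \<in> Y"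
  shows "(\<lambda>a. (1 / real (card T)) *\<^sub>R (\<Sum>t\<in>T. conj_op (y t) a)) \<in> averages"
  using assms
proof (induction rule: finite_ne_induct)
  case (singleton x)
  then show ?case
    using average_conj[OF average_id, of "y x"] by simp
next
  case (insert x F)
  let ?n = "real (card F)"
  have n: "?n > 0"
    using insert by (simp add: card_gt_0_iff)
  let ?P = "\<lambda>a. (1 / (?n + 1)) *\<^sub>R conj_op (y x) a + (1 - 1 / (?n + 1)) *\<^sub>R ((1 / ?n) *\<^sub>R (\<Sum>t\<in>F. conj_op (y t) a))"
  have "?P \<in> averages"
    using insert by (intro average_convex average_conj[OF average_id]) auto
  moreover have "(1 - 1 / (?n + 1)) * (1 / ?n) = 1 / (?n + 1)"
    using n by (simp add: field_simps)
  ultimately show ?case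
    using insert by (simp add: scaleR_add_right add.commute)
qed

text \<open>The mean \<open>X\<close> of \<open>n\<close> distinct conjugates of \<open>L g\<close> satisfies \<open>X* X = 1/n\<close> up to nontrivial
  generators from \<open>Y\<close>, which average to zero; the Kadison inequality turns this into a bound for a
  further average of \<open>X\<close> itself.\<close>

lemma averages_to_zero_infinite_orbit:
  assumes g: "g \<in> carrier G"
    and normal: "\<And>y. y \<in> Y \<Longrightarrow> inv g \<otimes> y \<otimes> g \<in> Y"
    and orbit: "infinite ((\<lambda>y. y \<otimes> g \<otimes> inv y) ` Y)"
    and null: "\<And>y. y \<in> Y \<Longrightarrow> y \<noteq> \<one> \<Longrightarrow> averages_to_zero (L y)"
  shows "averages_to_zero (L g)"
  unfolding averages_to_zero_def
proof (intro allI impI)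
  fix e :: real assume e: "0 < e"
  then obtain n :: nat where n: "n > 0" "1 / n < e\<^sup>2 / 2"
    using ex_inverse_of_nat_less[of "e\<^sup>2 / 2"] by (auto simp: inverse_eq_divide)
  obtain T where T: "T \<subseteq> (\<lambda>y. y \<otimes> g \<otimes> inv y) ` Y" "finite T" "card T = n"
    using infinite_arbitrarily_large[OF orbit] by blast
  have "\<forall>t\<in>T. \<exists>y\<in>Y. t = y \<otimes> g \<otimes> inv y"
    using T(1) by auto
  then obtain y where y: "\<And>t. t \<in> T \<Longrightarrow> y t \<in> Y" "\<And>t. t \<in> T \<Longrightarrow> y t \<otimes> g \<otimes> inv (y t) = t"
    by metis
  have Tc: "t \<in> carrier G" if "t \<in> T" for t
    using y[OF that] g by (metis Y_closed inv_closed m_closed)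
  have quot: "inv s \<otimes> t \<in> Y" if "s \<in> T" "t \<in> T" for s t
  proof -
    have "inv s \<otimes> t = y s \<otimes> (inv g \<otimes> (inv (y s) \<otimes> y t) \<otimes> g) \<otimes> inv (y t)"
    proof -
      have "inv (y s \<otimes> g \<otimes> inv (y s)) \<otimes> (y t \<otimes> g \<otimes> inv (y t)) =
          y s \<otimes> (inv g \<otimes> (inv (y s) \<otimes> y t) \<otimes> g) \<otimes> inv (y t)"
        using y(1)[OF that(1)] y(1)[OF that(2)] g by (simp add: inv_mult_group m_assoc)
      then show ?thesis
        using y(2) that by simp
    qed
    then show ?thesis
      using y(1) that Y_subgroup
      by (simp add: normal subgroup.m_closed subgroup.m_inv_closed)
  qed
  have "\<forall>t\<in>T. \<exists>c. cmod c = 1 \<and> conj_op (y t) (L g) = op_scaleC c (L t)"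
    using conj_op_L[OF y(1) g] y(2) by metis
  then obtain c where c: "\<And>t. t \<in> T \<Longrightarrow> cmod (c t) = 1"
    "\<And>t. t \<in> T \<Longrightarrow> conj_op (y t) (L g) = op_scaleC (c t) (L t)"
    by metis
  define P where "P a = (1 / real n) *\<^sub>R (\<Sum>t\<in>T. conj_op (y t) a)" for a
  have P: "P \<in> averages"
    unfolding P_def T(3)[symmetric] using T n y by (intro average_uniform) auto
  define X where "X = (1 / real n) *\<^sub>R (\<Sum>t\<in>T. op_scaleC (c t) (L t))"
  define X' where "X' = (1 / real n) *\<^sub>R (\<Sum>t\<in>T. op_scaleC (cnj (c t)) (L_adj t))"
  have PX: "P (L g) = X"
    using c by (simp add: P_def X_def)
  have adj: "is_adjoint X X'"
    unfolding X_def X'_def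
    using Tc by (intro is_adjoint_scaleR is_adjoint_sum is_adjoint_scaleC is_adjoint_L)
  let ?V = "{a \<in> A. averages_to_zero a}"
  define w where "w s t = op_scaleC (cnj (c s)) (L_adj s) o\<^sub>L op_scaleC (c t) (L t)" for s t
  have w: "w s t - (if s = t then L \<one> else 0) \<in> ?V" if st: "s \<in> T" "t \<in> T" for s t
  proof -
    have w_eq: "w s t = op_scaleC (cnj (c s) * c t) (L_adj s o\<^sub>L L t)"
      using st Tc by (simp add: w_def op_scaleC_compose_left op_scaleC_compose_right
          L_adj_complex_linear op_scaleC_mult)
    show ?thesis
    proof (cases "s = t")
      case True
      have "cnj (c t) * c t = 1"
        using c(1)[OF st(2)] complex_norm_square[of "c t"] by (simp add: mult.commute)
      then have "w s t = L \<one>"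
        using st Tc unfolding w_eq unfolding True by (simp add: L_adj_L)
      then show ?thesis
        using True averages_to_zero_subspace by (simp add: complex_subspace_def)
    next
      case False
      have "inv s \<otimes> t \<noteq> \<one>"
        using False Tc[OF st(1)] Tc[OF st(2)] by (metis inv_equality inv_inv inv_closed)
      then have "L (inv s \<otimes> t) \<in> ?V"
        using null quot[OF st] by simp
      moreover have "w s t = op_scaleC (cnj (c s) * c t * (cnj (\<sigma> (inv s) s) * \<sigma> (inv s) t)) (L (inv s \<otimes> t))"
        using st Tc by (simp add: w_eq L_adj_def op_scaleC_compose_left L_mult op_scaleC_mult)
      ultimately show ?thesis
        using False averages_to_zero_subspace by (simp add: complex_subspace_def)
    qed
  qed
  have "(X' o\<^sub>L X) - (1 / real n) *\<^sub>R L \<one> =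
      (1 / real n * (1 / real n)) *\<^sub>R (\<Sum>s\<in>T. \<Sum>t\<in>T. w s t - (if s = t then L \<one> else 0))"
  proof -
    have "(\<Sum>s\<in>T. \<Sum>t\<in>T. (if s = t then L \<one> else 0)) = real n *\<^sub>R L \<one>"
      using T by (simp add: sum_constant_scaleR)
    moreover have "X' o\<^sub>L X = (1 / real n * (1 / real n)) *\<^sub>R (\<Sum>s\<in>T. \<Sum>t\<in>T. w s t)"
      unfolding X_def X'_def w_def op_compose_scaleR_left op_compose_scaleR_right
      unfolding op_compose_sum_left
      unfolding op_compose_sum_right by simp
    ultimately show ?thesis
      using n by (simp add: sum_subtractf scaleR_diff_right)
  qed
  also have "\<dots> \<in> ?V"
    by (intro complex_subspace_scaleR complex_subspace_sum averages_to_zero_subspace w)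
  finally have "averages_to_zero ((X' o\<^sub>L X) - (1 / real n) *\<^sub>R L \<one>)"
    by simp
  moreover have "e\<^sup>2 / 2 > 0"
    using e by simp
  ultimately obtain Q where Q: "Q \<in> averages" "norm (Q ((X' o\<^sub>L X) - (1 / real n) *\<^sub>R L \<one>)) < e\<^sup>2 / 2"
    unfolding averages_to_zero_def by blast
  have "Q (X' o\<^sub>L X) = Q ((X' o\<^sub>L X) - (1 / real n) *\<^sub>R L \<one>) + (1 / real n) *\<^sub>R L \<one>"
    using Q(1) by (simp add: average_diff average_scaleR average_one)
  then have "norm (Q (X' o\<^sub>L X)) \<le> norm (Q ((X' o\<^sub>L X) - (1 / real n) *\<^sub>R L \<one>)) + norm ((1 / real n) *\<^sub>R L \<one>)"
    by (simp only: norm_triangle_ineq)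
  also have "\<dots> \<le> norm (Q ((X' o\<^sub>L X) - (1 / real n) *\<^sub>R L \<one>)) + 1 / real n"
    using norm_L_le[of \<one>] n by (simp add: divide_right_mono)
  also have "\<dots> < e\<^sup>2"
    using Q(2) n(2) by simp
  finally have "(norm (Q X))\<^sup>2 < e\<^sup>2"
    using average_Kadison[OF adj Q(1)] by simp
  then have "norm (Q (P (L g))) < e"
    using e by (simp add: PX power_less_imp_less_base)
  then show "\<exists>P\<in>averages. norm (P (L g)) < e"
    using average_compose[OF Q(1) P] by (rule bexI)
qed

text \<open>A relative Dixmier property: subtracting \<open>\<tau>(a)\<close> kills the coefficient at the neutral element,
  and the elements averaging to zero form a closed subspace.\<close>

lemma averages_to_trace:
  assumes null: "\<And>g. g \<in> carrier G \<Longrightarrow> g \<noteq> \<one> \<Longrightarrow> averages_to_zero (L g)" and a: "a \<in> A"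
  shows "averages_to_zero (a - op_scaleC (\<tau> a) (L \<one>))"
proof -
  let ?V = "{a \<in> A. averages_to_zero a}"
  define E where "E a = a - op_scaleC (\<tau> a) (L \<one>)" for a
  have Vs: "0 \<in> ?V" "\<And>a b. a \<in> ?V \<Longrightarrow> b \<in> ?V \<Longrightarrow> a + b \<in> ?V" "\<And>a c. a \<in> ?V \<Longrightarrow> op_scaleC c a \<in> ?V"
    using averages_to_zero_subspace unfolding complex_subspace_def by blast+
  have E_add: "E (a + b) = E a + E b" for a b
    by (simp add: E_def vec_functional_add op_scaleC_add_left)
  have E_scaleC: "E (op_scaleC c a) = op_scaleC c (E a)" for c a
    by (simp add: E_def vec_functional_scaleC op_scaleC_mult op_scaleC_diff)
  have E_diff: "E (a - b) = E a - E b" for a b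
    using E_add[of "a - b" b] by simp
  have bE: "bounded_linear E"
  proof (rule bounded_linear_intro[where K = 2])
    show "E (r *\<^sub>R a) = r *\<^sub>R E a" for r a
      using E_scaleC[of "complex_of_real r" a] by (simp add: op_scaleC_of_real)
    show "norm (E a) \<le> norm a * 2" for a
    proof -
      have "norm (E a) \<le> norm a + cmod (\<tau> a) * norm (L \<one>)"
        using norm_triangle_ineq4[of a "op_scaleC (\<tau> a) (L \<one>)"] by (simp add: E_def norm_op_scaleC)
      also have "\<dots> \<le> norm a + norm a * 1"
        using vec_functional_bound[of "ket \<one>" a] norm_L_le[of \<one>]
        by (intro add_left_mono mult_mono) auto
      finally show ?thesis
        by simp
    qed
  qed (rule E_add)
  have "A \<subseteq> E -` ?V"
  proof (rule A_subset_closed_subspace)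
    show "closed (E -` ?V)"
      using bE by (intro continuous_closed_vimage averages_to_zero_closed)
        (simp add: linear_continuous_at)
    have "E 0 = 0"
      using E_diff[of 0 0] by simp
    then show "complex_subspace (E -` ?V)"
      unfolding complex_subspace_def vimage_eq using Vs by (simp only: E_add E_scaleC) blast
    show "L g \<in> E -` ?V" if "g \<in> carrier G" for g
      using null[OF that] Vs(1) that by (cases "g = \<one>") (auto simp: E_def trace_L)
  qed
  then show ?thesis
    using a by (auto simp: E_def)
qed

text \<open>If \<open>a\<close> is a nonzero element of an ideal, then averaging \<open>a* a\<close> stays in the ideal and approaches
  the nonzero multiple \<open>\<tau>(a* a)\<close> of the unit.\<close>

lemma simple_of_averaging:
  assumes null: "\<And>g. g \<in> carrier G \<Longrightarrow> g \<noteq> \<one> \<Longrightarrow> averages_to_zero (L g)"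
  shows "simple_cstar A"
proof -
  have L1: "L \<one> \<noteq> 0"
    using trace_L[of \<one>] vec_functional_diff[of "ket \<one>" 0 0] by auto
  have full: "I = A" if I: "closed_ideal A I" and a: "a \<in> I" "a \<noteq> 0" for I a
  proof -
    have sub: "complex_subspace I" and IA: "I \<subseteq> A"
      using I by (auto simp: closed_ideal_def)
    obtain b where b: "b \<in> A" "is_adjoint a b"
      using A_adj_exists a IA by blast
    define t where "t = \<tau> (b o\<^sub>L a)"
    have t: "t \<noteq> 0"
      using trace_faithful[of a b] a IA b by (auto simp: t_def)
    have ba: "b o\<^sub>L a \<in> I"
      using I a b by (simp add: closed_ideal_def)
    have "op_scaleC t (L \<one>) \<in> closure I"
      unfolding closure_approachable
    proof (intro allI impI)
      fix e :: real assume "0 < e"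
      then obtain P where P: "P \<in> averages" "norm (P ((b o\<^sub>L a) - op_scaleC t (L \<one>))) < e"
        using averages_to_trace[OF null, of "b o\<^sub>L a"] ba IA
        unfolding averages_to_zero_def t_def by blast
      have "dist (P (b o\<^sub>L a)) (op_scaleC t (L \<one>)) < e"
        using P by (simp add: average_diff average_scaleC average_one dist_norm)
      then show "\<exists>y\<in>I. dist y (op_scaleC t (L \<one>)) < e"
        using average_ideal[OF I P(1) ba] by blast
    qed
    then have "op_scaleC t (L \<one>) \<in> I"
      using I by (simp add: closed_ideal_def)
    then have "op_scaleC (inverse t) (op_scaleC t (L \<one>)) \<in> I"
      using sub unfolding complex_subspace_def by blast
    then have "L \<one> \<in> I"
      using t by (simp add: op_scaleC_mult)
    then have "x \<in> I" if "x \<in> A" for x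
      using I A_unit[OF that] that unfolding closed_ideal_def by metis
    then show ?thesis
      using IA by blast
  qed
  have "closed_ideal A {0}" 
    using A_subspace by (auto simp: closed_ideal_def complex_subspace_def)
  moreover have "{0} \<noteq> A"
    using L1 L_in_A[OF one_closed] by blast
  moreover have "I = {0}" if "closed_ideal A I" "I \<noteq> A" for I
    using full[OF that(1)] that by (auto simp: closed_ideal_def complex_subspace_def)
  ultimately show ?thesis
    unfolding simple_cstar_def by blast
qed

lemma unique_trace_of_averaging:
  assumes null: "\<And>g. g \<in> carrier G \<Longrightarrow> g \<noteq> \<one> \<Longrightarrow> averages_to_zero (L g)"
  shows "unique_trace_property G \<sigma>"
  unfolding unique_trace_property_def
proof (rule ex1I)
  show "restrict \<tau> A \<in> tracial_states A"
    by (rule canonical_tracial_state)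
  fix \<phi> assume \<phi>: "\<phi> \<in> tracial_states A"
  note \<phi>' = tracial_stateD[OF this]
  have bf: "bounded_functional A \<phi>"
    using \<phi>'(1) by (rule positive_on_bounded)
  obtain C where C: "C > 0" "\<And>a. a \<in> A \<Longrightarrow> cmod (\<phi> a) \<le> C * norm a"
    using bounded_functional_bound[OF bf] by metis
  have "\<phi> (L g) = \<tau> (L g)" if g: "g \<in> carrier G" for g
  proof (cases "g = \<one>")
    case True
    then show ?thesis
      using \<phi>'(2) by (simp add: trace_L)
  next
    case False
    have "cmod (\<phi> (L g)) \<le> 0"
    proof (rule field_le_epsilon)
      fix e :: real assume "0 < e"
      then obtain P where P: "P \<in> averages" "norm (P (L g)) < e / C"
        using null[OF g False] C(1) unfolding averages_to_zero_def by (meson divide_pos_pos)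
      have "cmod (\<phi> (L g)) = cmod (\<phi> (P (L g)))"
        using average_trace[OF bf \<phi>'(3) P(1), of "L g"] g by simp
      also have "\<dots> \<le> C * norm (P (L g))"
        using average_in_A[OF P(1)] g by (intro C(2)) simp
      also have "\<dots> \<le> C * (e / C)"
        using P C(1) by (intro mult_left_mono) auto
      finally show "cmod (\<phi> (L g)) \<le> 0 + e"
        using C(1) by simp
    qed
    then show ?thesis
      using False g by (simp add: trace_L)
  qed
  then have "\<phi> a = \<tau> a" if "a \<in> A" for a
    using functional_ext[OF bf trace_bounded _ that] by blast
  then show "\<phi> = restrict \<tau> A"
    using \<phi>'(4) by (intro extensionalityI[of _ A]) auto
qed

end


section \<open>Divisible subgroups are direct factors\<close>

lemma (in comm_group) subgroup_adjoin_powers: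
  assumes N: "subgroup N G" and z: "z \<in> carrier G"
  shows "subgroup {a \<otimes> z [^] (m :: int) | a m. a \<in> N} G" (is "subgroup ?N' G")
proof (rule subgroupI)
  note Nc = subgroup.mem_carrier[OF N]
  show "?N' \<subseteq> carrier G"
    using z Nc by auto
  show "?N' \<noteq> {}"
    using subgroup.one_closed[OF N] by auto
  fix x assume "x \<in> ?N'"
  then obtain a m where x: "a \<in> N" "x = a \<otimes> z [^] (m :: int)"
    by auto
  have "inv x = inv a \<otimes> z [^] (- m)"
    using x z Nc by (simp add: inv_mult int_pow_neg)
  then show "inv x \<in> ?N'"
    using x subgroup.m_inv_closed[OF N] by blast
  fix y assume "y \<in> ?N'"
  then obtain b k where y: "b \<in> N" "y = b \<otimes> z [^] (k :: int)"
    by auto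
  have "x \<otimes> y = (a \<otimes> b) \<otimes> z [^] (m + k)"
    using x y z Nc by (simp add: int_pow_mult m_ac)
  then show "x \<otimes> y \<in> ?N'"
    using x y subgroup.m_closed[OF N] by blast
qed

text \<open>A subgroup maximal among those meeting \<open>T\<close> trivially is a complement: if it misses \<open>z\<close>,
  divisibility lets one correct \<open>z\<close> by an element of \<open>T\<close> so that the powers of \<open>z\<close> that lie in the
  product lie in the subgroup, and then \<open>z\<close> can be adjoined.\<close>

lemma (in comm_group) divisible_subgroup_complement:
  assumes T: "subgroup T G"
    and divisible: "\<And>t n. t \<in> T \<Longrightarrow> n > 0 \<Longrightarrow> \<exists>s\<in>T. s [^] (n :: nat) = t"
    and N0: "subgroup N0 G" "N0 \<inter> T = {\<one>}"
  obtains N where "subgroup N G" "N0 \<subseteq> N" "N \<inter> T = {\<one>}"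
    "\<And>x. x \<in> carrier G \<Longrightarrow> \<exists>a\<in>N. \<exists>t\<in>T. x = a \<otimes> t"
proof -
  let ?S = "{N. subgroup N G \<and> N0 \<subseteq> N \<and> N \<inter> T = {\<one>}}"
  have "\<exists>N\<in>?S. \<forall>X\<in>?S. N \<subseteq> X \<longrightarrow> X = N"
  proof (rule subset_Zorn_nonempty)
    show "?S \<noteq> {}"
      using N0 by auto
    fix \<C> assume ne: "\<C> \<noteq> {}" and ch: "subset.chain ?S \<C>"
    have mem: "subgroup N G" "N0 \<subseteq> N" "N \<inter> T = {\<one>}" if "N \<in> \<C>" for N
      using ch that by (auto simp: subset.chain_def)
    have "subgroup (\<Union>\<C>) G"
    proof (rule subgroupI)
      show "\<Union>\<C> \<subseteq> carrier G"
        using mem(1) subgroup.subset by blast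
      show "\<Union>\<C> \<noteq> {}"
        using ne mem(1) subgroup.one_closed by blast
      show "inv a \<in> \<Union>\<C>" if "a \<in> \<Union>\<C>" for a
        using that subgroup.m_inv_closed[OF mem(1)] by (meson UnionE UnionI)
      show "a \<otimes> b \<in> \<Union>\<C>" if ab: "a \<in> \<Union>\<C>" "b \<in> \<Union>\<C>" for a b
      proof -
        obtain M N where MN: "M \<in> \<C>" "N \<in> \<C>" "a \<in> M" "b \<in> N"
          using ab by auto
        then have "M \<subseteq> N \<or> N \<subseteq> M"
          using ch by (auto simp: subset.chain_def)
        then show ?thesis
        proof
          assume "M \<subseteq> N"
          then have "a \<otimes> b \<in> N"
            using MN subgroup.m_closed[OF mem(1)[OF MN(2)]] by blast
          then show ?thesis
            using MN by blast
        next
          assume "N \<subseteq> M"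
          then have "a \<otimes> b \<in> M"
            using MN subgroup.m_closed[OF mem(1)[OF MN(1)]] by blast
          then show ?thesis
            using MN by blast
        qed
      qed
    qed
    moreover have "N0 \<subseteq> \<Union>\<C>"
      using ne mem(2) by blast
    moreover have "\<Union>\<C> \<inter> T = {\<one>}"
      using ne mem(3) by blast
    ultimately show "\<Union>\<C> \<in> ?S"
      by blast
  qed
  then obtain N where N: "N \<in> ?S" and max: "\<forall>X\<in>?S. N \<subseteq> X \<longrightarrow> X = N"
    by (rule bexE)
  then have max: "X = N" if "subgroup X G" "N0 \<subseteq> X" "X \<inter> T = {\<one>}" "N \<subseteq> X" for X
    using that by simp
  from N have N: "subgroup N G" "N0 \<subseteq> N" "N \<inter> T = {\<one>}"
    by simp_all
  note Nc = subgroup.mem_carrier[OF N(1)] and Tc = subgroup.mem_carrier[OF T]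
  define NT where "NT = {a \<otimes> t | a t. a \<in> N \<and> t \<in> T}"
  have NT: "subgroup NT G"
  proof (rule subgroupI)
    show "NT \<subseteq> carrier G"
      using Nc Tc by (auto simp: NT_def)
    show "NT \<noteq> {}"
      using subgroup.one_closed[OF N(1)] subgroup.one_closed[OF T] by (auto simp: NT_def)
    fix x assume "x \<in> NT"
    then obtain a t where x: "x = a \<otimes> t" "a \<in> N" "t \<in> T"
      by (auto simp: NT_def)
    then have "inv x = inv a \<otimes> inv t"
      using Nc Tc by (simp add: inv_mult)
    then show "inv x \<in> NT"
      using x subgroup.m_inv_closed[OF N(1)] subgroup.m_inv_closed[OF T] by (auto simp: NT_def)
    fix y assume "y \<in> NT"
    then obtain b s where y: "y = b \<otimes> s" "b \<in> N" "s \<in> T"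
      by (auto simp: NT_def)
    have "x \<otimes> y = (a \<otimes> b) \<otimes> (t \<otimes> s)"
      using x y Nc Tc by (simp add: m_ac)
    moreover have "a \<otimes> b \<in> N" "t \<otimes> s \<in> T"
      using x y subgroup.m_closed[OF N(1)] subgroup.m_closed[OF T] by auto
    ultimately show "x \<otimes> y \<in> NT"
      unfolding NT_def by blast
  qed
  have N_NT: "a \<in> NT" if "a \<in> N" for a
    using that Nc[OF that] subgroup.one_closed[OF T] unfolding NT_def by force
  have T_NT: "t \<in> NT" if "t \<in> T" for t
    using that Tc[OF that] subgroup.one_closed[OF N(1)] unfolding NT_def by force
  note NTc = subgroup.mem_carrier[OF NT]
  have NT_pow: "x [^] (m :: int) \<in> NT" if "x \<in> NT" for x m
    using subgroup_int_pow_closed[OF NT that] .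
  \<comment> \<open>By maximality, no element outside the product can be adjoined to \<open>N\<close>.\<close>
  have adjoin: False if z: "z \<in> carrier G" "z \<notin> NT" "\<And>m :: int. z [^] m \<in> NT \<Longrightarrow> z [^] m \<in> N" for z
  proof -
    let ?N' = "{a \<otimes> z [^] (m :: int) | a m. a \<in> N}"
    have sub: "N \<subseteq> ?N'"
      using Nc z by (force intro: exI[of _ "0 :: int"])
    have "?N' \<inter> T \<subseteq> {\<one>}"
    proof
      fix t assume "t \<in> ?N' \<inter> T"
      then obtain a m where t: "t \<in> T" "a \<in> N" "t = a \<otimes> z [^] (m :: int)"
        by auto
      then have "z [^] m = inv a \<otimes> t"
        using z Nc by (simp add: m_assoc[symmetric])
      also have "\<dots> \<in> NT"
        using t subgroup.m_inv_closed[OF N(1)] by (auto simp: NT_def)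
      finally have "t \<in> N"
        using t z subgroup.m_closed[OF N(1)] by blast
      then show "t \<in> {\<one>}"
        using N t by blast
    qed
    then have "?N' \<inter> T = {\<one>}"
      using sub N by blast
    then have "?N' = N"
      using N sub by (intro max subgroup_adjoin_powers z) auto
    moreover have "\<one> \<otimes> z [^] (1 :: int) \<in> ?N'"
      using subgroup.one_closed[OF N(1)] by blast
    ultimately show False
      using z N_NT by simp
  qed
  have "z \<in> NT" if z: "z \<in> carrier G" for z
  proof (rule ccontr)
    assume nz: "z \<notin> NT"
    show False
    proof (cases "\<exists>n>0. z [^] (n :: nat) \<in> NT")
      case False
      have "m = 0" if m: "z [^] (m :: int) \<in> NT" for m
      proof (rule ccontr)
        assume "m \<noteq> 0"
        have "z [^] (- m) \<in> NT"
          using m subgroup.m_inv_closed[OF NT] z by (simp add: int_pow_neg)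
        then have "z [^] (int (nat \<bar>m\<bar>)) \<in> NT"
          using m by (auto simp: abs_if)
        then show False
          using False \<open>m \<noteq> 0\<close> by (metis int_pow_int zero_less_abs_iff zero_less_nat_eq)
      qed
      then have "z [^] m \<in> N" if "z [^] m \<in> NT" for m :: int
        using that subgroup.one_closed[OF N(1)] by force
      then show False
        using adjoin z nz by blast
    next
      case True
      define n where "n = (LEAST n. n > 0 \<and> z [^] (n :: nat) \<in> NT)"
      have n: "n > 0" "z [^] n \<in> NT"
        using LeastI_ex[OF True] by (auto simp: n_def)
      have least: "\<not> (k > 0 \<and> z [^] k \<in> NT)" if "k < n" for k :: nat
        using not_less_Least that by (auto simp: n_def)
      obtain a t where at: "z [^] n = a \<otimes> t" "a \<in> N" "t \<in> T"
        using n(2) by (auto simp: NT_def)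
      obtain s where s: "s \<in> T" "s [^] n = t"
        using divisible[OF at(3) n(1)] by blast
      define w where "w = z \<otimes> inv s"
      have w: "w \<in> carrier G" and sc: "s \<in> carrier G" and ac: "a \<in> carrier G" and tc: "t \<in> carrier G"
        using z s at Tc Nc by (auto simp: w_def)
      have zw: "z = w \<otimes> s"
        using z sc by (simp add: w_def m_assoc)
      have wn: "w [^] n = a"
      proof -
        have "w [^] n = z [^] n \<otimes> inv (s [^] n)"
          using z sc by (simp add: w_def pow_mult_distrib nat_pow_inv m_comm)
        then show ?thesis
          using at(1) s(2) ac tc by (simp add: m_assoc)
      qed
      have "w [^] m \<in> N" if m: "w [^] (m :: int) \<in> NT" for m
      proof -
        have "z [^] m = w [^] m \<otimes> s [^] m"
          using w sc by (simp add: zw int_pow_mult_distrib m_comm)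
        then have zm: "z [^] m \<in> NT"
          using m NT_pow[OF T_NT[OF s(1)]] subgroup.m_closed[OF NT] by metis
        have m_eq: "m = int n * (m div int n) + m mod int n"
          by simp
        have "z [^] m = z [^] (int n * (m div int n)) \<otimes> z [^] (m mod int n)"
          using z by (subst m_eq) (simp only: int_pow_mult)
        moreover have zk: "z [^] (int n * (m div int n)) \<in> NT"
          using NT_pow[OF n(2)] z by (simp add: int_pow_pow[symmetric] int_pow_int)
        ultimately have "z [^] (m mod int n) = inv (z [^] (int n * (m div int n))) \<otimes> z [^] m"
          using z by (simp add: m_assoc[symmetric])
        then have "z [^] (m mod int n) \<in> NT"
          using zm zk subgroup.m_closed[OF NT] subgroup.m_inv_closed[OF NT] by metis
        then have "z [^] nat (m mod int n) \<in> NT"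
          using n(1) by (metis int_pow_int nat_0_le of_nat_0_less_iff pos_mod_sign)
        moreover have "nat (m mod int n) < n"
          using n(1) by (simp add: nat_less_iff)
        ultimately have "nat (m mod int n) = 0"
          using least[of "nat (m mod int n)"] not_gr_zero[of "nat (m mod int n)"] by metis
        then have "m mod int n = 0"
          using n(1) by (metis nat_0_iff of_nat_0_less_iff order_antisym pos_mod_sign)
        then have "m = int n * (m div int n)"
          by auto
        then have "w [^] m = a [^] (m div int n)"
          using w wn by (metis int_pow_int int_pow_pow)
        then show ?thesis
          using subgroup_int_pow_closed[OF N(1) at(2)] by simp
      qed
      moreover have "w \<notin> NT"
        using nz zw T_NT[OF s(1)] subgroup.m_closed[OF NT] by metis
      ultimately show False
        using adjoin w by blast
    qed
  qed
  then have "\<exists>a\<in>N. \<exists>t\<in>T. x = a \<otimes> t" if "x \<in> carrier G" for x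
    using that unfolding NT_def by blast
  then show ?thesis
    using that N by blast
qed

section \<open>Folner sets in abelian subgroups\<close>

text \<open>Otherwise the growth would be exponential.\<close>

lemma polynomial_growth_ratio:
  fixes f :: "nat \<Rightarrow> nat"
  assumes "\<And>n. f n \<le> (n + 1) ^ d" "f 0 > 0" "e > (0 :: real)"
  shows "\<exists>n. real (f (Suc n)) \<le> (1 + e) * real (f n)"
proof (rule ccontr)
  assume "\<not> ?thesis"
  then have step: "real (f (Suc n)) > (1 + e) * real (f n)" for n
    by (simp add: not_le)
  have "real (f n) \<ge> (1 + e) ^ n" for n
  proof (induction n)
    case (Suc n)
    have "(1 + e) ^ Suc n \<le> (1 + e) * real (f n)"
      using Suc assms(3) by simp
    then show ?case
      using step[of n] by simp
  qed (use assms(2) in simp)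
  then have "(1 + e) ^ n \<le> real ((n + 1) ^ d)" for n
    using assms(1)[of n] by (meson of_nat_mono order_trans)
  then have le: "(1 + e) ^ n \<le> (real n + 1) ^ d" for n
    by (metis of_nat_Suc of_nat_power Suc_eq_plus1 add.commute)
  have "(\<lambda>n :: nat. (real n + 1) ^ d / (1 + e) ^ n) \<longlonglongrightarrow> 0"
    using assms(3) by real_asymp
  then have "\<forall>\<^sub>F n in sequentially. (real n + 1) ^ d / (1 + e) ^ n < 1"
    by (rule order_tendstoD) simp
  then obtain n where "(real n + 1) ^ d / (1 + e) ^ n < 1"
    by (auto simp: eventually_sequentially)
  then show False
    using le[of n] assms(3) by (simp add: field_simps)
qed

context twisted_group_with_abelian_subgroup
begin

text \<open>Adding a generator \<open>g\<close> to \<open>K\<close> multiplies the \<open>n\<close>-th set by the powers of \<open>g\<close> up to \<open>n\<close>, and so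
  raises the degree of the bound by one.\<close>

lemma abelian_polynomial_growth:
  assumes "finite K" "K \<subseteq> Y"
  shows "\<exists>B d. \<forall>n. finite (B n) \<and> B n \<subseteq> Y \<and> \<one> \<in> B n \<and> card (B n) \<le> (n + 1) ^ d \<and>
    (\<forall>g\<in>insert \<one> K. \<forall>x\<in>B n. g \<otimes> x \<in> B (Suc n))"
  using assms
proof (induction rule: finite_induct)
  case empty
  show ?case
    using subgroup.one_closed[OF Y_subgroup] by (intro exI[of _ "\<lambda>n. {\<one>}"] exI[of _ 0]) auto
next
  case (insert g K)
  then obtain B d where B: "\<And>n. finite (B n)" "\<And>n. B n \<subseteq> Y" "\<And>n. \<one> \<in> B n" "\<And>n. card (B n) \<le> (n + 1) ^ d"
    "\<And>n h x. h \<in> insert \<one> K \<Longrightarrow> x \<in> B n \<Longrightarrow> h \<otimes> x \<in> B (Suc n)"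
    by (metis insert_subset)
  have g: "g \<in> Y" and K: "K \<subseteq> Y"
    using insert by auto
  have gn: "g [^] (j :: nat) \<in> Y" for j
    using g subgroup.one_closed[OF Y_subgroup] subgroup.m_closed[OF Y_subgroup]
    by (induction j) auto
  have Bc: "x \<in> carrier G" if "x \<in> B n" for x n
    using that B(2) by (blast intro: Y_closed)
  have B_Suc: "x \<in> B (Suc n)" if "x \<in> B n" for x n
    using B(5)[of \<one> x n] that Bc by simp
  define B' where "B' n = (\<lambda>(j, x). g [^] (j :: nat) \<otimes> x) ` ({..n} \<times> B n)" for n
  have "card (B' n) \<le> (n + 1) ^ Suc d" for n
  proof -
    have "card (B' n) \<le> card ({..n} \<times> B n)"
      unfolding B'_def by (intro card_image_le finite_cartesian_product B) auto
    also have "\<dots> \<le> (n + 1) * (n + 1) ^ d"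
      using B(4)[of n] unfolding card_cartesian_product card_atMost Suc_eq_plus1
      by (rule mult_left_mono) simp
    finally show ?thesis
      by simp
  qed
  moreover have "B' n \<subseteq> Y" for n
    using gn B(2) subgroup.m_closed[OF Y_subgroup] by (fastforce simp: B'_def)
  moreover have "\<one> \<in> B' n" for n
    unfolding B'_def using B(3) by (intro image_eqI[of _ _ "(0, \<one>)"]) auto
  moreover have "h \<otimes> x \<in> B' (Suc n)" if h: "h \<in> insert \<one> (insert g K)" and x: "x \<in> B' n" for h x n
  proof -
    obtain j y where jy: "j \<le> n" "y \<in> B n" "x = g [^] j \<otimes> y"
      using x by (auto simp: B'_def)
    show ?thesis
    proof (cases "h = g")
      case True
      have "h \<otimes> x = g [^] (Suc j) \<otimes> y"
        using jy g gn[of j] Bc by (simp add: True m_assoc[symmetric] Y_comm)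
      then show ?thesis
        unfolding B'_def using jy B_Suc by (intro image_eqI[of _ _ "(Suc j, y)"]) auto
    next
      case False
      then have hK: "h \<in> insert \<one> K"
        using h by auto
      then have hY: "h \<in> Y"
        using K subgroup.one_closed[OF Y_subgroup] by auto
      have "h \<otimes> x = (h \<otimes> g [^] j) \<otimes> y"
        using jy hY g Bc by (simp add: m_assoc)
      also have "\<dots> = g [^] j \<otimes> (h \<otimes> y)"
        using jy hY g Bc gn[of j] by (simp add: Y_comm[of h "g [^] j"] m_assoc)
      finally show ?thesis
        unfolding B'_def using jy B(5)[OF hK jy(2)] by (intro image_eqI[of _ _ "(j, h \<otimes> y)"]) auto
    qed
  qed
  moreover have "finite (B' n)" for n
    unfolding B'_def using B(1) by simp
  ultimately show ?case
    by (intro exI[of _ B'] exI[of _ "Suc d"]) blast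
qed

text \<open>In a sequence of polynomial growth, take for \<open>F\<close> the successor of a term at which the growth ratio
  is at most \<open>1 + e\<close>: the inverses of \<open>K\<close> do not move the elements of that term out of \<open>F\<close>.\<close>

lemma abelian_Folner:
  assumes K: "finite K" "K \<subseteq> Y" and e: "e > (0 :: real)"
  obtains F where "finite F" "F \<noteq> {}" "F \<subseteq> Y"
    "\<And>g. g \<in> K \<Longrightarrow> (1 - e) * real (card F) \<le> real (card {x \<in> F. inv g \<otimes> x \<in> F})"
proof -
  have invK: "finite (m_inv G ` K)" "m_inv G ` K \<subseteq> Y"
    using K subgroup.m_inv_closed[OF Y_subgroup] by auto
  obtain B d where B: "\<And>n. finite (B n)" "\<And>n. B n \<subseteq> Y" "\<And>n. \<one> \<in> B n" "\<And>n. card (B n) \<le> (n + 1) ^ d"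
    "\<And>n h x. h \<in> insert \<one> (m_inv G ` K) \<Longrightarrow> x \<in> B n \<Longrightarrow> h \<otimes> x \<in> B (Suc n)"
    using abelian_polynomial_growth[OF invK] by metis
  have pos: "card (B n) > 0" for n
    using B(1,3) by (metis card_gt_0_iff empty_iff)
  obtain n where n: "real (card (B (Suc n))) \<le> (1 + e) * real (card (B n))"
    using polynomial_growth_ratio[OF B(4) pos e] by blast
  show ?thesis
  proof (rule that)
    show "finite (B (Suc n))" "B (Suc n) \<noteq> {}" "B (Suc n) \<subseteq> Y"
      using B(1)[of "Suc n"] B(2)[of "Suc n"] B(3)[of "Suc n"] by blast+
    fix g assume g: "g \<in> K"
    have "B n \<subseteq> {x \<in> B (Suc n). inv g \<otimes> x \<in> B (Suc n)}"
      using B(5)[of "inv g" _ n] B(5)[of \<one> _ n] B(2) g by fastforce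
    then have le: "card (B n) \<le> card {x \<in> B (Suc n). inv g \<otimes> x \<in> B (Suc n)}"
      using B(1) by (intro card_mono) auto
    have "(1 - e) * real (card (B (Suc n))) \<le> real (card (B n))"
    proof (cases "e \<le> 1")
      case True
      then have "(1 - e) * real (card (B (Suc n))) \<le> (1 - e) * ((1 + e) * real (card (B n)))"
        using n by (intro mult_left_mono) auto
      also have "\<dots> = real (card (B n)) - e\<^sup>2 * real (card (B n))"
        by (simp add: algebra_simps power2_eq_square)
      finally show ?thesis
        by (smt (verit) mult_nonneg_nonneg of_nat_0_le_iff zero_le_power2)
    next
      case False
      then show ?thesis
        by (smt (verit) mult_nonneg_nonneg of_nat_0_le_iff minus_mult_left)
    qed
    then show "(1 - e) * real (card (B (Suc n))) \<le> real (card {x \<in> B (Suc n). inv g \<otimes> x \<in> B (Suc n)})"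
      using le by linarith
  qed
qed

end

section \<open>States as limits of vector states\<close>

lemma ell2_exists_finite_support:
  assumes "finite F" "\<And>x. x \<notin> F \<Longrightarrow> f x = 0"
  obtains \<xi> where "ell2_apply \<xi> = f"
proof
  have "(\<lambda>x. (cmod (f x))\<^sup>2) summable_on F"
    using assms by simp
  then have "(\<lambda>x. (cmod (f x))\<^sup>2) summable_on UNIV"
    using assms(2) by (rule_tac summable_on_cong_neutral[THEN iffD1, rotated -1]) auto
  then show "ell2_apply (Abs_ell2 f) = f"
    by (simp add: Abs_ell2_inverse)
qed

context twisted_group
begin

text \<open>Vector states are bounded by the norm, so the set of elements at which they converge is a closed
  subspace; convergence on generators suffices. The limit is taken along finite sets of generators
  together with a precision \<open>1/(n + 1)\<close>.\<close>

lemma state_of_approximate_vectors: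
  assumes approx: "\<And>M e. finite M \<Longrightarrow> M \<subseteq> carrier G \<Longrightarrow> e > 0 \<Longrightarrow>
    \<exists>\<xi>. norm \<xi> = 1 \<and> (\<forall>g\<in>M. cmod (vec_functional \<xi> (L g) - t g) < e)"
  obtains \<phi> where "positive_on A \<phi>" "\<And>g. g \<in> carrier G \<Longrightarrow> \<phi> (L g) = t g"
proof -
  have "\<forall>i. \<exists>\<xi>. norm \<xi> = 1 \<and> (finite (fst i) \<and> fst i \<subseteq> carrier G \<longrightarrow>
      (\<forall>g\<in>fst i. cmod (vec_functional \<xi> (L g) - t g) < inverse (real (Suc (snd i)))))"
  proof
    fix i :: "'a set \<times> nat"
    let ?e = "inverse (real (Suc (snd i)))"
    let ?M = "if finite (fst i) \<and> fst i \<subseteq> carrier G then fst i else {}"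
    have "\<exists>\<xi>. norm \<xi> = 1 \<and> (\<forall>g\<in>?M. cmod (vec_functional \<xi> (L g) - t g) < ?e)"
      by (rule approx) auto
    then show "\<exists>\<xi>. norm \<xi> = 1 \<and> (finite (fst i) \<and> fst i \<subseteq> carrier G \<longrightarrow>
        (\<forall>g\<in>fst i. cmod (vec_functional \<xi> (L g) - t g) < ?e))"
      by metis
  qed
  then obtain \<xi> :: "'a set \<times> nat \<Rightarrow> 'a ell2" where \<xi>: "\<And>i. norm (\<xi> i) = 1"
    "\<And>M n g. finite M \<Longrightarrow> M \<subseteq> carrier G \<Longrightarrow> g \<in> M \<Longrightarrow>
      cmod (vec_functional (\<xi> (M, n)) (L g) - t g) < inverse (real (Suc n))"
    by (metis fst_conv snd_conv)
  define \<omega> where "\<omega> i a = vec_functional (\<xi> i) a" for i a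
  define \<F> where "\<F> = finite_subsets_at_top (carrier G) \<times>\<^sub>F (sequentially :: nat filter)"
  have ne: "\<F> \<noteq> bot"
    by (simp add: \<F>_def prod_filter_eq_bot)
  have bound: "cmod (\<omega> i a) \<le> norm a" for i a
    using vec_functional_bound[of "\<xi> i" a] by (simp add: \<omega>_def \<xi>(1))
  have gen: "((\<lambda>i. \<omega> i (L g)) \<longlongrightarrow> t g) \<F>" if g: "g \<in> carrier G" for g
  proof (rule tendstoI)
    fix e :: real assume "0 < e"
    then obtain N where N: "inverse (real (Suc N)) < e"
      using reals_Archimedean by blast
    have "\<forall>\<^sub>F M in finite_subsets_at_top (carrier G). finite M \<and> {g} \<subseteq> M \<and> M \<subseteq> carrier G"
      using g unfolding eventually_finite_subsets_at_top by (intro exI[of _ "{g}"]) auto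
    moreover have "\<forall>\<^sub>F n in sequentially. n \<ge> N"
      by (rule eventually_ge_at_top)
    ultimately have "\<forall>\<^sub>F i in \<F>. (finite (fst i) \<and> {g} \<subseteq> fst i \<and> fst i \<subseteq> carrier G) \<and> snd i \<ge> N"
      unfolding \<F>_def by (intro eventually_prodI)
    then show "\<forall>\<^sub>F i in \<F>. dist (\<omega> i (L g)) (t g) < e"
    proof (rule eventually_mono)
      fix i assume i: "(finite (fst i) \<and> {g} \<subseteq> fst i \<and> fst i \<subseteq> carrier G) \<and> snd i \<ge> N"
      then have "cmod (vec_functional (\<xi> (fst i, snd i)) (L g) - t g) < inverse (real (Suc (snd i)))"
        by (intro \<xi>(2)) auto
      also have "\<dots> \<le> inverse (real (Suc N))"
        using i by (intro le_imp_inverse_le) auto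
      finally show "dist (\<omega> i (L g)) (t g) < e"
        using N by (simp add: \<omega>_def dist_norm)
    qed
  qed
  define C where "C = {a. \<exists>l. ((\<lambda>i. \<omega> i a) \<longlongrightarrow> l) \<F>}"
  have lim_add: "((\<lambda>i. \<omega> i (a + b)) \<longlongrightarrow> l + m) \<F>"
    if "((\<lambda>i. \<omega> i a) \<longlongrightarrow> l) \<F>" "((\<lambda>i. \<omega> i b) \<longlongrightarrow> m) \<F>" for a b l m
    unfolding \<omega>_def vec_functional_add using that by (intro tendsto_add) (simp_all add: \<omega>_def)
  have lim_scale: "((\<lambda>i. \<omega> i (op_scaleC c a)) \<longlongrightarrow> c * l) \<F>"
    if "((\<lambda>i. \<omega> i a) \<longlongrightarrow> l) \<F>" for a l c
    unfolding \<omega>_def vec_functional_scaleC using that by (intro tendsto_mult_left) (simp add: \<omega>_def)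
  have "A \<subseteq> C"
  proof (rule A_subset_closed_subspace)
    have "(\<lambda>i. \<omega> i 0) = (\<lambda>i. 0)"
      using bound[of _ 0] by (auto simp: fun_eq_iff)
    then have "0 \<in> C"
      unfolding C_def by auto
    then show "complex_subspace C"
      using lim_add lim_scale unfolding complex_subspace_def C_def by blast
    show "L g \<in> C" if "g \<in> carrier G" for g
      using gen[OF that] by (auto simp: C_def)
    show "closed C"
      unfolding closed_sequential_limits
    proof (intro allI impI, elim conjE)
      fix s a assume s: "\<forall>n. s n \<in> C" and sa: "s \<longlonglongrightarrow> a"
      then have "\<forall>n. \<exists>l. ((\<lambda>i. \<omega> i (s n)) \<longlongrightarrow> l) \<F>"
        by (simp add: C_def)
      then obtain l where l: "\<And>n. ((\<lambda>i. \<omega> i (s n)) \<longlongrightarrow> l n) \<F>"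
        by metis
      have \<omega>_diff: "cmod (\<omega> i b - \<omega> i c) \<le> norm (b - c)" for i b c
        using bound[of i "b - c"] by (simp add: \<omega>_def vec_functional_diff)
      have "dist (l m) (l n) \<le> dist (s m) (s n)" for m n
        unfolding dist_norm using \<omega>_diff
        by (intro Lim_norm_ubound[OF ne tendsto_diff[OF l l]] always_eventually) auto
      then have "Cauchy l"
        using LIMSEQ_imp_Cauchy[OF sa] unfolding Cauchy_def by (meson order_le_less_trans)
      then obtain z where z: "l \<longlonglongrightarrow> z"
        by (auto simp: Cauchy_convergent_iff convergent_def)
      have "((\<lambda>i. \<omega> i a) \<longlongrightarrow> z) \<F>"
      proof (rule tendstoI)
        fix e :: real assume "0 < e"
        then have e3: "e/3 > 0"
          by simp
        have "\<forall>\<^sub>F n in sequentially. dist (s n) a < e/3 \<and> dist (l n) z < e/3"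
          using tendstoD[OF sa e3] tendstoD[OF z e3] by (rule eventually_conj)
        then obtain n where n: "dist (s n) a < e/3" "dist (l n) z < e/3"
          using eventually_sequentially by auto
        from tendstoD[OF l[of n] e3] show "\<forall>\<^sub>F i in \<F>. dist (\<omega> i a) z < e"
        proof (rule eventually_mono)
          fix i assume "dist (\<omega> i (s n)) (l n) < e/3"
          moreover have "dist (\<omega> i a) (\<omega> i (s n)) < e/3"
            using \<omega>_diff[of i "s n" a] n(1) by (simp add: dist_norm norm_minus_commute)
          ultimately show "dist (\<omega> i a) z < e"
            using n(2) dist_triangle[of "\<omega> i a" z "\<omega> i (s n)"] dist_triangle[of "\<omega> i (s n)" z "l n"]
            by linarith
        qed
      qed
      then show "a \<in> C"
        by (auto simp: C_def)
    qed
  qed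
  then have "\<forall>a\<in>A. \<exists>l. ((\<lambda>i. \<omega> i a) \<longlongrightarrow> l) \<F>"
    by (auto simp: C_def)
  then obtain \<phi> where \<phi>: "\<And>a. a \<in> A \<Longrightarrow> ((\<lambda>i. \<omega> i a) \<longlongrightarrow> \<phi> a) \<F>"
    by metis
  show ?thesis
  proof (rule that)
    show "\<phi> (L g) = t g" if "g \<in> carrier G" for g
      using tendsto_unique[OF ne \<phi> gen] that by simp
    have "\<phi> (a + b) = \<phi> a + \<phi> b" if "a \<in> A" "b \<in> A" for a b
      using tendsto_unique[OF ne \<phi>[OF A_add[OF that]] lim_add[OF \<phi> \<phi>]] that by simp
    moreover have "\<phi> (op_scaleC c a) = c * \<phi> a" if "a \<in> A" for c a
      using tendsto_unique[OF ne \<phi>[OF A_scaleC[OF that]] lim_scale[OF \<phi>]] that by simp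
    moreover have "\<phi> (b o\<^sub>L a) \<in> \<real>\<^sub>\<ge>\<^sub>0" if a: "a \<in> A" and ab: "is_adjoint a b" for a b
    proof (rule Lim_in_closed_set[OF closed_nonneg_Reals_complex _ ne \<phi>])
      show "b o\<^sub>L a \<in> A"
        using A_mult A_adj a ab by blast
      show "\<forall>\<^sub>F i in \<F>. \<omega> i (b o\<^sub>L a) \<in> \<real>\<^sub>\<ge>\<^sub>0"
        using vec_functional_adj_mult[OF ab] by (simp add: \<omega>_def)
    qed
    ultimately show "positive_on A \<phi>"
      unfolding positive_on_def by blast
  qed
qed

end

section \<open>Traces from trivialized cocycles\<close>

text \<open>On the subgroup \<open>Y\<close> the cocycle is the coboundary of \<open>b\<close>, so that \<open>y\<close> is mapped to \<open>b y\<close> by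
  a one-dimensional twisted representation of \<open>Y\<close>.\<close>

locale trivialized_cocycle = twisted_group_with_abelian_subgroup +
  fixes b :: "'a \<Rightarrow> complex"
  assumes cmod_b: "y \<in> Y \<Longrightarrow> cmod (b y) = 1"
    and b_mult: "x \<in> Y \<Longrightarrow> y \<in> Y \<Longrightarrow> b x * b y = \<sigma> x y * b (x \<otimes> y)"
begin

definition b_ext :: "'a \<Rightarrow> complex"
  where "b_ext g = (if g \<in> Y then b g else 0)"

lemma b_one: "b \<one> = 1"
proof -
  have Y1: "\<one> \<in> Y"
    by (rule subgroup.one_closed[OF Y_subgroup])
  have "b \<one> * b \<one> = b \<one>"
    using b_mult[OF Y1 Y1] by simp
  then show ?thesis
    using cmod_b[OF Y1] by (metis mult_cancel_left1 norm_zero zero_neq_one)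
qed

lemma cnj_b: "y \<in> Y \<Longrightarrow> cnj (b y) * b y = 1"
  using complex_norm_square[of "b y"] cmod_b by (simp add: mult.commute)

text \<open>The normalized vector with entries \<open>cnj (b x)\<close> on a Folner set is almost an eigenvector of each
  \<open>L g\<close> with \<open>g \<in> Y\<close>, with eigenvalue \<open>b g\<close>; for \<open>g\<close> outside \<open>Y\<close> it is orthogonal to its translate.\<close>

lemma Folner_vector:
  assumes F: "finite F" "F \<noteq> {}" "F \<subseteq> Y"
  obtains \<xi> where "norm \<xi> = 1"
    "\<And>g. g \<in> carrier G \<Longrightarrow>
      vec_functional \<xi> (L g) = b_ext g * complex_of_real (real (card {x \<in> F. inv g \<otimes> x \<in> F}) / real (card F))"
proof -
  define n where "n = real (card F)"
  have n: "n > 0"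
    using F by (simp add: n_def card_gt_0_iff)
  have sq: "complex_of_real (sqrt n) * complex_of_real (sqrt n) = complex_of_real n"
    using n by (metis of_real_mult order_less_imp_le real_sqrt_mult_self abs_of_nonneg)
  obtain \<xi> where \<xi>: "ell2_apply \<xi> = (\<lambda>x. if x \<in> F then cnj (b x) / complex_of_real (sqrt n) else 0)"
    using ell2_exists_finite_support[OF F(1), of "\<lambda>x. if x \<in> F then cnj (b x) / complex_of_real (sqrt n) else 0"]
    by auto
  have inner: "ell2_cinner \<xi> \<eta> = (\<Sum>x\<in>F. b x / complex_of_real (sqrt n) * ell2_apply \<eta> x)" for \<eta>
    using F(1) by (subst ell2_cinner_finite_support[OF F(1)]) (auto simp: \<xi>)
  show ?thesis
  proof (rule that)
    have "ell2_cinner \<xi> \<xi> = (\<Sum>x\<in>F. 1 / complex_of_real n)"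
      unfolding inner
    proof (rule sum.cong)
      fix x assume x: "x \<in> F"
      have "b x * cnj (b x) = 1"
        using cnj_b[of x] x F by (auto simp: mult.commute)
      then show "b x / complex_of_real (sqrt n) * ell2_apply \<xi> x = 1 / complex_of_real n"
        using x by (simp add: \<xi> sq)
    qed simp
    also have "\<dots> = 1"
      using n by (simp add: n_def)
    finally have "(norm \<xi>)\<^sup>2 = 1"
      unfolding ell2_cinner_self_norm by (metis of_real_eq_1_iff)
    then show "norm \<xi> = 1"
      using norm_ge_zero[of \<xi>] by (auto simp: power2_eq_1_iff)
    fix g assume g: "g \<in> carrier G"
    let ?F' = "{x \<in> F. inv g \<otimes> x \<in> F}"
    have "vec_functional \<xi> (L g) = (\<Sum>x\<in>F. if inv g \<otimes> x \<in> F then b_ext g / complex_of_real n else 0)"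
      unfolding vec_functional_def inner
    proof (rule sum.cong)
      fix x assume x: "x \<in> F"
      then have xY: "x \<in> Y" and xc: "x \<in> carrier G"
        using F by auto
      show "b x / complex_of_real (sqrt n) * ell2_apply (blinfun_apply (L g) \<xi>) x =
          (if inv g \<otimes> x \<in> F then b_ext g / complex_of_real n else 0)"
      proof (cases "inv g \<otimes> x \<in> F")
        case True
        define y where "y = inv g \<otimes> x"
        have y: "y \<in> Y" and yc: "y \<in> carrier G"
          using True F by (auto simp: y_def)
        have "g = x \<otimes> inv y"
          using g xc by (simp add: y_def inv_mult_group m_assoc[symmetric])
        then have gY: "g \<in> Y"
          using xY y subgroup.m_closed[OF Y_subgroup] subgroup.m_inv_closed[OF Y_subgroup] by simp
        have gy: "g \<otimes> y = x"
          using g xc by (simp add: y_def m_assoc[symmetric])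
        have "b x * (\<sigma> g y * cnj (b y)) = b g * (cnj (b y) * b y)"
          using b_mult[OF gY y] by (simp add: gy mult_ac)
        then have "b x * (\<sigma> g y * cnj (b y)) = b g"
          using cnj_b[OF y] by simp
        then show ?thesis
          using True g xc gY by (simp add: L_apply \<xi> b_ext_def sq flip: y_def)
      qed (use g xc in \<open>simp add: L_apply \<xi>\<close>)
    qed simp
    also have "\<dots> = (\<Sum>x\<in>?F'. b_ext g / complex_of_real n)"
      by (rule sum.inter_filter[OF F(1), symmetric])
    also have "\<dots> = b_ext g * complex_of_real (real (card ?F') / real (card F))"
      by (simp add: n_def)
    finally show "vec_functional \<xi> (L g) = b_ext g * complex_of_real (real (card ?F') / real (card F))" .
  qed
qed

text \<open>Amenability of the abelian group \<open>Y\<close>: the twisted character \<open>b\<close>, extended by zero, is weakly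
  contained in the regular representation.\<close>

lemma b_state:
  obtains \<phi> where "positive_on A \<phi>" "\<And>g. g \<in> carrier G \<Longrightarrow> \<phi> (L g) = b_ext g"
proof -
  have approx: "\<exists>\<xi>. norm \<xi> = 1 \<and> (\<forall>g\<in>M. cmod (vec_functional \<xi> (L g) - b_ext g) < e)"
    if M: "finite M" "M \<subseteq> carrier G" and e: "e > 0" for M and e :: real
  proof -
  obtain F where F: "finite F" "F \<noteq> {}" "F \<subseteq> Y"
    and Fol: "\<And>g. g \<in> M \<inter> Y \<Longrightarrow> (1 - e/2) * real (card F) \<le> real (card {x \<in> F. inv g \<otimes> x \<in> F})"
    using abelian_Folner[of "M \<inter> Y" "e/2"] M e by auto
  obtain \<xi> where \<xi>: "norm \<xi> = 1"
    "\<And>g. g \<in> carrier G \<Longrightarrow>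
      vec_functional \<xi> (L g) = b_ext g * complex_of_real (real (card {x \<in> F. inv g \<otimes> x \<in> F}) / real (card F))"
    using Folner_vector[OF F] by blast
  have "cmod (vec_functional \<xi> (L g) - b_ext g) < e" if g: "g \<in> M" for g
  proof (cases "g \<in> Y")
    case True
    define r where "r = real (card {x \<in> F. inv g \<otimes> x \<in> F}) / real (card F)"
    have n: "real (card F) > 0"
      using F by (simp add: card_gt_0_iff)
    have "card {x \<in> F. inv g \<otimes> x \<in> F} \<le> card F"
      using F by (intro card_mono) auto
    then have "r \<le> 1"
      using n by (simp add: r_def)
    moreover have "1 - e/2 \<le> r"
      unfolding r_def using Fol[of g] n True g by (simp only: pos_le_divide_eq) blast
    moreover have "vec_functional \<xi> (L g) - b_ext g = b_ext g * complex_of_real (r - 1)"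
      using \<xi>(2)[of g] g M by (auto simp: r_def algebra_simps)
    then have "cmod (vec_functional \<xi> (L g) - b_ext g) = \<bar>r - 1\<bar>"
      using True cmod_b by (simp only: norm_mult norm_of_real) (simp add: b_ext_def)
    ultimately show ?thesis
      using e by simp
  next
    case False
    then show ?thesis
      using \<xi>(2)[of g] g M e by (auto simp: b_ext_def)
  qed
  then show ?thesis
    using \<xi>(1) by blast
  qed
  show ?thesis
    using state_of_approximate_vectors[OF approx] that by blast
qed

end

locale trivialized_cocycle_trace = trivialized_cocycle +
  assumes b_trace: "g \<in> carrier G \<Longrightarrow> h \<in> carrier G \<Longrightarrow>
      \<sigma> g h * b_ext (g \<otimes> h) = \<sigma> h g * b_ext (h \<otimes> g)"
    and Y_nontrivial: "\<exists>s\<in>Y. s \<noteq> \<one>"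
begin

definition b_trace_functional :: "'a op \<Rightarrow> complex"
  where "b_trace_functional = (SOME \<phi>. positive_on A \<phi> \<and> (\<forall>g\<in>carrier G. \<phi> (L g) = b_ext g))"

abbreviation \<phi> :: "'a op \<Rightarrow> complex"
  where "\<phi> \<equiv> b_trace_functional"

lemma phi_positive: "positive_on A \<phi>" and phi_L: "g \<in> carrier G \<Longrightarrow> \<phi> (L g) = b_ext g"
proof -
  have "\<exists>\<phi>. positive_on A \<phi> \<and> (\<forall>g\<in>carrier G. \<phi> (L g) = b_ext g)"
    using b_state by metis
  from someI_ex[OF this]
  show "positive_on A \<phi>" "g \<in> carrier G \<Longrightarrow> \<phi> (L g) = b_ext g"
    by (auto simp: b_trace_functional_def)
qed

lemma phi_bounded: "bounded_functional A \<phi>"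
  by (rule positive_on_bounded[OF phi_positive])

lemma phi_one: "\<phi> (L \<one>) = 1"
  using subgroup.one_closed[OF Y_subgroup] by (simp add: phi_L b_ext_def b_one)

lemma phi_tracial_L: "g \<in> carrier G \<Longrightarrow> h \<in> carrier G \<Longrightarrow> \<phi> (L g o\<^sub>L L h) = \<phi> (L h o\<^sub>L L g)"
  by (simp add: functional_L_mult[OF phi_bounded] phi_L b_trace)

lemma phi_tracial: "a \<in> A \<Longrightarrow> c \<in> A \<Longrightarrow> \<phi> (a o\<^sub>L c) = \<phi> (c o\<^sub>L a)"
  by (rule functional_tracial[OF phi_bounded phi_tracial_L])

lemma not_unique_trace: "\<not> unique_trace_property G \<sigma>"
proof
  assume "unique_trace_property G \<sigma>"
  moreover have "restrict \<phi> A \<in> tracial_states A"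
    by (intro tracial_stateI phi_positive phi_one phi_tracial_L)
  ultimately have "restrict \<phi> A = restrict \<tau> A"
    using canonical_tracial_state unfolding unique_trace_property_def by blast
  moreover obtain s where s: "s \<in> Y" "s \<noteq> \<one>"
    using Y_nontrivial by blast
  ultimately have "\<phi> (L s) = \<tau> (L s)"
    by (metis L_in_A Y_closed restrict_apply')
  then show False
    using s cmod_b[OF s(1)] by (simp add: phi_L trace_L b_ext_def)
qed

text \<open>By the trace property and the Cauchy-Schwarz inequality these are the elements with
  \<open>\<phi>(a* a) = 0\<close>; in this bilinear form the set is visibly a closed two-sided ideal.\<close>

definition trace_kernel :: "'a op set"
  where "trace_kernel = {a \<in> A. \<forall>c\<in>A. \<phi> (c o\<^sub>L a) = 0}"

lemma trace_kernel_ideal: "closed_ideal A trace_kernel"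
proof -
  have sub: "complex_subspace trace_kernel"
    using A_subspace phi_bounded A_mult A_linear
    by (auto simp: trace_kernel_def complex_subspace_def op_compose_add_right
        op_scaleC_compose_right bounded_functional_def
        bounded_functional_diff[OF phi_bounded A_subspace L_in_A[OF one_closed] L_in_A[OF one_closed], simplified])
  have "trace_kernel = A \<inter> (\<Inter>c\<in>A. {a \<in> A. \<phi> (c o\<^sub>L a) = 0})"
    by (auto simp: trace_kernel_def)
  moreover have "closed {a \<in> A. \<phi> (c o\<^sub>L a) = 0}" if "c \<in> A" for c
    by (intro continuous_closed_preimage_constant A_closed bounded_functional_continuous
        A_subspace bounded_functional_compose_left phi_bounded that)
  ultimately have clo: "closed trace_kernel"
    using A_closed by (metis (no_types, lifting) closed_INT closed_Int)
  have "a o\<^sub>L x \<in> trace_kernel \<and> x o\<^sub>L a \<in> trace_kernel" if a: "a \<in> A" and x: "x \<in> trace_kernel" for a x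
  proof -
    have xA: "x \<in> A" and x0: "\<And>c. c \<in> A \<Longrightarrow> \<phi> (c o\<^sub>L x) = 0"
      using x by (auto simp: trace_kernel_def)
    have "\<phi> (c o\<^sub>L (a o\<^sub>L x)) = 0" if "c \<in> A" for c
      using x0[OF A_mult[OF that a]] by (simp add: op_compose_assoc)
    moreover have "\<phi> (c o\<^sub>L (x o\<^sub>L a)) = 0" if "c \<in> A" for c
    proof -
      have "\<phi> (c o\<^sub>L (x o\<^sub>L a)) = \<phi> (a o\<^sub>L (c o\<^sub>L x))"
        using phi_tracial[OF A_mult[OF that xA] a] by (simp add: op_compose_assoc)
      then show ?thesis
        using x0[OF A_mult[OF a that]] by (simp add: op_compose_assoc)
    qed
    ultimately show ?thesis
      using A_mult a xA by (simp add: trace_kernel_def)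
  qed
  then show ?thesis
    using sub clo by (auto simp: closed_ideal_def trace_kernel_def)
qed

lemma trace_kernel_proper: "trace_kernel \<noteq> A"
proof
  assume "trace_kernel = A"
  then have "L \<one> \<in> trace_kernel"
    by simp
  then have "\<phi> (L \<one> o\<^sub>L L \<one>) = 0"
    by (auto simp: trace_kernel_def)
  then show False
    using phi_one A_unit[of "L \<one>"] by simp
qed

text \<open>The kernel contains \<open>L s - b s\<close> for \<open>s \<in> Y\<close>, because \<open>\<phi>\<close> is multiplicative along \<open>Y\<close>.\<close>

lemma trace_kernel_nonzero: "trace_kernel \<noteq> {0}"
proof -
  obtain s where s: "s \<in> Y" "s \<noteq> \<one>"
    using Y_nontrivial by blast
  define d where "d = L s - op_scaleC (b s) (L \<one>)"
  have dA: "d \<in> A"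
    using s by (simp add: d_def A_diff A_scaleC)
  have "\<phi> (c o\<^sub>L d) = 0" if "c \<in> A" for c
  proof (rule functional_ext[where \<phi> = "\<lambda>c. \<phi> (c o\<^sub>L d)" and \<psi> = "\<lambda>_. 0"])
    show "bounded_functional A (\<lambda>c. \<phi> (c o\<^sub>L d))"
      by (intro bounded_functional_compose_right phi_bounded dA)
    show "bounded_functional A (\<lambda>_. 0)"
      by (auto simp: bounded_functional_def intro!: exI[of _ 0])
    fix g assume g: "g \<in> carrier G"
    have "L g o\<^sub>L d = (L g o\<^sub>L L s) - op_scaleC (b s) (L g)"
      using g s A_unit[of "L g"]
      by (simp add: d_def op_compose_diff_right op_scaleC_compose_right L_complex_linear)
    then have "\<phi> (L g o\<^sub>L d) = \<phi> (L g o\<^sub>L L s) - \<phi> (op_scaleC (b s) (L g))"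
      using g s by (simp add: bounded_functional_diff[OF phi_bounded A_subspace] A_mult A_scaleC)
    also have "\<dots> = \<sigma> g s * b_ext (g \<otimes> s) - b s * b_ext g"
      using g s phi_bounded by (simp add: functional_L_mult[OF phi_bounded] phi_L bounded_functional_def)
    also have "\<dots> = 0"
    proof (cases "g \<in> Y")
      case True
      then show ?thesis
        using s b_mult[OF True s(1)] subgroup.m_closed[OF Y_subgroup] by (simp add: b_ext_def mult.commute)
    next
      case False
      have "g \<otimes> s \<notin> Y"
      proof
        assume "g \<otimes> s \<in> Y"
        then have "(g \<otimes> s) \<otimes> inv s \<in> Y"
          using s subgroup.m_closed[OF Y_subgroup] subgroup.m_inv_closed[OF Y_subgroup] by blast
        then show False
          using False g s by (simp add: m_assoc)
      qed
      then show ?thesis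
        using False by (simp add: b_ext_def)
    qed
    finally show "\<phi> (L g o\<^sub>L d) = 0" .
  qed (rule that)
  then have "d \<in> trace_kernel"
    using dA by (simp add: trace_kernel_def)
  moreover have "d \<noteq> 0"
  proof
    assume "d = 0"
    then have "L s = op_scaleC (b s) (L \<one>)"
      by (simp add: d_def)
    then have "blinfun_apply (L s) (ket \<one>) = blinfun_apply (op_scaleC (b s) (L \<one>)) (ket \<one>)"
      by simp
    then have "ket s = ell2_scaleC (b s) (ket \<one>)"
      using s by (simp add: L_ket op_scaleC_apply)
    then have "ell2_apply (ket s) s = ell2_apply (ell2_scaleC (b s) (ket \<one>)) s"
      by simp
    then show False
      using s by (simp add: ket.rep_eq ell2_scaleC.rep_eq)
  qed
  ultimately show ?thesis
    by blast
qed

lemma not_simple: "\<not> simple_cstar A"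
  using trace_kernel_ideal trace_kernel_proper trace_kernel_nonzero
  unfolding simple_cstar_def by blast

text \<open>The composition of \<open>\<phi>\<close> with \<open>\<Phi>\<close> is again positive and agrees with \<open>\<phi>\<close> on generators, hence
  everywhere; so \<open>\<Phi>\<close> preserves the kernel of the trace.\<close>

lemma not_minimal:
  assumes \<Phi>: "star_automorphism A \<Phi>"
    and \<beta>: "\<And>x. x \<in> carrier G \<Longrightarrow> \<beta> x \<in> carrier G \<and> \<Phi> (L x) = L (\<beta> x) \<and> b_ext (\<beta> x) = b_ext x"
  shows "\<not> acts_minimally A \<Phi>"
proof -
  have bij: "bij_betw \<Phi> A A" and mult: "\<And>a c. a \<in> A \<Longrightarrow> c \<in> A \<Longrightarrow> \<Phi> (a o\<^sub>L c) = \<Phi> a o\<^sub>L \<Phi> c"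
    using \<Phi> by (auto simp: star_automorphism_def)
  have in_A: "\<Phi> a \<in> A" if "a \<in> A" for a
    using bij that by (auto simp: bij_betw_def)
  have surj: "\<exists>a'\<in>A. a = \<Phi> a'" if "a \<in> A" for a
    using bij that by (auto simp: bij_betw_def)
  have "positive_on A (\<lambda>a. \<phi> (\<Phi> a))"
    by (rule positive_on_star_automorphism[OF \<Phi> phi_positive])
  then have inv: "\<phi> (\<Phi> a) = \<phi> a" if "a \<in> A" for a
    using \<beta> that
    by (intro functional_ext[where a = a and \<phi> = "\<lambda>a. \<phi> (\<Phi> a)"] positive_on_bounded phi_bounded)
      (auto simp: phi_L)
  have iff: "\<Phi> a \<in> trace_kernel \<longleftrightarrow> a \<in> trace_kernel" if a: "a \<in> A" for a
  proof -
    have "(\<forall>c\<in>A. \<phi> (c o\<^sub>L \<Phi> a) = 0) \<longleftrightarrow> (\<forall>c\<in>A. \<phi> (\<Phi> c o\<^sub>L \<Phi> a) = 0)"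
      using surj in_A by metis
    also have "\<dots> \<longleftrightarrow> (\<forall>c\<in>A. \<phi> (c o\<^sub>L a) = 0)"
      using a A_mult by (simp add: inv flip: mult)
    finally show ?thesis
      using a in_A by (simp add: trace_kernel_def)
  qed
  have kernel_in_A: "a \<in> A" if "a \<in> trace_kernel" for a
    using that by (simp add: trace_kernel_def)
  have "\<Phi> ` trace_kernel = trace_kernel"
  proof
    show "\<Phi> ` trace_kernel \<subseteq> trace_kernel"
      using iff kernel_in_A by blast
    show "trace_kernel \<subseteq> \<Phi> ` trace_kernel"
    proof
      fix a assume a: "a \<in> trace_kernel"
      then obtain a' where "a' \<in> A" "a = \<Phi> a'"
        using surj kernel_in_A by blast
      then show "a \<in> \<Phi> ` trace_kernel"
        using a iff by blast
    qed
  qed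
  then show ?thesis
    using trace_kernel_ideal trace_kernel_proper trace_kernel_nonzero
    unfolding acts_minimally_def by blast
qed

end


section \<open>Trivializing a symmetric cocycle invariantly\<close>

lemma unit_circle_root:
  assumes "cmod c = 1" "n > 0"
  obtains s where "cmod s = 1" "s ^ n = c"
proof -
  obtain s where s: "s ^ n = c"
    using exists_complex_root[of n c] assms by auto
  then have "cmod s ^ n = 1"
    using assms by (metis norm_power)
  then have "cmod s = 1"
    using assms(2) power_eq_imp_eq_base[of "cmod s" n 1] by simp
  then show ?thesis
    using that s by blast
qed

text \<open>The central extension of \<open>S\<close> by the circle that is classified by \<open>\<sigma>\<close>. Splittings of it
  correspond to functions whose coboundary is \<open>\<sigma>\<close>.\<close>

definition circle_extension :: "'a set \<Rightarrow> ('a, 'm) monoid_scheme \<Rightarrow> ('a \<Rightarrow> 'a \<Rightarrow> complex) \<Rightarrow> (complex \<times> 'a) monoid"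
  where "circle_extension S H \<sigma> =
    \<lparr>carrier = {c. cmod c = 1} \<times> S,
     monoid.mult = (\<lambda>(c, x) (d, y). (c * d * \<sigma> x y, x \<otimes>\<^bsub>H\<^esub> y)),
     one = (1, \<one>\<^bsub>H\<^esub>)\<rparr>"

lemma circle_extension_comm_group:
  assumes H: "comm_group H" and \<sigma>: "\<sigma> \<in> two_cocycles H" and S: "subgroup S H"
    and sym: "\<And>x y. x \<in> S \<Longrightarrow> y \<in> S \<Longrightarrow> \<sigma> x y = \<sigma> y x"
  shows "comm_group (circle_extension S H \<sigma>)"
proof -
  interpret H: comm_group H by (rule H)
  interpret T: twisted_group H \<sigma> by unfold_locales (rule \<sigma>)
  have Sc: "x \<in> carrier H" if "x \<in> S" for x
    using subgroup.mem_carrier[OF S that] .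
  note S1 = subgroup.one_closed[OF S] and Sm = subgroup.m_closed[OF S] and Si = subgroup.m_inv_closed[OF S]
  show ?thesis
  proof (rule comm_groupI)
    fix x y assume "x \<in> carrier (circle_extension S H \<sigma>)" "y \<in> carrier (circle_extension S H \<sigma>)"
    then show "x \<otimes>\<^bsub>circle_extension S H \<sigma>\<^esub> y \<in> carrier (circle_extension S H \<sigma>)"
      using Sc Sm by (auto simp: circle_extension_def norm_mult)
  next
    fix x y z
    assume "x \<in> carrier (circle_extension S H \<sigma>)" "y \<in> carrier (circle_extension S H \<sigma>)"
      "z \<in> carrier (circle_extension S H \<sigma>)"
    then show "x \<otimes>\<^bsub>circle_extension S H \<sigma>\<^esub> y \<otimes>\<^bsub>circle_extension S H \<sigma>\<^esub> z =
        x \<otimes>\<^bsub>circle_extension S H \<sigma>\<^esub> (y \<otimes>\<^bsub>circle_extension S H \<sigma>\<^esub> z)"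
      using T.sigma_cocycle[of "snd x" "snd y" "snd z"] Sc
      by (auto simp: circle_extension_def H.m_assoc)
  next
    fix x y assume "x \<in> carrier (circle_extension S H \<sigma>)" "y \<in> carrier (circle_extension S H \<sigma>)"
    then show "x \<otimes>\<^bsub>circle_extension S H \<sigma>\<^esub> y = y \<otimes>\<^bsub>circle_extension S H \<sigma>\<^esub> x"
      using Sc sym by (auto simp: circle_extension_def H.m_comm)
  next
    fix x assume x: "x \<in> carrier (circle_extension S H \<sigma>)"
    then show "\<one>\<^bsub>circle_extension S H \<sigma>\<^esub> \<otimes>\<^bsub>circle_extension S H \<sigma>\<^esub> x = x"
      using Sc by (auto simp: circle_extension_def)
    obtain c y where cy: "x = (c, y)" "cmod c = 1" "y \<in> S"
      using x by (auto simp: circle_extension_def)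
    have "c \<noteq> 0" "\<sigma> (inv\<^bsub>H\<^esub> y) y \<noteq> 0"
      using cy Sc by auto
    then have "inverse (c * \<sigma> (inv\<^bsub>H\<^esub> y) y) * c * \<sigma> (inv\<^bsub>H\<^esub> y) y = 1"
      by (simp add: field_simps)
    moreover have "cmod (inverse (c * \<sigma> (inv\<^bsub>H\<^esub> y) y)) = 1"
      using cy Sc by (simp add: norm_mult norm_inverse)
    ultimately show "\<exists>z\<in>carrier (circle_extension S H \<sigma>). z \<otimes>\<^bsub>circle_extension S H \<sigma>\<^esub> x = \<one>\<^bsub>circle_extension S H \<sigma>\<^esub>"
      using cy Sc Si
      by (intro bexI[of _ "(inverse (c * \<sigma> (inv\<^bsub>H\<^esub> y) y), inv\<^bsub>H\<^esub> y)"])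
        (simp_all add: circle_extension_def del: inverse_mult_distrib)
  qed (use S1 in \<open>auto simp: circle_extension_def\<close>)
qed

text \<open>In the central extension of \<open>S\<close> by the circle, let \<open>\<beta>\<close> act trivially on the circle. The elements
  \<open>\<beta>(e) e\<^sup>-\<^sup>1\<close> form a subgroup, which meets the circle trivially: if \<open>\<beta>(e) = c e\<close> with \<open>c\<close> in the
  circle, then \<open>\<beta>\<close> fixes the image of \<open>e\<close> in \<open>S\<close>, so \<open>e\<close> itself lies in the circle and \<open>c = 1\<close>. A
  complement of the circle containing this subgroup is the graph of an invariant splitting.\<close>

lemma invariant_trivialization:
  assumes H: "comm_group H" and \<sigma>: "\<sigma> \<in> two_cocycles H" and S: "subgroup S H"
    and sym: "\<And>x y. x \<in> S \<Longrightarrow> y \<in> S \<Longrightarrow> \<sigma> x y = \<sigma> y x"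
    and \<beta>: "\<And>x. x \<in> S \<Longrightarrow> \<beta> x \<in> S" "\<And>x y. x \<in> S \<Longrightarrow> y \<in> S \<Longrightarrow> \<beta> (x \<otimes>\<^bsub>H\<^esub> y) = \<beta> x \<otimes>\<^bsub>H\<^esub> \<beta> y"
    and inv: "\<And>x y. x \<in> S \<Longrightarrow> y \<in> S \<Longrightarrow> \<sigma> (\<beta> x) (\<beta> y) = \<sigma> x y"
    and fixed: "\<And>x. x \<in> S \<Longrightarrow> \<beta> x = x \<Longrightarrow> x = \<one>\<^bsub>H\<^esub>"
  obtains b where "\<And>x. x \<in> S \<Longrightarrow> cmod (b x) = 1"
    "\<And>x y. x \<in> S \<Longrightarrow> y \<in> S \<Longrightarrow> b x * b y = \<sigma> x y * b (x \<otimes>\<^bsub>H\<^esub> y)"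
    "\<And>x. x \<in> S \<Longrightarrow> b (\<beta> x) = b x"
proof -
  define E where "E = circle_extension S H \<sigma>"
  interpret H: comm_group H by (rule H)
  interpret E: comm_group E
    unfolding E_def by (rule circle_extension_comm_group[OF H \<sigma> S sym])
  interpret T: twisted_group H \<sigma> by unfold_locales (rule \<sigma>)
  have Sc: "x \<in> carrier H" if "x \<in> S" for x
    using subgroup.mem_carrier[OF S that] .
  note S1 = subgroup.one_closed[OF S]
  have carrier_E: "carrier E = {c. cmod c = 1} \<times> S"
    and mult_E: "(c, x) \<otimes>\<^bsub>E\<^esub> (d, y) = (c * d * \<sigma> x y, x \<otimes>\<^bsub>H\<^esub> y)"
    and one_E: "\<one>\<^bsub>E\<^esub> = (1, \<one>\<^bsub>H\<^esub>)" for c x d y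
    by (simp_all add: E_def circle_extension_def)
  have inv_E_circle: "inv\<^bsub>E\<^esub> (c, \<one>\<^bsub>H\<^esub>) = (inverse c, \<one>\<^bsub>H\<^esub>)" if "cmod c = 1" for c
  proof -
    have "c \<noteq> 0"
      using that by auto
    then show ?thesis
      using that S1 by (intro E.inv_equality) (auto simp: mult_E one_E carrier_E norm_inverse)
  qed
  define C where "C = {c. cmod c = 1} \<times> {\<one>\<^bsub>H\<^esub>}"
  have C: "subgroup C E"
    by (rule E.subgroupI)
      (use S1 in \<open>auto simp: C_def carrier_E mult_E inv_E_circle norm_mult norm_inverse intro: exI[of _ 1]\<close>)
  have C_pow: "(c, \<one>\<^bsub>H\<^esub>) [^]\<^bsub>E\<^esub> n = (c ^ n, \<one>\<^bsub>H\<^esub>)" for c and n :: nat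
    by (induction n) (auto simp: one_E mult_E)
  have C_div: "\<exists>s\<in>C. s [^]\<^bsub>E\<^esub> n = t" if t: "t \<in> C" and n: "n > 0" for t and n :: nat
  proof -
    obtain c where c: "cmod c = 1" "t = (c, \<one>\<^bsub>H\<^esub>)"
      using t by (auto simp: C_def)
    obtain s where "cmod s = 1" "s ^ n = c"
      using unit_circle_root[OF c(1) n] by blast
    then show ?thesis
      using c by (intro bexI[of _ "(s, \<one>\<^bsub>H\<^esub>)"]) (auto simp: C_pow C_def)
  qed
  define \<beta>E where "\<beta>E = (\<lambda>(c :: complex, x). (c, \<beta> x))"
  have \<beta>E: "\<beta>E e \<in> carrier E" if "e \<in> carrier E" for e
    using that \<beta>(1) by (auto simp: carrier_E \<beta>E_def)
  have \<beta>E_mult: "\<beta>E (e \<otimes>\<^bsub>E\<^esub> f) = \<beta>E e \<otimes>\<^bsub>E\<^esub> \<beta>E f" if "e \<in> carrier E" "f \<in> carrier E" for e f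
    using that \<beta>(2) inv by (auto simp: carrier_E \<beta>E_def mult_E)
  have \<beta>1: "\<beta> \<one>\<^bsub>H\<^esub> = \<one>\<^bsub>H\<^esub>"
    using \<beta>(2)[OF S1 S1] \<beta>(1)[OF S1] Sc by (metis H.l_cancel_one H.l_one H.one_closed)
  define \<delta> where "\<delta> e = \<beta>E e \<otimes>\<^bsub>E\<^esub> inv\<^bsub>E\<^esub> e" for e
  have \<delta>: "\<delta> \<in> hom E E"
  proof (rule homI)
    show "\<delta> e \<in> carrier E" if "e \<in> carrier E" for e
      using that \<beta>E by (simp add: \<delta>_def)
    show "\<delta> (e \<otimes>\<^bsub>E\<^esub> f) = \<delta> e \<otimes>\<^bsub>E\<^esub> \<delta> f" if "e \<in> carrier E" "f \<in> carrier E" for e f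
      using that \<beta>E by (simp add: \<delta>_def \<beta>E_mult E.inv_mult E.m_ac)
  qed
  \<comment> \<open>\<open>E\<close> is abelian, so the map \<open>\<delta>\<close> is a homomorphism and its image is a subgroup.\<close>
  define N0 where "N0 = \<delta> ` carrier E"
  have N0: "subgroup N0 E"
    unfolding N0_def using \<delta>
    by (intro group_hom.img_is_subgroup) (simp add: group_hom_def group_hom_axioms_def)
  have "N0 \<inter> C \<subseteq> {\<one>\<^bsub>E\<^esub>}"
  proof
    fix t assume "t \<in> N0 \<inter> C"
    then obtain e c where e: "e \<in> carrier E" "t = \<delta> e" and c: "cmod c = 1" "t = (c, \<one>\<^bsub>H\<^esub>)"
      by (auto simp: N0_def C_def)
    have "t \<in> carrier E"
      using c S1 by (simp add: carrier_E)
    have eq: "t \<otimes>\<^bsub>E\<^esub> e = \<beta>E e"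
      using e \<beta>E[OF e(1)] by (simp add: \<delta>_def E.m_assoc)
    obtain d x where dx: "e = (d, x)" "x \<in> S"
      using e by (auto simp: carrier_E)
    have "\<beta> x = x"
      using eq c dx Sc by (auto simp: mult_E \<beta>E_def)
    then have "x = \<one>\<^bsub>H\<^esub>"
      using fixed dx by blast
    then have "\<beta>E e = e"
      using dx \<beta>1 by (simp add: \<beta>E_def)
    then show "t \<in> {\<one>\<^bsub>E\<^esub>}"
      using eq e \<open>t \<in> carrier E\<close> by (simp add: \<delta>_def)
  qed
  moreover have "\<one>\<^bsub>E\<^esub> \<in> N0 \<inter> C"
    using subgroup.one_closed[OF N0] subgroup.one_closed[OF C] by blast
  ultimately have N0C: "N0 \<inter> C = {\<one>\<^bsub>E\<^esub>}"
    by blast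
  obtain N where N: "subgroup N E" "N0 \<subseteq> N" "N \<inter> C = {\<one>\<^bsub>E\<^esub>}"
    and NC: "\<And>e. e \<in> carrier E \<Longrightarrow> \<exists>a\<in>N. \<exists>t\<in>C. e = a \<otimes>\<^bsub>E\<^esub> t"
    by (rule E.divisible_subgroup_complement[OF C C_div N0 N0C]) metis+
  \<comment> \<open>The value of \<open>b\<close> at \<open>x\<close> is the circle component of \<open>(1, x)\<close> with respect to \<open>N\<close>.\<close>
  have ex: "\<exists>t. cmod t = 1 \<and> (inverse t, x) \<in> N" if x: "x \<in> S" for x
  proof -
    have "(1, x) \<in> carrier E"
      using x by (simp add: carrier_E)
    then obtain a t where at: "a \<in> N" "t \<in> C" "(1, x) = a \<otimes>\<^bsub>E\<^esub> t"
      using NC by blast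
    obtain c where c: "cmod c = 1" "t = (c, \<one>\<^bsub>H\<^esub>)"
      using at(2) by (auto simp: C_def)
    obtain d y where dy: "a = (d, y)" "y \<in> S"
      using at(1) subgroup.mem_carrier[OF N(1)] by (metis (no_types) SigmaE carrier_E)
    have "y = x" "d * c = 1"
      using at(3) dy c Sc by (auto simp: mult_E)
    moreover from this have "d = inverse c"
      by (metis inverse_unique mult.commute)
    ultimately show ?thesis
      using at(1) dy c by auto
  qed
  have unique: "t = s" if t: "(inverse t, x) \<in> N" "cmod t = 1" and s: "(inverse s, x) \<in> N" "cmod s = 1" for t s x
  proof -
    have x: "x \<in> S"
      using t subgroup.mem_carrier[OF N(1)] carrier_E by auto
    have tc: "(inverse t, x) \<in> carrier E" and sc: "(inverse s, x) \<in> carrier E"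
      using t s x by (auto simp: carrier_E norm_inverse)
    define r where "r = (s * inverse t, \<one>\<^bsub>H\<^esub>)"
    have r: "r \<in> C" "r \<in> carrier E"
      using t s S1 by (auto simp: r_def C_def norm_mult norm_inverse carrier_E)
    have "s \<noteq> 0"
      using s by auto
    then have "r \<otimes>\<^bsub>E\<^esub> (inverse s, x) = (inverse t, x)"
      using x Sc by (simp add: r_def mult_E)
    then have "r = (inverse t, x) \<otimes>\<^bsub>E\<^esub> inv\<^bsub>E\<^esub> (inverse s, x)"
      using sc r(2) by (metis E.inv_solve_right tc)
    then have "r \<in> N"
      using t s subgroup.m_closed[OF N(1)] subgroup.m_inv_closed[OF N(1)] by metis
    then have "r = \<one>\<^bsub>E\<^esub>"
      using r N(3) by blast
    then have "s * inverse t = 1"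
      by (simp add: r_def one_E)
    then show "t = s"
      by (metis inverse_inverse_eq inverse_unique mult.commute)
  qed
  obtain b where b: "\<And>x. x \<in> S \<Longrightarrow> cmod (b x) = 1" "\<And>x. x \<in> S \<Longrightarrow> (inverse (b x), x) \<in> N"
    using ex by metis
  show ?thesis
  proof (rule that)
    show "cmod (b x) = 1" if "x \<in> S" for x
      using b that by blast
    show "b x * b y = \<sigma> x y * b (x \<otimes>\<^bsub>H\<^esub> y)" if x: "x \<in> S" and y: "y \<in> S" for x y
    proof -
      have sg: "\<sigma> x y \<noteq> 0" "cmod (\<sigma> x y) = 1"
        using x y Sc by auto
      have "(inverse (b x), x) \<otimes>\<^bsub>E\<^esub> (inverse (b y), y) \<in> N"
        using b x y subgroup.m_closed[OF N(1)] by blast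
      then have "(inverse (b x * b y / \<sigma> x y), x \<otimes>\<^bsub>H\<^esub> y) \<in> N"
        using sg by (simp add: mult_E divide_inverse)
      moreover have "cmod (b x * b y / \<sigma> x y) = 1"
        using b(1)[OF x] b(1)[OF y] sg by (simp add: norm_mult norm_divide)
      ultimately have "b x * b y / \<sigma> x y = b (x \<otimes>\<^bsub>H\<^esub> y)"
        using b subgroup.m_closed[OF S x y] unique by blast
      then show ?thesis
        using sg by (simp add: field_simps)
    qed
    show "b (\<beta> x) = b x" if x: "x \<in> S" for x
    proof -
      define e where "e = (inverse (b x), x)"
      have eN: "e \<in> N" and eE: "e \<in> carrier E"
        using b(2)[OF x] subgroup.mem_carrier[OF N(1)] by (auto simp: e_def)
      have "\<delta> e \<in> N"
        using N(2) eE by (auto simp: N0_def)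
      then have "\<delta> e \<otimes>\<^bsub>E\<^esub> e \<in> N"
        using eN subgroup.m_closed[OF N(1)] by blast
      moreover have "\<delta> e \<otimes>\<^bsub>E\<^esub> e = \<beta>E e"
        using eE \<beta>E[OF eE] by (simp add: \<delta>_def E.m_assoc)
      ultimately have "(inverse (b x), \<beta> x) \<in> N"
        by (simp add: e_def \<beta>E_def)
      then show ?thesis
        using unique b \<beta>(1)[OF x] x by blast
    qed
  qed
qed

section \<open>The induced automorphism\<close>

definition perm_op :: "('a \<Rightarrow> 'a) \<Rightarrow> 'a op"
  where "perm_op \<pi> = Blinfun (\<lambda>\<xi>. Abs_ell2 (\<lambda>x. ell2_apply \<xi> (\<pi> x)))"

lemma perm_op_apply:
  assumes "bij \<pi>"
  shows "ell2_apply (blinfun_apply (perm_op \<pi>) \<xi>) x = ell2_apply \<xi> (\<pi> x)"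
proof -
  let ?T = "\<lambda>\<xi>. Abs_ell2 (\<lambda>x. ell2_apply \<xi> (\<pi> x))"
  have rep: "ell2_apply (?T \<xi>) = (\<lambda>x. ell2_apply \<xi> (\<pi> x))" for \<xi>
    using summable_on_reindex_bij_betw[OF assms, of "\<lambda>x. (cmod (ell2_apply \<xi> x))\<^sup>2"] ell2_apply[of \<xi>]
    by (simp add: Abs_ell2_inverse)
  have "bounded_linear ?T"
  proof (rule bounded_linear_intro[where K = 1])
    fix x y :: "'a ell2" and r :: real
    show "?T (x + y) = ?T x + ?T y"
      unfolding ell2_apply_inject[symmetric] rep unfolding plus_ell2.rep_eq rep ..
    show "?T (r *\<^sub>R x) = r *\<^sub>R ?T x"
      unfolding ell2_apply_inject[symmetric] rep unfolding scaleR_ell2.rep_eq rep ..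
    show "norm (?T x) \<le> norm x * 1"
      using infsum_reindex_bij_betw[OF assms, of "\<lambda>y. (cmod (ell2_apply x y))\<^sup>2"]
      by (simp add: norm_ell2_eq rep)
  qed
  then show ?thesis
    by (simp add: perm_op_def bounded_linear_Blinfun_apply rep)
qed

lemma is_adjoint_perm_op:
  assumes \<pi>: "bij \<pi>" "bij \<rho>" "\<And>x. \<pi> (\<rho> x) = x"
  shows "is_adjoint (perm_op \<pi>) (perm_op \<rho>)"
  unfolding is_adjoint_def
proof (intro allI)
  fix \<xi> \<eta>
  show "ell2_cinner (blinfun_apply (perm_op \<pi>) \<xi>) \<eta> = ell2_cinner \<xi> (blinfun_apply (perm_op \<rho>) \<eta>)"
    using infsum_reindex_bij_betw[OF \<pi>(2), of "\<lambda>x. cnj (ell2_apply \<xi> (\<pi> x)) * ell2_apply \<eta> x"]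
    by (simp add: ell2_cinner.rep_eq perm_op_apply \<pi>)
qed

lemma perm_op_complex_linear: "bij \<pi> \<Longrightarrow> complex_linear_op (perm_op \<pi>)"
  unfolding complex_linear_op_def by (intro allI ell2_eqI) (simp add: perm_op_apply ell2_scaleC.rep_eq)

lemma perm_op_cancel:
  "bij \<pi> \<Longrightarrow> bij \<rho> \<Longrightarrow> (\<And>x. \<pi> (\<rho> x) = x) \<Longrightarrow>
    blinfun_apply (perm_op \<rho>) (blinfun_apply (perm_op \<pi>) \<xi>) = \<xi>"
  by (rule ell2_eqI) (simp add: perm_op_apply)

text \<open>Polarization.\<close>

lemma complex_linear_op_eqI:
  assumes a: "complex_linear_op a" and c: "complex_linear_op c"
    and eq: "\<And>\<xi>. ell2_cinner \<xi> (blinfun_apply a \<xi>) = ell2_cinner \<xi> (blinfun_apply c \<xi>)"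
  shows "a = c"
proof (rule blinfun_eqI)
  fix \<eta>
  define q where "q \<xi> \<zeta> = ell2_cinner \<xi> (blinfun_apply a \<zeta>) - ell2_cinner \<xi> (blinfun_apply c \<zeta>)" for \<xi> \<zeta>
  have q0: "q \<xi> \<xi> = 0" for \<xi>
    by (simp add: q_def eq)
  have swap: "q \<xi> \<zeta> + q \<zeta> \<xi> = 0" for \<xi> \<zeta>
  proof -
    have "q (\<xi> + \<zeta>) (\<xi> + \<zeta>) = q \<xi> \<xi> + (q \<xi> \<zeta> + q \<zeta> \<xi>) + q \<zeta> \<zeta>"
      unfolding q_def blinfun.add_right ell2_cinner_add_left ell2_cinner_add_right by simp
    then show ?thesis
      by (simp add: q0)
  qed
  have "q \<xi> \<eta> = 0" for \<xi>
  proof -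
    have "\<i> * q \<xi> \<eta> + cnj \<i> * q \<eta> \<xi> = 0"
      using swap[of \<xi> "ell2_scaleC \<i> \<eta>"] a c
      by (simp add: q_def complex_linear_op_def ell2_cinner_scaleC_left ell2_cinner_scaleC_right algebra_simps)
    then have "\<i> * (q \<xi> \<eta> - q \<eta> \<xi>) = 0"
      by (simp add: algebra_simps)
    then have "q \<xi> \<eta> = q \<eta> \<xi>"
      by simp
    then show ?thesis
      using swap[of \<xi> \<eta>] by simp
  qed
  then have "ell2_apply (blinfun_apply a \<eta>) x = ell2_apply (blinfun_apply c \<eta>) x" for x
    unfolding q_def ell2_cinner_ket[symmetric] by simp
  then show "blinfun_apply a \<eta> = blinfun_apply c \<eta>"
    by (rule ell2_eqI)
qed

context twisted_group
begin

text \<open>A *-automorphism turns vector states into positive functionals. These are automatically bounded,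
  hence determined by their values on generators.\<close>

lemma star_automorphism_eqI:
  assumes \<Phi>: "star_automorphism A \<Phi>" and \<Psi>: "star_automorphism A \<Psi>"
    and gens: "\<And>g. g \<in> carrier G \<Longrightarrow> \<Phi> (L g) = \<Psi> (L g)" and a: "a \<in> A"
  shows "\<Phi> a = \<Psi> a"
proof (rule complex_linear_op_eqI)
  have "\<Phi> a \<in> A" "\<Psi> a \<in> A"
    using \<Phi> \<Psi> a by (auto simp: star_automorphism_def bij_betw_def)
  then show "complex_linear_op (\<Phi> a)" "complex_linear_op (\<Psi> a)"
    by (auto intro: A_linear)
  fix \<xi>
  have bounded: "bounded_functional A (\<lambda>a. vec_functional \<xi> (\<Theta> a))" if "star_automorphism A \<Theta>" for \<Theta>
    by (rule positive_on_bounded[OF positive_on_star_automorphism[OF that vec_functional_positive]])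
  have "vec_functional \<xi> (\<Phi> a) = vec_functional \<xi> (\<Psi> a)"
    by (rule functional_ext[OF bounded[OF \<Phi>] bounded[OF \<Psi>] _ a]) (simp add: gens)
  then show "ell2_cinner \<xi> (blinfun_apply (\<Phi> a) \<xi>) = ell2_cinner \<xi> (blinfun_apply (\<Psi> a) \<xi>)"
    by (simp add: vec_functional_def)
qed

lemma conjugation_into_A:
  assumes \<pi>: "bij \<pi>" and gens: "\<And>g. g \<in> carrier G \<Longrightarrow> perm_op \<rho> o\<^sub>L (L g o\<^sub>L perm_op \<pi>) \<in> A"
    and \<rho>: "bij \<rho>" and a: "a \<in> A"
  shows "perm_op \<rho> o\<^sub>L (a o\<^sub>L perm_op \<pi>) \<in> A"
proof -
  let ?W = "{a. perm_op \<rho> o\<^sub>L (a o\<^sub>L perm_op \<pi>) \<in> A}"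
  have "A \<subseteq> ?W"
  proof (rule A_subset_closed_subspace)
    have "continuous (at a) (\<lambda>a. perm_op \<rho> o\<^sub>L (a o\<^sub>L perm_op \<pi>))" for a
      by (intro continuous_intros)
    from continuous_closed_vimage[OF A_closed this] show "closed ?W"
      by (simp add: vimage_def)
    show "complex_subspace ?W"
      using A_subspace
      by (auto simp: complex_subspace_def op_compose_add_left op_compose_add_right
          op_scaleC_compose_left op_scaleC_compose_right perm_op_complex_linear[OF \<rho>])
  qed (use gens in auto)
  then show ?thesis
    using a by blast
qed

text \<open>The automorphism is implemented by permuting coordinates. Points outside the group are left
  fixed, so that the permutation acts unitarily on the whole ambient space.\<close>

lemma induced_automorphism_spec:
  assumes bij: "bij_betw \<beta> (carrier G) (carrier G)"
    and hom: "\<And>x y. x \<in> carrier G \<Longrightarrow> y \<in> carrier G \<Longrightarrow> \<beta> (x \<otimes> y) = \<beta> x \<otimes> \<beta> y"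
    and inv: "\<And>x y. x \<in> carrier G \<Longrightarrow> y \<in> carrier G \<Longrightarrow> \<sigma> (\<beta> x) (\<beta> y) = \<sigma> x y"
  shows "star_automorphism A (induced_automorphism G \<sigma> \<beta>)"
    and "x \<in> carrier G \<Longrightarrow> induced_automorphism G \<sigma> \<beta> (L x) = L (\<beta> x)"
proof -
  have \<beta>c: "\<beta> x \<in> carrier G" if "x \<in> carrier G" for x
    using bij that by (auto simp: bij_betw_def)
  define \<pi> where "\<pi> x = (if x \<in> carrier G then \<beta> x else x)" for x
  have "bij_betw \<pi> (carrier G) (carrier G)"
    using bij by (rule bij_betw_cong[THEN iffD1, rotated]) (simp add: \<pi>_def)
  moreover have "bij_betw \<pi> (- carrier G) (- carrier G)"
    by (rule bij_betw_cong[THEN iffD1, rotated, OF bij_betw_id]) (simp add: \<pi>_def)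
  ultimately have \<pi>: "bij \<pi>"
    using bij_betw_combine[of \<pi> "carrier G" "carrier G" "- carrier G" "- carrier G"] by simp
  define \<rho> where "\<rho> = inv_into UNIV \<pi>"
  have \<rho>: "bij \<rho>" and \<pi>\<rho>: "\<pi> (\<rho> x) = x" and \<rho>\<pi>: "\<rho> (\<pi> x) = x" for x
    using \<pi> by (auto simp: \<rho>_def bij_imp_bij_inv bij_is_surj surj_f_inv_f bij_is_inj)
  have \<rho>c: "\<rho> x \<in> carrier G \<longleftrightarrow> x \<in> carrier G" for x
    using \<pi>\<rho>[of x] \<rho>\<pi> \<beta>c bij unfolding \<pi>_def by (metis bij_betw_imp_surj_on imageE)
  have inv_\<beta>: "\<beta> (inv x) = inv (\<beta> x)" if "x \<in> carrier G" for x
  proof -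
    have "\<beta> \<one> \<otimes> \<beta> \<one> = \<beta> \<one>"
      using hom[of \<one> \<one>] by simp
    then have "\<beta> \<one> = \<one>"
      using \<beta>c by (metis l_cancel_one one_closed)
    then show ?thesis
      using hom[of "inv x" x] that \<beta>c by (intro inv_equality[symmetric]) auto
  qed
  define \<Phi> where "\<Phi> a = perm_op \<rho> o\<^sub>L (a o\<^sub>L perm_op \<pi>)" for a
  define \<Psi> where "\<Psi> a = perm_op \<pi> o\<^sub>L (a o\<^sub>L perm_op \<rho>)" for a
  have \<Phi>_L: "\<Phi> (L x) = L (\<beta> x)" if x: "x \<in> carrier G" for x
  proof (rule blinfun_eqI, rule ell2_eqI)
    fix \<xi> h
    show "ell2_apply (blinfun_apply (\<Phi> (L x)) \<xi>) h = ell2_apply (blinfun_apply (L (\<beta> x)) \<xi>) h"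
    proof (cases "h \<in> carrier G")
      case True
      define k where "k = \<rho> h"
      have k: "k \<in> carrier G" "h = \<beta> k"
        using True \<rho>c[of h] \<pi>\<rho>[of h] by (auto simp: k_def \<pi>_def)
      have "inv (\<beta> x) \<otimes> \<beta> k = \<beta> (inv x \<otimes> k)"
        using x k by (simp add: hom inv_\<beta>)
      moreover have "\<rho> (\<beta> k) = k"
        unfolding k(2)[symmetric] by (rule k_def[symmetric])
      ultimately show ?thesis
        using x k inv[of x "inv x \<otimes> k"] \<beta>c
        by (simp add: \<Phi>_def perm_op_apply \<rho> \<pi> L_apply) (simp add: \<pi>_def)
    next
      case False
      then show ?thesis
        using x \<beta>c \<rho>c[of h] by (simp add: \<Phi>_def perm_op_apply \<rho> \<pi> L_apply)
    qed
  qed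
  have \<Psi>\<Phi>: "\<Psi> (\<Phi> a) = a" and \<Phi>\<Psi>: "\<Phi> (\<Psi> a) = a" for a
    by (rule blinfun_eqI,
        simp add: \<Phi>_def \<Psi>_def perm_op_cancel[OF \<rho> \<pi> \<rho>\<pi>] perm_op_cancel[OF \<pi> \<rho> \<pi>\<rho>])+
  have \<Psi>_L: "\<Psi> (L x) \<in> A" if x: "x \<in> carrier G" for x
  proof -
    obtain y where "y \<in> carrier G" "x = \<beta> y"
      using bij x by (auto simp: bij_betw_def)
    then show ?thesis
      using \<Psi>\<Phi>[of "L y"] by (simp add: \<Phi>_L)
  qed
  have \<Phi>A: "\<Phi> a \<in> A" if "a \<in> A" for a
    unfolding \<Phi>_def
    by (rule conjugation_into_A[OF \<pi> _ \<rho> that], unfold \<Phi>_def[symmetric]) (simp add: \<Phi>_L \<beta>c)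
  have \<Psi>A: "\<Psi> a \<in> A" if "a \<in> A" for a
    unfolding \<Psi>_def
    by (rule conjugation_into_A[OF \<rho> _ \<pi> that], unfold \<Psi>_def[symmetric]) (rule \<Psi>_L)
  have star: "star_automorphism A (restrict \<Phi> A)"
    unfolding star_automorphism_def
  proof (intro conjI ballI allI impI)
    have "bij_betw \<Phi> A A"
      by (rule bij_betw_byWitness[where f' = \<Psi>]) (auto simp: \<Phi>\<Psi> \<Psi>\<Phi> \<Phi>A \<Psi>A)
    then show "bij_betw (restrict \<Phi> A) A A"
      by (rule bij_betw_cong[THEN iffD1, rotated]) simp
    fix a assume a: "a \<in> A"
    show "restrict \<Phi> A (op_scaleC c a) = op_scaleC c (restrict \<Phi> A a)" for c
      using a A_scaleC
      by (simp add: \<Phi>_def op_scaleC_compose_left op_scaleC_compose_right perm_op_complex_linear[OF \<rho>])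
    fix c
    show "is_adjoint (restrict \<Phi> A a) (restrict \<Phi> A c)" if "c \<in> A" "is_adjoint a c"
      using a that is_adjoint_compose[OF is_adjoint_perm_op[OF \<rho> \<pi> \<rho>\<pi>]
          is_adjoint_compose[OF that(2) is_adjoint_perm_op[OF \<pi> \<rho> \<pi>\<rho>]]]
      by (simp add: \<Phi>_def op_compose_assoc)
    assume c: "c \<in> A"
    show "restrict \<Phi> A (a + c) = restrict \<Phi> A a + restrict \<Phi> A c"
      using a c A_add by (simp add: \<Phi>_def op_compose_add_left op_compose_add_right)
    have "\<Phi> (a o\<^sub>L c) = \<Phi> a o\<^sub>L \<Phi> c"
      by (rule blinfun_eqI) (simp add: \<Phi>_def perm_op_cancel[OF \<rho> \<pi> \<rho>\<pi>])
    then show "restrict \<Phi> A (a o\<^sub>L c) = restrict \<Phi> A a o\<^sub>L restrict \<Phi> A c"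
      using a c A_mult by simp
  qed
  let ?P = "\<lambda>\<Phi>. \<Phi> \<in> extensional A \<and> star_automorphism A \<Phi> \<and> (\<forall>x\<in>carrier G. \<Phi> (L x) = L (\<beta> x))"
  have P: "?P (restrict \<Phi> A)"
    using star \<Phi>_L by simp
  moreover have "\<Theta> = restrict \<Phi> A" if "?P \<Theta>" for \<Theta>
  proof (rule extensionalityI[of _ A])
    show "\<Theta> a = restrict \<Phi> A a" if "a \<in> A" for a
    proof (rule star_automorphism_eqI[OF _ star _ that])
      show "star_automorphism A \<Theta>"
        using \<open>?P \<Theta>\<close> by blast
    qed (use \<open>?P \<Theta>\<close> \<Phi>_L in simp)
  qed (use that in simp_all)
  ultimately have "?P (induced_automorphism G \<sigma> \<beta>)"
    unfolding induced_automorphism_def by (rule theI[of ?P])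
  then show "star_automorphism A (induced_automorphism G \<sigma> \<beta>)"
    and "x \<in> carrier G \<Longrightarrow> induced_automorphism G \<sigma> \<beta> (L x) = L (\<beta> x)"
    by auto
qed

end


section \<open>Semidirect products with the integers\<close>

locale group_automorphism = group H for H :: "('h, 'm) monoid_scheme" (structure) +
  fixes \<beta> :: "'h \<Rightarrow> 'h"
  assumes auto: "\<beta> \<in> auto H"
begin

abbreviation B :: "int \<Rightarrow> 'h \<Rightarrow> 'h"
  where "B \<equiv> aut_power H \<beta>"

abbreviation G :: "('h \<times> int) monoid"
  where "G \<equiv> semidirect_product H integer_group B"

lemma carrier_AutoGroup: "carrier (AutoGroup H) = auto H"
  by (simp add: AutoGroup_def)

lemma mult_AutoGroup:
  assumes "f \<in> auto H" "g \<in> auto H" "x \<in> carrier H"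
  shows "(f \<otimes>\<^bsub>AutoGroup H\<^esub> g) x = f (g x)"
  using assms by (simp add: AutoGroup_def BijGroup_def auto_def compose_def)

lemma B_auto: "B k \<in> auto H"
  using group.int_pow_closed[OF AutoGroup] auto by (simp add: carrier_AutoGroup)

lemma B_closed [simp]: "x \<in> carrier H \<Longrightarrow> B k x \<in> carrier H"
  using B_auto[of k] by (auto simp: auto_def hom_def)

lemma B_mult: "x \<in> carrier H \<Longrightarrow> y \<in> carrier H \<Longrightarrow> B k (x \<otimes> y) = B k x \<otimes> B k y"
  using B_auto[of k] by (auto simp: auto_def hom_def)

lemma B_bij: "bij_betw (B k) (carrier H) (carrier H)"
  using B_auto[of k] by (auto simp: auto_def Bij_def)

lemma one_AutoGroup [simp]: "x \<in> carrier H \<Longrightarrow> \<one>\<^bsub>AutoGroup H\<^esub> x = x"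
  by (simp add: AutoGroup_def BijGroup_def)

lemma B_1 [simp]: "B 1 = \<beta>"
  using group.int_pow_1[OF AutoGroup] auto by (simp add: carrier_AutoGroup)

lemma B_add: "x \<in> carrier H \<Longrightarrow> B (k + l) x = B k (B l x)"
  using group.int_pow_mult[OF AutoGroup, of \<beta> k l] auto B_auto
  by (simp add: carrier_AutoGroup mult_AutoGroup)

lemma B_one [simp]: "B k \<one> = \<one>"
  using B_mult[of \<one> \<one> k] by (metis B_closed l_cancel_one one_closed l_one)

lemma B_inv: "x \<in> carrier H \<Longrightarrow> B k (inv x) = inv (B k x)"
  using B_mult[of "inv x" x k] by (intro inv_equality[symmetric]) auto

text \<open>A point fixed by one nonzero power of \<open>\<beta>\<close> has a finite orbit; see \<open>aperiodic_fixed\<close>.\<close>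

lemma B_fixed_multiple:
  assumes x: "x \<in> carrier H" "B k x = x"
  shows "B (k * m) x = x"
proof (induction m rule: int_induct[where k = 0])
  case (step1 i)
  have "B (k * (i + 1)) x = B (k * i) (B k x)"
    using B_add[OF x(1), of "k * i" k] by (simp only: distrib_left mult_1_right)
  then show ?case
    using step1 x(2) by (simp only:)
next
  case (step2 i)
  have "k * (i - 1) + k = k * i"
    by (simp add: right_diff_distrib)
  then have "B (k * i) x = B (k * (i - 1)) (B k x)"
    using B_add[OF x(1), of "k * (i - 1)" k] by (simp only:)
  then show ?case
    using step2 x(2) by (simp only:)
qed (use x in simp)

lemma aperiodic_fixed:
  assumes ap: "aperiodic H \<beta>" and k: "k \<noteq> 0" and x: "x \<in> carrier H" "B k x = x"
  shows "x = \<one>"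
proof (rule ccontr)
  assume "x \<noteq> \<one>"
  then have inf: "infinite (range (\<lambda>j. B j x))"
    using ap x by (simp add: aperiodic_def)
  have "B j x \<in> (\<lambda>r. B r x) ` {- \<bar>k\<bar>..\<bar>k\<bar>}" for j
  proof -
    have "B j x = B (j mod k + k * (j div k)) x"
      by simp
    also have "\<dots> = B (j mod k) x"
      using x by (subst B_add) (simp_all add: B_fixed_multiple)
    finally have "B j x = B (j mod k) x" .
    moreover have "j mod k \<in> {- \<bar>k\<bar>..\<bar>k\<bar>}"
      using abs_mod_less[OF k, of j] by auto
    ultimately show ?thesis
      by blast
  qed
  then have "range (\<lambda>j. B j x) \<subseteq> (\<lambda>r. B r x) ` {- \<bar>k\<bar>..\<bar>k\<bar>}"
    by blast
  then show False
    using inf finite_subset by blast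
qed

lemma carrier_G: "carrier G = carrier H \<times> UNIV"
  by (simp add: semidirect_product_def)

lemma mult_G: "(x, k) \<otimes>\<^bsub>G\<^esub> (y, l) = (x \<otimes> B k y, k + l)"
  by (simp add: semidirect_product_def)

lemma one_G: "\<one>\<^bsub>G\<^esub> = (\<one>, 0)"
  by (simp add: semidirect_product_def)

lemma group_G: "group G"
proof (rule groupI)
  fix g assume "g \<in> carrier G"
  then obtain x k where g: "g = (x, k)" "x \<in> carrier H"
    by (auto simp: carrier_G)
  show "\<exists>h\<in>carrier G. h \<otimes>\<^bsub>G\<^esub> g = \<one>\<^bsub>G\<^esub>"
    using g by (intro bexI[of _ "(B (- k) (inv x), - k)"])
      (auto simp: carrier_G mult_G one_G B_mult[symmetric])
  show "\<one>\<^bsub>G\<^esub> \<otimes>\<^bsub>G\<^esub> g = g"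
    using g by (simp add: one_G mult_G)
qed (auto simp: carrier_G mult_G one_G B_mult B_add m_assoc)

lemma inv_G: "x \<in> carrier H \<Longrightarrow> inv\<^bsub>G\<^esub> (x, k) = (B (- k) (inv x), - k)"
  by (rule group.inv_equality[OF group_G])
    (auto simp: carrier_G mult_G one_G B_mult[symmetric])

lemma subgroup_times_zero:
  assumes S: "subgroup S H"
  shows "subgroup (S \<times> {0}) G"
proof (rule group.subgroupI[OF group_G])
  have Sc: "x \<in> carrier H" if "x \<in> S" for x
    using subgroup.mem_carrier[OF S that] .
  show "S \<times> {0} \<subseteq> carrier G"
    using Sc by (auto simp: carrier_G)
  show "S \<times> {0 :: int} \<noteq> {}"
    using subgroup.one_closed[OF S] by blast
  show "inv\<^bsub>G\<^esub> g \<in> S \<times> {0}" if "g \<in> S \<times> {0}" for g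
    using that Sc subgroup.m_inv_closed[OF S] by (auto simp: inv_G)
  show "g \<otimes>\<^bsub>G\<^esub> h \<in> S \<times> {0}" if "g \<in> S \<times> {0}" "h \<in> S \<times> {0}" for g h
    using that Sc subgroup.m_closed[OF S] by (auto simp: mult_G)
qed

end

text \<open>The quotient \<open>\<sigma>(x, z) / \<sigma>(z, x)\<close> is multiplicative in \<open>x\<close>, here with denominators cleared. The
  elements in the radical of this bicharacter are the regular ones, which therefore form a subgroup.\<close>

lemma commutator_bicharacter:
  assumes H: "comm_group H" and \<sigma>: "\<sigma> \<in> two_cocycles H"
    and xyz: "x \<in> carrier H" "y \<in> carrier H" "z \<in> carrier H"
  shows "\<sigma> (x \<otimes>\<^bsub>H\<^esub> y) z * (\<sigma> z x * \<sigma> z y) = \<sigma> z (x \<otimes>\<^bsub>H\<^esub> y) * (\<sigma> x z * \<sigma> y z)"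
proof -
  interpret H: comm_group H by (rule H)
  interpret T: twisted_group H \<sigma> by unfold_locales (rule \<sigma>)
  have 1: "\<sigma> x y * \<sigma> (x \<otimes>\<^bsub>H\<^esub> y) z = \<sigma> y z * \<sigma> x (y \<otimes>\<^bsub>H\<^esub> z)"
    using T.sigma_cocycle[of x y z] xyz by simp
  have 2: "\<sigma> z x * \<sigma> (x \<otimes>\<^bsub>H\<^esub> z) y = \<sigma> x y * \<sigma> z (x \<otimes>\<^bsub>H\<^esub> y)"
    using T.sigma_cocycle[of z x y] xyz by (simp add: H.m_comm)
  have 3: "\<sigma> x z * \<sigma> (x \<otimes>\<^bsub>H\<^esub> z) y = \<sigma> z y * \<sigma> x (y \<otimes>\<^bsub>H\<^esub> z)"
    using T.sigma_cocycle[of x z y] xyz by (simp add: H.m_comm)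
  have nz: "\<sigma> x y \<noteq> 0" "\<sigma> (x \<otimes>\<^bsub>H\<^esub> z) y \<noteq> 0"
    using xyz by auto
  have cancel: "q * (t * v) = w * (m * r)"
    if "p * q = r * s" "t * u = p * w" "m * u = v * s" "p \<noteq> 0" "u \<noteq> 0" for p q r s t u v w m :: complex
  proof -
    have "(p * u) * (q * (t * v)) = (p * q) * (t * u) * v"
      by (simp only: mult_ac)
    also have "\<dots> = (r * s) * (p * w) * v"
      by (simp only: that(1,2))
    also have "\<dots> = p * w * r * (v * s)"
      by (simp only: mult_ac)
    also have "\<dots> = p * w * r * (m * u)"
      by (simp only: that(3))
    also have "\<dots> = (p * u) * (w * (m * r))"
      by (simp only: mult_ac)
    finally show ?thesis
      using that(4,5) by simp
  qed
  show ?thesis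
    by (rule cancel[OF 1 2 3 nz])
qed

lemma kleppner_condition_abelian:
  assumes H: "comm_group H"
  shows "kleppner_condition H \<sigma> \<longleftrightarrow>
    (\<forall>x\<in>carrier H. x \<noteq> \<one>\<^bsub>H\<^esub> \<longrightarrow> (\<exists>y\<in>carrier H. \<sigma> x y \<noteq> \<sigma> y x))"
proof -
  interpret H: comm_group H by (rule H)
  have "conjugacy_class H x = {x}" if "x \<in> carrier H" for x
  proof -
    have "h \<otimes>\<^bsub>H\<^esub> x \<otimes>\<^bsub>H\<^esub> inv\<^bsub>H\<^esub> h = x" if "h \<in> carrier H" for h
      using that \<open>x \<in> carrier H\<close> by (simp add: H.m_comm[of h x] H.m_assoc)
    then have "conjugacy_class H x = (\<lambda>h. x) ` carrier H"
      unfolding conjugacy_class_def by (rule image_cong[OF refl])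
    also have "\<dots> = {x}"
      using H.one_closed by (rule_tac image_constant)
    finally show ?thesis .
  qed
  moreover have "cocycle_regular H \<sigma> x \<longleftrightarrow> (\<forall>y\<in>carrier H. \<sigma> x y = \<sigma> y x)" if "x \<in> carrier H" for x
    using that H.m_comm by (simp add: cocycle_regular_def)
  ultimately show ?thesis
    by (auto simp: kleppner_condition_def)
qed

section \<open>Kleppner's condition for the semidirect product\<close>

locale semidirect_cocycle = group_automorphism H \<beta> + H: twisted_group H \<sigma>' + G: twisted_group G \<sigma>
  for H :: "('h, 'm) monoid_scheme" (structure) and \<beta> \<sigma>' \<sigma> +
  assumes comm: "comm_group H"
    and inf: "infinite (carrier H)"
    and ap: "aperiodic H \<beta>"
    and invariant: "x \<in> carrier H \<Longrightarrow> y \<in> carrier H \<Longrightarrow> \<sigma>' (B k x) (B k y) = \<sigma>' x y"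
    and extends: "x \<in> carrier H \<Longrightarrow> y \<in> carrier H \<Longrightarrow> \<sigma> (x, k) (y, l) = \<sigma>' x (B k y)"
begin

interpretation C: comm_group H by (rule comm)

text \<open>Averaging over \<open>H\<close>, in \<open>H\<close> itself and in \<open>G\<close>. A generator at \<open>(x, k)\<close> with \<open>k \<noteq> 0\<close> has
  infinitely many conjugates \<open>(y x \<beta>\<^sup>k(y)\<^sup>-\<^sup>1, k)\<close>, since \<open>y \<beta>\<^sup>k(y)\<^sup>-\<^sup>1\<close> determines \<open>y\<close>.\<close>

lemma kleppner_averaging:
  assumes K: "kleppner_condition H \<sigma>'"
  shows kleppner_simple_H: "simple_cstar H.A"
    and kleppner_simple_G: "simple_cstar G.A"
    and kleppner_unique_trace_G: "unique_trace_property G \<sigma>"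
proof -
  interpret AH: twisted_group_with_abelian_subgroup H \<sigma>' "carrier H"
    by unfold_locales (simp_all add: subgroup_self C.m_comm)
  interpret AG: twisted_group_with_abelian_subgroup G \<sigma> "carrier H \<times> {0}"
    by (intro twisted_group_with_abelian_subgroup.intro twisted_group_with_abelian_subgroup_axioms.intro
        G.twisted_group_axioms subgroup_times_zero subgroup_self) (auto simp: mult_G C.m_comm)
  have nonregular: "\<exists>y\<in>carrier H. \<sigma>' x y \<noteq> \<sigma>' y x" if "x \<in> carrier H" "x \<noteq> \<one>" for x
    using K that by (simp add: kleppner_condition_abelian[OF comm])
  have "AH.averages_to_zero (H.L x)" if "x \<in> carrier H" "x \<noteq> \<one>" for x
    using nonregular[OF that] AH.averages_to_zero_not_regular that(1) by blast
  then show "simple_cstar H.A"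
    by (rule AH.simple_of_averaging)
  have null0: "AG.averages_to_zero (G.L g)" if g: "g \<in> carrier H \<times> {0}" "g \<noteq> \<one>\<^bsub>G\<^esub>" for g
  proof -
    obtain x where x: "g = (x, 0)" "x \<in> carrier H" "x \<noteq> \<one>"
      using g by (auto simp: one_G)
    obtain y where y: "y \<in> carrier H" "\<sigma>' x y \<noteq> \<sigma>' y x"
      using nonregular x by blast
    show ?thesis
      using x y by (intro AG.averages_to_zero_not_regular[of g "(y, 0)"]) (auto simp: extends)
  qed
  have null: "AG.averages_to_zero (G.L g)" if g: "g \<in> carrier G" "g \<noteq> \<one>\<^bsub>G\<^esub>" for g
  proof (cases "g \<in> carrier H \<times> {0}")
    case False
    then obtain x k where x: "g = (x, k)" "x \<in> carrier H" and k: "k \<noteq> 0"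
      using g by (auto simp: carrier_G)
    show ?thesis
    proof (rule AG.averages_to_zero_infinite_orbit)
      show "inv\<^bsub>G\<^esub> g \<otimes>\<^bsub>G\<^esub> h \<otimes>\<^bsub>G\<^esub> g \<in> carrier H \<times> {0}" if "h \<in> carrier H \<times> {0}" for h
        using that x by (auto simp: inv_G mult_G)
      let ?c = "\<lambda>h. h \<otimes>\<^bsub>G\<^esub> g \<otimes>\<^bsub>G\<^esub> inv\<^bsub>G\<^esub> h"
      have "inj_on ?c (carrier H \<times> {0})"
      proof (rule inj_onI)
        fix h h' assume h: "h \<in> carrier H \<times> {0}" "h' \<in> carrier H \<times> {0}" and eq: "?c h = ?c h'"
        then obtain y z where yz: "h = (y, 0)" "y \<in> carrier H" "h' = (z, 0)" "z \<in> carrier H"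
          by auto
        have "y \<otimes> x \<otimes> inv (B k y) = z \<otimes> x \<otimes> inv (B k z)"
          using eq x yz by (simp add: inv_G mult_G B_inv)
        then have "x \<otimes> (y \<otimes> inv (B k y)) = x \<otimes> (z \<otimes> inv (B k z))"
          using x yz by (simp add: C.m_ac)
        then have "y \<otimes> inv (B k y) = z \<otimes> inv (B k z)"
          using x yz by simp
        then have "inv z \<otimes> (y \<otimes> inv (B k y)) \<otimes> B k y = inv z \<otimes> (z \<otimes> inv (B k z)) \<otimes> B k y"
          by simp
        then have "inv z \<otimes> y = inv (B k z) \<otimes> B k y"
        proof -
          have "inv z \<otimes> (y \<otimes> inv (B k y)) \<otimes> B k y = inv z \<otimes> y"
            using yz by (simp add: m_assoc)
          moreover have "inv z \<otimes> (z \<otimes> inv (B k z)) \<otimes> B k y = inv (B k z) \<otimes> B k y"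
            using yz by (simp add: m_assoc[symmetric])
          ultimately show ?thesis
            using \<open>inv z \<otimes> (y \<otimes> inv (B k y)) \<otimes> B k y = inv z \<otimes> (z \<otimes> inv (B k z)) \<otimes> B k y\<close>
            by (simp only:)
        qed
        moreover have "B k (inv z \<otimes> y) = inv (B k z) \<otimes> B k y"
          using yz by (simp add: B_mult B_inv)
        ultimately have "B k (inv z \<otimes> y) = inv z \<otimes> y"
          by (simp only:)
        then have "inv z \<otimes> y = \<one>"
          using yz by (intro aperiodic_fixed[OF ap k]) auto
        then show "h = h'"
          using yz by (metis inv_equality inv_inv inv_closed)
      qed
      then show "infinite (?c ` (carrier H \<times> {0}))"
        using inf by (auto simp: finite_image_iff finite_cartesian_product_iff)
    qed (use g null0 in auto)
  qed (use null0 g in blast)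
  show "simple_cstar G.A"
    by (rule AG.simple_of_averaging[OF null])
  show "unique_trace_property G \<sigma>"
    by (rule AG.unique_trace_of_averaging[OF null])
qed

text \<open>The regular elements form a \<open>\<beta>\<close>-invariant subgroup \<open>S\<close>. The function \<open>b\<close> on \<open>S\<close> is used twice:
  on \<open>H\<close>, and on \<open>G\<close> through the subgroup of pairs \<open>(x, 0)\<close> with \<open>x \<in> S\<close>, where invariance of \<open>b\<close>
  makes the functional tracial.\<close>

lemma not_kleppner:
  assumes K: "\<not> kleppner_condition H \<sigma>'"
  shows not_kleppner_not_simple_G: "\<not> simple_cstar G.A"
    and not_kleppner_not_unique_trace_G: "\<not> unique_trace_property G \<sigma>"
    and not_kleppner_not_minimal_H: "\<not> acts_minimally H.A (induced_automorphism H \<sigma>' \<beta>)"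
proof -
  define S where "S = {x \<in> carrier H. \<forall>y\<in>carrier H. \<sigma>' x y = \<sigma>' y x}"
  note bichar = commutator_bicharacter[OF comm H.cocycle]
  have S: "subgroup S H"
  proof (rule subgroupI)
    show "S \<subseteq> carrier H" "S \<noteq> {}"
      by (auto simp: S_def intro: exI[of _ \<one>])
    fix x assume x: "x \<in> S"
    then have xc: "x \<in> carrier H" and xr: "\<And>z. z \<in> carrier H \<Longrightarrow> \<sigma>' x z = \<sigma>' z x"
      by (auto simp: S_def)
    have "\<sigma>' (inv x) z = \<sigma>' z (inv x)" if z: "z \<in> carrier H" for z
      using bichar[OF xc inv_closed[OF xc] z] xc z xr[OF z] by simp
    then show "inv x \<in> S"
      using xc by (simp add: S_def)
    fix y assume "y \<in> S"
    then have yc: "y \<in> carrier H" and yr: "\<And>z. z \<in> carrier H \<Longrightarrow> \<sigma>' y z = \<sigma>' z y"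
      by (auto simp: S_def)
    have "\<sigma>' (x \<otimes> y) z = \<sigma>' z (x \<otimes> y)" if z: "z \<in> carrier H" for z
      using bichar[OF xc yc z] xc yc z xr[OF z] yr[OF z] by simp
    then show "x \<otimes> y \<in> S"
      using xc yc by (simp add: S_def)
  qed
  have Sc: "x \<in> carrier H" if "x \<in> S" for x
    using that by (simp add: S_def)
  have S_sym: "\<sigma>' x y = \<sigma>' y x" if "x \<in> S" "y \<in> carrier H" for x y
    using that by (simp add: S_def)
  have S_nontrivial: "\<exists>s\<in>S. s \<noteq> \<one>"
    using K by (auto simp: kleppner_condition_abelian[OF comm] S_def)
  have B_S: "B k x \<in> S" if x: "x \<in> S" for k x
  proof -
    have "\<sigma>' (B k x) y = \<sigma>' y (B k x)" if y: "y \<in> carrier H" for y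
    proof -
      obtain z where z: "z \<in> carrier H" "y = B k z"
        using B_bij[of k] y by (auto simp: bij_betw_def)
      then show ?thesis
        using invariant[of x z k] invariant[of z x k] S_sym[OF x, of z] Sc[OF x] by simp
    qed
    then show ?thesis
      using Sc[OF x] by (simp add: S_def)
  qed
  have B_S_iff: "B k x \<in> S \<longleftrightarrow> x \<in> S" if "x \<in> carrier H" for k x
    using B_S[of "B k x" "- k"] B_S[of x k] that by (auto simp: B_add[symmetric])
  obtain b where b: "\<And>x. x \<in> S \<Longrightarrow> cmod (b x) = 1"
    "\<And>x y. x \<in> S \<Longrightarrow> y \<in> S \<Longrightarrow> b x * b y = \<sigma>' x y * b (x \<otimes> y)"
    and b_inv: "\<And>x. x \<in> S \<Longrightarrow> b (B 1 x) = b x"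
  proof (rule invariant_trivialization[OF comm H.cocycle S, of "B 1"])
    show "x = \<one>" if "x \<in> S" "B 1 x = x" for x
      using aperiodic_fixed[OF ap, of 1 x] that Sc by simp
  qed (use S_sym Sc B_S B_mult invariant in \<open>auto simp del: B_1\<close>)
  have b_B: "b (B k x) = b x" if x: "x \<in> S" for k x
  proof (induction k rule: int_induct[where k = 0])
    case (step1 i)
    have "B (i + 1) x = B 1 (B i x)"
      using Sc[OF x] by (simp only: B_add[symmetric] add.commute)
    then show ?case
      using step1 b_inv[OF B_S[OF x]] by simp
  next
    case (step2 i)
    have "B i x = B 1 (B (i - 1) x)"
      using Sc[OF x] by (simp only: B_add[symmetric]) simp
    then show ?case
      using step2 b_inv[OF B_S[OF x], of "i - 1"] by simp
  qed (use Sc[OF x] in simp)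
  \<comment> \<open>If a product is regular then its factors commute in the twisted sense.\<close>
  have prod_sym: "\<sigma>' x z = \<sigma>' z x" if xz: "x \<in> carrier H" "z \<in> carrier H" "x \<otimes> z \<in> S" for x z
  proof -
    have "\<sigma>' (x \<otimes> z) z = \<sigma>' z (x \<otimes> z)"
      using S_sym[OF xz(3,2)] .
    then show ?thesis
      using bichar[OF xz(1,2,2)] xz by simp
  qed
  interpret TH0: trivialized_cocycle H \<sigma>' S b
    by (intro trivialized_cocycle.intro trivialized_cocycle_axioms.intro
        twisted_group_with_abelian_subgroup.intro twisted_group_with_abelian_subgroup_axioms.intro
        H.twisted_group_axioms S) (use Sc b C.m_comm in auto)
  interpret TH: trivialized_cocycle_trace H \<sigma>' S b
    by unfold_locales
      (use S_nontrivial prod_sym C.m_comm in \<open>auto simp: TH0.b_ext_def\<close>)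
  have b_ext_B: "TH0.b_ext (B k x) = TH0.b_ext x" if "x \<in> carrier H" for k x
    using that by (simp add: TH0.b_ext_def B_S_iff b_B)
  show "\<not> acts_minimally H.A (induced_automorphism H \<sigma>' \<beta>)"
  proof (rule TH.not_minimal)
    show "star_automorphism H.A (induced_automorphism H \<sigma>' \<beta>)"
      using H.induced_automorphism_spec(1)[of "B 1", OF B_bij B_mult invariant] by (simp only: B_1)
    show "\<beta> x \<in> carrier H \<and> induced_automorphism H \<sigma>' \<beta> (H.L x) = H.L (\<beta> x) \<and> TH0.b_ext (\<beta> x) = TH0.b_ext x"
      if "x \<in> carrier H" for x
      using B_closed[OF that, of 1] b_ext_B[OF that, of 1]
        H.induced_automorphism_spec(2)[of "B 1", OF B_bij B_mult invariant that] by (simp only: B_1)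
  qed
  have SG: "subgroup (S \<times> {0}) G"
    by (rule subgroup_times_zero[OF S])
  interpret TG0: trivialized_cocycle G \<sigma> "S \<times> {0}" "\<lambda>g. b (fst g)"
    by (intro trivialized_cocycle.intro trivialized_cocycle_axioms.intro
        twisted_group_with_abelian_subgroup.intro twisted_group_with_abelian_subgroup_axioms.intro
        G.twisted_group_axioms SG) (use Sc b C.m_comm in \<open>auto simp: mult_G extends\<close>)
  interpret TG: trivialized_cocycle_trace G \<sigma> "S \<times> {0}" "\<lambda>g. b (fst g)"
  proof unfold_locales
    fix g h assume "g \<in> carrier G" "h \<in> carrier G"
    then obtain x k y l where g: "g = (x, k)" "x \<in> carrier H" and h: "h = (y, l)" "y \<in> carrier H"
      by (auto simp: carrier_G)
    show "\<sigma> g h * TG0.b_ext (g \<otimes>\<^bsub>G\<^esub> h) = \<sigma> h g * TG0.b_ext (h \<otimes>\<^bsub>G\<^esub> g)"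
    proof (cases "k + l = 0")
      case True
      then have l: "l = - k"
        by simp
      have yx: "B k (y \<otimes> B l x) = x \<otimes> B k y"
        using g h by (simp add: l B_mult B_add[symmetric] C.m_comm)
      have "\<sigma> h g = \<sigma>' (B k y) (B k (B l x))"
        using g h by (simp add: extends invariant)
      then have "\<sigma> h g = \<sigma>' (B k y) x"
        using g by (simp add: l B_add[symmetric])
      moreover have "TG0.b_ext (h \<otimes>\<^bsub>G\<^esub> g) = TH0.b_ext (x \<otimes> B k y)"
        using g h True b_ext_B[of "y \<otimes> B l x" k]
        by (simp add: yx mult_G TG0.b_ext_def TH0.b_ext_def add.commute)
      moreover have "TG0.b_ext (g \<otimes>\<^bsub>G\<^esub> h) = TH0.b_ext (x \<otimes> B k y)"
        using g h True by (simp add: mult_G TG0.b_ext_def TH0.b_ext_def)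
      moreover have "\<sigma> g h = \<sigma>' x (B k y)"
        using g h by (simp add: extends)
      ultimately show ?thesis
        using prod_sym[of x "B k y"] g h by (simp add: TH0.b_ext_def)
    next
      case False
      then show ?thesis
        using g h by (simp add: mult_G TG0.b_ext_def add.commute)
    qed
  next
    show "\<exists>s\<in>S \<times> {0}. s \<noteq> \<one>\<^bsub>G\<^esub>"
      using S_nontrivial by (auto simp: one_G)
  qed
  show "\<not> simple_cstar G.A"
    by (rule TG.not_simple)
  show "\<not> unique_trace_property G \<sigma>"
    by (rule TG.not_unique_trace)
qed

lemma simple_imp_minimal:
  assumes "simple_cstar H.A"
  shows "acts_minimally H.A (induced_automorphism H \<sigma>' \<beta>)"
proof -
  let ?\<Phi> = "induced_automorphism H \<sigma>' \<beta>"
  have star: "star_automorphism H.A ?\<Phi>"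
    using H.induced_automorphism_spec(1)[of "B 1", OF B_bij B_mult invariant] by (simp only: B_1)
  have "0 \<in> H.A"
    using H.A_subspace by (simp add: complex_subspace_def)
  then have "?\<Phi> (op_scaleC 0 0) = op_scaleC 0 (?\<Phi> 0)"
    using star unfolding star_automorphism_def by blast
  then have zero: "?\<Phi> ` {0} = {0}"
    by simp
  have "{I. closed_ideal H.A I \<and> I \<noteq> H.A \<and> ?\<Phi> ` I = I} =
      {I. closed_ideal H.A I \<and> I \<noteq> H.A} \<inter> {I. ?\<Phi> ` I = I}"
    by blast
  also have "\<dots> = {{0}} \<inter> {I. ?\<Phi> ` I = I}"
    using assms by (simp only: simple_cstar_def)
  also have "\<dots> = {{0}}"
    using zero by simp
  finally show ?thesis
    by (simp add: acts_minimally_def)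
qed

end

theorem theorem5p1:
  fixes H :: "('h, 'm) monoid_scheme" and \<beta> :: "'h \<Rightarrow> 'h"
    and G :: "('h \<times> int) monoid"
    and \<sigma>' :: "'h \<Rightarrow> 'h \<Rightarrow> complex"
    and \<sigma> :: "'h \<times> int \<Rightarrow> 'h \<times> int \<Rightarrow> complex"
  assumes H: "comm_group H" "infinite (carrier H)"
    and \<beta>: "\<beta> \<in> auto H" "aperiodic H \<beta>"
    and G: "G = semidirect_product H integer_group (aut_power H \<beta>)"
    and \<sigma>': "\<sigma>' \<in> two_cocycles H"
      "\<forall>k. \<forall>x\<in>carrier H. \<forall>y\<in>carrier H. \<sigma>' (aut_power H \<beta> k x) (aut_power H \<beta> k y) = \<sigma>' x y"
    and \<sigma>: "\<sigma> \<in> two_cocycles G"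
      "\<forall>x\<in>carrier H. \<forall>y\<in>carrier H. \<forall>k l. \<sigma> (x, k) (y, l) = \<sigma>' x (aut_power H \<beta> k y)"
  shows "(kleppner_condition H \<sigma>' \<longleftrightarrow> unique_trace_property G \<sigma>) \<and>
    (kleppner_condition H \<sigma>' \<longrightarrow> cstar_simple G \<sigma>) \<and>
    (countable (carrier H) \<longrightarrow>
      (cstar_simple G \<sigma> \<longleftrightarrow>
        acts_minimally (reduced_twisted_cstar H \<sigma>') (induced_automorphism H \<sigma>' \<beta>)))"
proof -
  interpret C: comm_group H
    by (rule H)
  interpret P: group_automorphism H \<beta>
    by unfold_locales (rule \<beta>)
  interpret semidirect_cocycle H \<beta> \<sigma>' \<sigma>
    unfolding semidirect_cocycle_def semidirect_cocycle_axioms_def twisted_group_def twisted_group_axioms_def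
    using H \<beta> G \<sigma>' \<sigma> P.group_automorphism_axioms P.group_G C.is_group by auto
  show ?thesis
    unfolding G cstar_simple_def
    using kleppner_simple_H kleppner_simple_G kleppner_unique_trace_G simple_imp_minimal
      not_kleppner_not_simple_G not_kleppner_not_unique_trace_G not_kleppner_not_minimal_H
    by blast
qed

end
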